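(* For all measurable subsets $A\subset\mathbb{R}^n$, for all $0\le\rho<1$ and $q>1$, one has $$\mathcal{S}^q_\rho(H(A))\ \ge\ \mathcal{S}^q_\rho(A).$$ Moreover, equality holds if and only if the symmetric difference between $A$ and $H(A)$ has measure zero.
   Context: $\gamma$ is the standard Gaussian measure on $\mathbb{R}^n$. For $X,Y$ independent standard Gaussian vectors in $\mathbb{R}^n$, the $q$-stability of a measurable set $A\subset\mathbb{R}^n$ with parameter $\rho$ is $$\mathcal{S}^q_\rho(A)=\mathbb{E}\Big[\mathbb{P}\big(\sqrt{\rho}\,X+\sqrt{1-\rho}\,Y\in A\ \big|\ X\big)^q\Big].$$ Let $v(A)=\int_A x\,d\gamma(x)\in\mathbb{R}^n$ if this integral is nonzero, and otherwise let $v(A)=e_1$ for some fixed unit vector $e_1$. Let $H(A)$ be the half-space $H(A)=\{x:\langle x,v(A)\rangle\ge\alpha\}$, where $\alpha$ is chosen such that $\gamma(H(A))=\gamma(A)$.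
   Formalization: The claim that equality forces the symmetric difference of A and H(A) to have measure zero is stated only for 0 < ρ < 1; at ρ = 0 both stabilities equal γ(A)^q for every A, so equality always holds and that direction is false there. *)

theory Defs
  imports "HOL-Probability.Probability"
begin

definition std_gaussian_density :: "'a::euclidean_space \<Rightarrow> real" where
  "std_gaussian_density x = (\<Prod>b\<in>Basis. std_normal_density (x \<bullet> b))"

(* Taken over lebesgue rather than lborel, so that every Lebesgue measurable set is measurable. *)
definition std_gaussian :: "'a::euclidean_space measure" where
  "std_gaussian = density lebesgue (\<lambda>x. ennreal (std_gaussian_density x))"

definition independent_std_gaussians ::
    "'w measure \<Rightarrow> ('w \<Rightarrow> 'a::euclidean_space) \<Rightarrow> ('w \<Rightarrow> 'a) \<Rightarrow> bool" where
  "independent_std_gaussians M X Y \<longleftrightarrow>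
     prob_space M \<and>
     distributed M lborel X (\<lambda>x. ennreal (std_gaussian_density x)) \<and>
     distributed M lborel Y (\<lambda>x. ennreal (std_gaussian_density x)) \<and>
     prob_space.indep_var M borel X borel Y"

(* P(Z \<in> A | X): the conditional expectation of the indicator of the event given the
   sigma-algebra generated by X.  The probability space is completed because for a Lebesgue
   (non-Borel) set A the event {Z \<in> A} need not belong to sets M; for Borel A the completion
   makes no difference. *)
definition cond_prob_in ::
    "'w measure \<Rightarrow> ('w \<Rightarrow> 'a::euclidean_space) \<Rightarrow> ('w \<Rightarrow> 'a) \<Rightarrow> 'a set \<Rightarrow> 'w \<Rightarrow> real" where
  "cond_prob_in M X Z A =
     real_cond_exp (completion M) (vimage_algebra (space M) X borel)
       (indicator {\<omega> \<in> space M. Z \<omega> \<in> A})"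

definition q_stability ::
    "'w measure \<Rightarrow> ('w \<Rightarrow> 'a::euclidean_space) \<Rightarrow> ('w \<Rightarrow> 'a) \<Rightarrow> real \<Rightarrow> real \<Rightarrow> 'a set \<Rightarrow> real" where
  "q_stability M X Y q \<rho> A =
     (\<integral>\<omega>. cond_prob_in M X (\<lambda>\<omega>. sqrt \<rho> *\<^sub>R X \<omega> + sqrt (1 - \<rho>) *\<^sub>R Y \<omega>) A \<omega> powr q
        \<partial>completion M)"

definition gaussian_moment_dir :: "'a::euclidean_space \<Rightarrow> 'a set \<Rightarrow> 'a" where
  "gaussian_moment_dir e A =
     (let m = (\<integral>x\<in>A. x \<partial>std_gaussian) in if m \<noteq> 0 then m else e)"

(* The threshold is an extended real: for sets of Gaussian measure 0 and 1 it has to be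
   \<infinity> and -\<infinity>, giving the empty set and the whole space. *)
definition gaussian_threshold :: "'a::euclidean_space \<Rightarrow> 'a set \<Rightarrow> ereal" where
  "gaussian_threshold e A =
     (SOME \<alpha>. measure std_gaussian {x. \<alpha> \<le> ereal (x \<bullet> gaussian_moment_dir e A)}
                = measure std_gaussian A)"

definition gaussian_halfspace :: "'a::euclidean_space \<Rightarrow> 'a set \<Rightarrow> 'a set" where
  "gaussian_halfspace e A =
     {x. gaussian_threshold e A \<le> ereal (x \<bullet> gaussian_moment_dir e A)}"

end

theory Submission
  imports Defs "HOL-Real_Asymp.Real_Asymp"
begin

text \<open>Let \<open>Z\<close> be standard Gaussian and write \<open>heat v f x = E f (x + sqrt v * Z)\<close>. Conditioning on \<open>X\<close> turns the
\<open>q\<close>-stability of \<open>A\<close> into \<open>heat \<rho> ((heat (1 - \<rho>) f) powr q) 0\<close>, where \<open>f\<close> is the indicator of a Borel set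
that agrees with \<open>A\<close> almost everywhere (\<open>q_stability_eq_heat\<close>). For a convex profile \<open>\<psi>\<close> and a half-space \<open>f\<close> the
number \<open>heat (v - w) (\<psi> \<circ> heat w f) x\<close> depends on \<open>f\<close> and \<open>x\<close> only through \<open>m = heat v f x\<close>; it is
\<open>halfspace_value \<psi> c m\<close> with \<open>c = sqrt (w / v)\<close>. The theorem is that for every \<open>f\<close> with values in \<open>[0, 1]\<close> this
number is at most \<open>halfspace_value \<psi> c (heat v f x)\<close>.

The reason is a comparison of martingales. If \<open>W\<close> is a Brownian motion, \<open>heat (1 - s) f (W\<^sub>s)\<close> is a martingale whose
speed is governed by the gradient of the heat flow, that is, by the Gaussian moment \<open>E k(Z) Z\<close> of a rescaled copy
\<open>k\<close> of \<open>f\<close>. Among all \<open>k\<close> with values in \<open>[0, 1]\<close> and a given mean, half-spaces have the longest moment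
(\<open>gauss_moment_le_phi\<close>), so at equal current value the martingale of a half-space is the faster one. Since
\<open>halfspace_value \<psi> c\<close> is convex, being slower can only decrease the final expectation of \<open>\<psi>\<close>.

This is carried out without stochastic calculus. The time from \<open>w\<close> to \<open>v\<close> is cut into \<open>N\<close> equal steps. In one step
the value function is expanded to second order, both for \<open>f\<close> and for a half-line with the same mean; for the
half-line the value is reproduced exactly (\<open>integral_V_halfline\<close>), so that only the difference of the second
moments and a third-order error remain (\<open>V_step\<close>). The errors add up to \<open>N\<close> times a multiple of
\<open>N powr (- 3 / 2)\<close> and vanish in the limit (\<open>heat_profile_le_interior\<close>). The second moments come from an explicit
expansion of Gaussian averages (\<open>mehler_increment_moments\<close>), which rests on the translation formula for the Gaussian
density and on the rotation invariance of a pair of independent Gaussian vectors.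

If \<open>f\<close> is not a half-space up to a null set, the first step already loses a positive amount of second order in the
step length, which beats the third-order error; this gives the equality case (\<open>heat_profile_eq_imp\<close>). The power
\<open>t powr q\<close> is not smooth at \<open>0\<close>, so it is written as a limit of smooth convex profiles plus a small multiple of an
integer power; the latter is smooth and strictly convex and carries the equality case (\<open>heat_powr_le\<close>).\<close>

section \<open>The standard Gaussian measure\<close>

text \<open>The Borel version of the Gaussian measure on Lebesgue sets; the latter is its completion.\<close>

definition gauss :: "'a::euclidean_space measure" where
  "gauss = density lborel (\<lambda>x. ennreal (std_gaussian_density x))"

lemma std_gaussian_density_eq_exp:
  fixes x :: "'a::euclidean_space"
  shows "std_gaussian_density x = (1 / sqrt (2 * pi)) ^ DIM('a) * exp (- (norm x)\<^sup>2 / 2)"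
proof -
  have "(norm x)\<^sup>2 = (\<Sum>b\<in>Basis. (x \<bullet> b)\<^sup>2)"
    unfolding power2_norm_eq_inner by (subst euclidean_inner) (simp add: power2_eq_square)
  then have "- (norm x)\<^sup>2 / 2 = (\<Sum>b\<in>Basis. - (x \<bullet> b)\<^sup>2 / 2)"
    by (simp add: sum_negf sum_divide_distrib)
  then show ?thesis
    by (simp add: std_gaussian_density_def std_normal_density_def prod.distrib prod_dividef exp_sum power_one_over)
qed

lemma std_gaussian_density_pos: "0 < std_gaussian_density x"
  by (simp add: std_gaussian_density_eq_exp)

lemma std_gaussian_density_nonneg [simp]: "0 \<le> std_gaussian_density x"
  using std_gaussian_density_pos[of x] by simp

lemma borel_measurable_std_gaussian_density [measurable]:
  "std_gaussian_density \<in> borel_measurable borel"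
  unfolding std_gaussian_density_def by measurable

lemma sets_gauss [simp, measurable_cong]: "sets gauss = sets borel"
  and space_gauss [simp]: "space gauss = UNIV"
  by (simp_all add: gauss_def)

lemma gauss_real: "gauss = density lborel (\<lambda>x. ennreal (std_normal_density x))"
  by (simp add: gauss_def std_gaussian_density_def)

lemma prob_space_gauss: "prob_space (gauss :: 'a::euclidean_space measure)"
proof
  have one: "(\<integral>\<^sup>+ x. ennreal (std_normal_density x) \<partial>lborel) = 1"
    using prob_space.emeasure_space_1[OF prob_space_normal_density[of 1 0]]
    by (simp add: emeasure_density)
  have "emeasure (gauss :: 'a measure) (space gauss) = (\<integral>\<^sup>+ (x::'a). ennreal (std_gaussian_density x) \<partial>lborel)"
    by (simp add: gauss_def emeasure_density)
  also have "\<dots> = (\<integral>\<^sup>+ (x::'a). (\<Prod>b\<in>Basis. ennreal (std_normal_density (x \<bullet> b))) \<partial>lborel)"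
    by (simp add: std_gaussian_density_def prod_ennreal)
  also have "\<dots> = (\<Prod>b\<in>(Basis::'a set). (\<integral>\<^sup>+ x. ennreal (std_normal_density x) \<partial>lborel))"
    by (rule nn_integral_lborel_prod) auto
  finally show "emeasure (gauss :: 'a measure) (space gauss) = 1"
    by (simp add: one)
qed

interpretation gauss: prob_space gauss
  by (rule prob_space_gauss)

interpretation gauss_pair: pair_prob_space gauss gauss ..

lemma nn_integral_gauss:
  assumes [measurable]: "f \<in> borel_measurable borel"
  shows "(\<integral>\<^sup>+x. f x \<partial>gauss) = (\<integral>\<^sup>+x. ennreal (std_gaussian_density x) * f x \<partial>lborel)"
  unfolding gauss_def by (subst nn_integral_density) auto

lemma AE_gauss_iff: "(AE x in gauss. P x) \<longleftrightarrow> (AE x in lborel. P x)"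
  unfolding gauss_def by (subst AE_density) (auto simp: std_gaussian_density_pos)

lemma nn_integral_lborel_affine:
  fixes t :: "'a::euclidean_space"
  assumes [measurable]: "f \<in> borel_measurable borel" and c: "c \<noteq> 0"
  shows "(\<integral>\<^sup>+x. f x \<partial>lborel) = ennreal (\<bar>c\<bar> ^ DIM('a)) * (\<integral>\<^sup>+x. f (t + c *\<^sub>R x) \<partial>lborel)"
  by (subst lborel_affine[OF c, of t])
     (simp add: nn_integral_density nn_integral_distr nn_integral_cmult)

text \<open>The Cameron-Martin formula; the density comes from completing the square in the exponent.\<close>

lemma distr_gauss_translate:
  fixes q :: "'a::euclidean_space"
  shows "distr gauss borel (\<lambda>z. z + q) = density gauss (\<lambda>z. ennreal (exp (q \<bullet> z - (norm q)\<^sup>2 / 2)))"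
proof (rule measure_eqI)
  fix A :: "'a set" assume "A \<in> sets (distr gauss borel (\<lambda>z. z + q))"
  then have [measurable]: "A \<in> sets borel" by simp
  have eq: "std_gaussian_density (x - q) = std_gaussian_density x * exp (q \<bullet> x - (norm q)\<^sup>2 / 2)" for x
  proof -
    have "- (norm (x - q))\<^sup>2 / 2 = - (norm x)\<^sup>2 / 2 + (q \<bullet> x - (norm q)\<^sup>2 / 2)"
      by (simp add: power2_norm_eq_inner inner_diff inner_commute field_simps)
    then show ?thesis by (simp only: std_gaussian_density_eq_exp exp_add mult.assoc)
  qed
  have "emeasure (distr gauss borel (\<lambda>z. z + q)) A = (\<integral>\<^sup>+z. indicator A z \<partial>distr gauss borel (\<lambda>z. z + q))"
    by simp
  also have "\<dots> = (\<integral>\<^sup>+z. indicator A (z + q) \<partial>gauss)"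
    by (subst nn_integral_distr) auto
  also have "\<dots> = (\<integral>\<^sup>+z. ennreal (std_gaussian_density z) * indicator A (z + q) \<partial>lborel)"
    by (subst nn_integral_gauss) auto
  also have "\<dots> = (\<integral>\<^sup>+z. ennreal (std_gaussian_density (z - q)) * indicator A z \<partial>lborel)"
    by (subst nn_integral_lborel_affine[where c = 1 and t = "- q"]) auto
  also have "\<dots> = (\<integral>\<^sup>+z. ennreal (exp (q \<bullet> z - (norm q)\<^sup>2 / 2)) * indicator A z \<partial>gauss)"
    by (subst nn_integral_gauss) (auto simp: eq ennreal_mult' mult.assoc intro!: nn_integral_cong)
  finally show "emeasure (distr gauss borel (\<lambda>z. z + q)) A =
      emeasure (density gauss (\<lambda>z. ennreal (exp (q \<bullet> z - (norm q)\<^sup>2 / 2)))) A"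
    by (simp add: emeasure_density)
qed simp

lemma gauss_translate:
  fixes f :: "'a::euclidean_space \<Rightarrow> 'b::{banach, second_countable_topology}"
  assumes [measurable]: "f \<in> borel_measurable borel"
  shows "(\<integral>z. f (z + q) \<partial>gauss) = (\<integral>z. exp (q \<bullet> z - (norm q)\<^sup>2 / 2) *\<^sub>R f z \<partial>gauss)"
    and "integrable gauss (\<lambda>z. f (z + q)) \<longleftrightarrow>
         integrable gauss (\<lambda>z. exp (q \<bullet> z - (norm q)\<^sup>2 / 2) *\<^sub>R f z)"
proof -
  have "(\<integral>z. f (z + q) \<partial>gauss) = (\<integral>z. f z \<partial>distr gauss borel (\<lambda>z. z + q))"
    by (subst integral_distr) auto
  also have "\<dots> = (\<integral>z. exp (q \<bullet> z - (norm q)\<^sup>2 / 2) *\<^sub>R f z \<partial>gauss)"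
    unfolding distr_gauss_translate by (subst integral_density) auto
  finally show "(\<integral>z. f (z + q) \<partial>gauss) = (\<integral>z. exp (q \<bullet> z - (norm q)\<^sup>2 / 2) *\<^sub>R f z \<partial>gauss)" .
  have "integrable gauss (\<lambda>z. f (z + q)) \<longleftrightarrow> integrable (distr gauss borel (\<lambda>z. z + q)) f"
    by (subst integrable_distr_eq) auto
  also have "\<dots> \<longleftrightarrow> integrable gauss (\<lambda>z. exp (q \<bullet> z - (norm q)\<^sup>2 / 2) *\<^sub>R f z)"
    unfolding distr_gauss_translate by (subst integrable_density) auto
  finally show "integrable gauss (\<lambda>z. f (z + q)) \<longleftrightarrow>
         integrable gauss (\<lambda>z. exp (q \<bullet> z - (norm q)\<^sup>2 / 2) *\<^sub>R f z)" .
qed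

text \<open>The joint density of two independent standard Gaussian vectors depends on \<open>|x|\<^sup>2 + |y|\<^sup>2\<close> only, and rotating the pair
preserves both this quantity and Lebesgue measure. The rotation is performed as two affine substitutions, one in
each variable; the first divides by \<open>c\<close>, which is why \<open>c\<close> has to be nonzero.\<close>

lemma nn_integral_gauss_rotate:
  fixes F :: "'a::euclidean_space \<times> 'a \<Rightarrow> ennreal"
  assumes [measurable]: "F \<in> borel_measurable (borel \<Otimes>\<^sub>M borel)"
    and cs: "c\<^sup>2 + s\<^sup>2 = 1" and c: "0 < c"
  shows "(\<integral>\<^sup>+p. F (c *\<^sub>R fst p + s *\<^sub>R snd p, c *\<^sub>R snd p - s *\<^sub>R fst p) \<partial>(gauss \<Otimes>\<^sub>M gauss))
       = (\<integral>\<^sup>+p. F p \<partial>(gauss \<Otimes>\<^sub>M gauss))"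
proof -
  let ?g = "\<lambda>x::'a. ennreal (std_gaussian_density x)"
  have gg: "(gauss \<Otimes>\<^sub>M gauss :: ('a \<times> 'a) measure) = density (lborel \<Otimes>\<^sub>M lborel) (\<lambda>(x,y). ?g x * ?g y)"
    unfolding gauss_def
    by (rule pair_measure_density)
       (auto simp: lborel.sigma_finite_measure_axioms prob_space_gauss[unfolded gauss_def, THEN prob_space_imp_sigma_finite])
  have iter: "(\<integral>\<^sup>+p. H p \<partial>(gauss \<Otimes>\<^sub>M gauss)) = (\<integral>\<^sup>+y. \<integral>\<^sup>+x. ?g x * ?g y * H (x,y) \<partial>lborel \<partial>lborel)"
    if [measurable]: "H \<in> borel_measurable (borel \<Otimes>\<^sub>M borel)" for H :: "'a \<times> 'a \<Rightarrow> ennreal"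
  proof -
    have "(\<integral>\<^sup>+p. H p \<partial>(gauss \<Otimes>\<^sub>M gauss)) = (\<integral>\<^sup>+p. ?g (fst p) * ?g (snd p) * H p \<partial>(lborel \<Otimes>\<^sub>M lborel))"
      unfolding gg by (subst nn_integral_density) (auto simp: split_beta)
    also have "\<dots> = (\<integral>\<^sup>+y. \<integral>\<^sup>+x. ?g x * ?g y * H (x,y) \<partial>lborel \<partial>lborel)"
      by (subst lborel_pair.nn_integral_snd[symmetric]) auto
    finally show ?thesis .
  qed
  have c0: "c \<noteq> 0" using c by simp
  have gid: "?g (c *\<^sub>R y - s *\<^sub>R w) * ?g (s *\<^sub>R y + c *\<^sub>R w) = ?g y * ?g w" for y w
  proof -
    have e1: "(norm (c *\<^sub>R y - s *\<^sub>R w))\<^sup>2 = c\<^sup>2 * (norm y)\<^sup>2 - 2 * (c * s * (y \<bullet> w)) + s\<^sup>2 * (norm w)\<^sup>2"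
      unfolding power2_norm_eq_inner
      by (simp add: inner_diff inner_add inner_commute power2_eq_square algebra_simps)
    have e2: "(norm (s *\<^sub>R y + c *\<^sub>R w))\<^sup>2 = s\<^sup>2 * (norm y)\<^sup>2 + 2 * (c * s * (y \<bullet> w)) + c\<^sup>2 * (norm w)\<^sup>2"
      unfolding power2_norm_eq_inner
      by (simp add: inner_diff inner_add inner_commute power2_eq_square algebra_simps)
    have "(norm (c *\<^sub>R y - s *\<^sub>R w))\<^sup>2 + (norm (s *\<^sub>R y + c *\<^sub>R w))\<^sup>2
        = (c\<^sup>2 + s\<^sup>2) * (norm y)\<^sup>2 + (c\<^sup>2 + s\<^sup>2) * (norm w)\<^sup>2"
      unfolding e1 e2 by (simp add: algebra_simps)
    then have *: "- (norm (c *\<^sub>R y - s *\<^sub>R w))\<^sup>2 / 2 + - (norm (s *\<^sub>R y + c *\<^sub>R w))\<^sup>2 / 2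
        = - (norm y)\<^sup>2 / 2 + - (norm w)\<^sup>2 / 2" by (simp add: cs field_simps)
    have "exp (- (norm (c *\<^sub>R y - s *\<^sub>R w))\<^sup>2 / 2) * exp (- (norm (s *\<^sub>R y + c *\<^sub>R w))\<^sup>2 / 2)
        = exp (- (norm y)\<^sup>2 / 2) * exp (- (norm w)\<^sup>2 / 2)"
      unfolding exp_add[symmetric] * ..
    then show ?thesis
      by (simp add: ennreal_mult'[symmetric] std_gaussian_density_eq_exp mult.commute mult.left_commute)
  qed
  have "(\<integral>\<^sup>+p. F (c *\<^sub>R fst p + s *\<^sub>R snd p, c *\<^sub>R snd p - s *\<^sub>R fst p) \<partial>(gauss \<Otimes>\<^sub>M gauss))
      = (\<integral>\<^sup>+y. \<integral>\<^sup>+x. ?g x * ?g y * F (c *\<^sub>R x + s *\<^sub>R y, c *\<^sub>R y - s *\<^sub>R x) \<partial>lborel \<partial>lborel)"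
    by (subst iter) auto
  also have "\<dots> = (\<integral>\<^sup>+y. ennreal (\<bar>1/c\<bar> ^ DIM('a)) *
      (\<integral>\<^sup>+x. ?g ((1/c) *\<^sub>R (x - s *\<^sub>R y)) * ?g y * F (x, (1/c) *\<^sub>R (y - s *\<^sub>R x)) \<partial>lborel) \<partial>lborel)"
  proof (rule nn_integral_cong)
    fix y :: 'a
    have a1: "- (s/c) *\<^sub>R y + (1/c) *\<^sub>R x = (1/c) *\<^sub>R (x - s *\<^sub>R y)" for x
      by (simp add: scaleR_diff_right)
    have a2: "c *\<^sub>R ((1/c) *\<^sub>R (x - s *\<^sub>R y)) + s *\<^sub>R y = x" for x using c0 by simp
    have a3: "c *\<^sub>R y - s *\<^sub>R ((1/c) *\<^sub>R (x - s *\<^sub>R y)) = (1/c) *\<^sub>R (y - s *\<^sub>R x)" for x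
    proof -
      have "c *\<^sub>R (c *\<^sub>R y - s *\<^sub>R ((1/c) *\<^sub>R (x - s *\<^sub>R y))) = (c\<^sup>2 + s\<^sup>2) *\<^sub>R y - s *\<^sub>R x"
        using c0 by (simp add: scaleR_diff_right scaleR_add_left power2_eq_square)
      also have "\<dots> = c *\<^sub>R ((1/c) *\<^sub>R (y - s *\<^sub>R x))" using c0 by (simp add: cs)
      finally show ?thesis using c0 by (metis scaleR_left_imp_eq)
    qed
    show "(\<integral>\<^sup>+x. ?g x * ?g y * F (c *\<^sub>R x + s *\<^sub>R y, c *\<^sub>R y - s *\<^sub>R x) \<partial>lborel)
      = ennreal (\<bar>1/c\<bar> ^ DIM('a)) *
      (\<integral>\<^sup>+x. ?g ((1/c) *\<^sub>R (x - s *\<^sub>R y)) * ?g y * F (x, (1/c) *\<^sub>R (y - s *\<^sub>R x)) \<partial>lborel)"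
      using c0
      by (subst nn_integral_lborel_affine[where c = "1/c" and t = "- (s/c) *\<^sub>R y"])
         (simp_all only: a1 a2 a3, auto)
  qed
  also have "\<dots> = ennreal (\<bar>1/c\<bar> ^ DIM('a)) *
      (\<integral>\<^sup>+y. \<integral>\<^sup>+x. ?g ((1/c) *\<^sub>R (x - s *\<^sub>R y)) * ?g y * F (x, (1/c) *\<^sub>R (y - s *\<^sub>R x)) \<partial>lborel \<partial>lborel)"
    by (subst nn_integral_cmult) auto
  also have "(\<integral>\<^sup>+y. \<integral>\<^sup>+x. ?g ((1/c) *\<^sub>R (x - s *\<^sub>R y)) * ?g y * F (x, (1/c) *\<^sub>R (y - s *\<^sub>R x)) \<partial>lborel \<partial>lborel)
     = (\<integral>\<^sup>+x. \<integral>\<^sup>+y. ?g ((1/c) *\<^sub>R (x - s *\<^sub>R y)) * ?g y * F (x, (1/c) *\<^sub>R (y - s *\<^sub>R x)) \<partial>lborel \<partial>lborel)"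
    by (rule lborel_pair.Fubini') auto
  also have "\<dots> = (\<integral>\<^sup>+x. ennreal (\<bar>c\<bar> ^ DIM('a)) * (\<integral>\<^sup>+y. ?g x * ?g y * F (x, y) \<partial>lborel) \<partial>lborel)"
  proof (rule nn_integral_cong)
    fix x :: 'a
    have b1: "(1/c) *\<^sub>R (x - s *\<^sub>R (s *\<^sub>R x + c *\<^sub>R y)) = c *\<^sub>R x - s *\<^sub>R y" for y
    proof -
      have "x - s *\<^sub>R (s *\<^sub>R x + c *\<^sub>R y) = (1 - s\<^sup>2) *\<^sub>R x - (c * s) *\<^sub>R y"
        by (simp add: algebra_simps power2_eq_square)
      also have "\<dots> = c *\<^sub>R (c *\<^sub>R x - s *\<^sub>R y)"
        using cs by (simp add: scaleR_diff_right power2_eq_square eq_diff_eq[symmetric])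
      finally show ?thesis using c0 by simp
    qed
    have b2: "(1/c) *\<^sub>R ((s *\<^sub>R x + c *\<^sub>R y) - s *\<^sub>R x) = y" for y using c0 by simp
    show "(\<integral>\<^sup>+y. ?g ((1/c) *\<^sub>R (x - s *\<^sub>R y)) * ?g y * F (x, (1/c) *\<^sub>R (y - s *\<^sub>R x)) \<partial>lborel)
      = ennreal (\<bar>c\<bar> ^ DIM('a)) * (\<integral>\<^sup>+y. ?g x * ?g y * F (x, y) \<partial>lborel)"
      using c0
      by (subst nn_integral_lborel_affine[where c = "c" and t = "s *\<^sub>R x"])
         (simp_all only: b1 b2 gid, auto)
  qed
  also have "\<dots> = ennreal (\<bar>c\<bar> ^ DIM('a)) * (\<integral>\<^sup>+x. \<integral>\<^sup>+y. ?g x * ?g y * F (x, y) \<partial>lborel \<partial>lborel)"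
    by (subst nn_integral_cmult) auto
  also have "(\<integral>\<^sup>+x. \<integral>\<^sup>+y. ?g x * ?g y * F (x, y) \<partial>lborel \<partial>lborel) = (\<integral>\<^sup>+y. \<integral>\<^sup>+x. ?g x * ?g y * F (x, y) \<partial>lborel \<partial>lborel)"
    by (rule lborel_pair.Fubini') auto
  also have "\<dots> = (\<integral>\<^sup>+p. F p \<partial>(gauss \<Otimes>\<^sub>M gauss))" by (subst iter) auto
  also have "ennreal (\<bar>1/c\<bar> ^ DIM('a)) * (ennreal (\<bar>c\<bar> ^ DIM('a)) * (\<integral>\<^sup>+p. F p \<partial>(gauss \<Otimes>\<^sub>M gauss)))
     = (\<integral>\<^sup>+p. F p \<partial>(gauss \<Otimes>\<^sub>M gauss))"
    using c by (simp add: mult.assoc[symmetric] ennreal_mult'[symmetric] power_mult_distrib[symmetric])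
  finally show ?thesis .
qed

lemma distr_gauss_rotate:
  assumes cs: "c\<^sup>2 + s\<^sup>2 = 1" and c: "0 < c"
  shows "distr (gauss \<Otimes>\<^sub>M gauss) (gauss \<Otimes>\<^sub>M gauss)
      (\<lambda>p::'a::euclidean_space \<times> 'a. (c *\<^sub>R fst p + s *\<^sub>R snd p, c *\<^sub>R snd p - s *\<^sub>R fst p)) = gauss \<Otimes>\<^sub>M gauss"
    (is "distr _ _ ?T = _")
proof (rule measure_eqI)
  fix A :: "('a \<times> 'a) set" assume "A \<in> sets (distr (gauss \<Otimes>\<^sub>M gauss) (gauss \<Otimes>\<^sub>M gauss) ?T)"
  then have A[measurable]: "A \<in> sets (gauss \<Otimes>\<^sub>M gauss)" by simp
  then have A'[measurable]: "A \<in> sets (borel \<Otimes>\<^sub>M borel)" by (simp cong: sets_pair_measure_cong)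
  have "emeasure (distr (gauss \<Otimes>\<^sub>M gauss) (gauss \<Otimes>\<^sub>M gauss) ?T) A
      = (\<integral>\<^sup>+p. indicator A p \<partial>distr (gauss \<Otimes>\<^sub>M gauss) (gauss \<Otimes>\<^sub>M gauss) ?T)"
    by simp
  also have "\<dots> = (\<integral>\<^sup>+p. indicator A (?T p) \<partial>(gauss \<Otimes>\<^sub>M gauss))"
    by (subst nn_integral_distr) auto
  also have "\<dots> = (\<integral>\<^sup>+p. indicator A p \<partial>(gauss \<Otimes>\<^sub>M gauss))"
    by (rule nn_integral_gauss_rotate[OF _ cs c]) simp
  finally show "emeasure (distr (gauss \<Otimes>\<^sub>M gauss) (gauss \<Otimes>\<^sub>M gauss) ?T) A = emeasure (gauss \<Otimes>\<^sub>M gauss) A"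
    by simp
qed simp

text \<open>The form used below: in an average over independent \<open>x\<close> and \<open>y\<close>, the vector \<open>s y + c x\<close> may be replaced by a single
standard Gaussian vector, with \<open>c y - s x\<close> independent of it.\<close>

lemma gauss_rotate:
  fixes F :: "'a::euclidean_space \<Rightarrow> 'a \<Rightarrow> 'b::{banach, second_countable_topology}"
  assumes cs: "c\<^sup>2 + s\<^sup>2 = 1" and c: "0 < c"
    and m[measurable]: "case_prod F \<in> borel_measurable (borel \<Otimes>\<^sub>M borel)"
    and int: "integrable (gauss \<Otimes>\<^sub>M gauss) (case_prod F)"
  shows "(\<integral>y. \<integral>x. F (s *\<^sub>R y + c *\<^sub>R x) (c *\<^sub>R y - s *\<^sub>R x) \<partial>gauss \<partial>gauss) = (\<integral>x. \<integral>y. F x y \<partial>gauss \<partial>gauss)"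
proof -
  let ?T = "\<lambda>p::'a \<times> 'a. (c *\<^sub>R fst p + s *\<^sub>R snd p, c *\<^sub>R snd p - s *\<^sub>R fst p)"
  have int': "integrable (gauss \<Otimes>\<^sub>M gauss) (\<lambda>p. case_prod F (?T p))"
    by (rule integrable_distr[where T = ?T and M' = "gauss \<Otimes>\<^sub>M gauss"])
       (auto simp: distr_gauss_rotate[OF cs c] int)
  have "(\<integral>p. case_prod F (?T p) \<partial>(gauss \<Otimes>\<^sub>M gauss)) = (\<integral>p. case_prod F p \<partial>distr (gauss \<Otimes>\<^sub>M gauss) (gauss \<Otimes>\<^sub>M gauss) ?T)"
    by (subst integral_distr) auto
  also have "\<dots> = (\<integral>p. case_prod F p \<partial>(gauss \<Otimes>\<^sub>M gauss))" by (simp only: distr_gauss_rotate[OF cs c])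
  finally have "(\<integral>p. case_prod F (?T p) \<partial>(gauss \<Otimes>\<^sub>M gauss)) = (\<integral>p. case_prod F p \<partial>(gauss \<Otimes>\<^sub>M gauss))" .
  moreover have "(\<integral>y. \<integral>x. F (s *\<^sub>R y + c *\<^sub>R x) (c *\<^sub>R y - s *\<^sub>R x) \<partial>gauss \<partial>gauss)
      = (\<integral>p. case_prod F (?T p) \<partial>(gauss \<Otimes>\<^sub>M gauss))"
    using gauss_pair.integral_snd[of "\<lambda>x y. case_prod F (?T (x, y))"] int'
    by (simp add: add.commute split_beta')
  ultimately show ?thesis
    using gauss_pair.integral_fst'[OF int] by simp
qed

section \<open>One-dimensional marginals and moments\<close>

lemma prob_gauss_UNIV: "measure gauss UNIV = 1"
  using gauss.prob_space by simp

text \<open>Call the marginal law \<open>\<mu>\<close>. By the translation formula, shifting \<open>\<mu>\<close> by \<open>t\<close> has density \<open>exp (t x - t\<^sup>2 / 2)\<close> with respect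
to \<open>\<mu>\<close>. Integrating the shifted measures over all \<open>t\<close> produces Lebesgue measure on the one hand and a multiple of \<open>\<mu>\<close>
on the other; choosing the test function \<open>\<phi> x * indicator A x\<close> identifies \<open>\<mu>\<close> with the standard normal law.\<close>

lemma distr_gauss_inner:
  fixes \<theta> :: "'a::euclidean_space"
  assumes "norm \<theta> = 1"
  shows "distr gauss borel (\<lambda>z. \<theta> \<bullet> z) = (gauss :: real measure)"
proof (rule measure_eqI)
  define \<mu> where "\<mu> = distr gauss borel (\<lambda>z. \<theta> \<bullet> z)"
  have [measurable_cong, simp]: "sets \<mu> = sets borel" by (simp add: \<mu>_def)
  interpret \<mu>: prob_space \<mu> unfolding \<mu>_def by (rule gauss.prob_space_distr) simp
  interpret pair_sigma_finite \<mu> lborel ..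
  have shift: "(\<integral>\<^sup>+x. k (x + t) \<partial>\<mu>) = (\<integral>\<^sup>+x. ennreal (exp (t * x - t\<^sup>2 / 2)) * k x \<partial>\<mu>)"
    if [measurable]: "k \<in> borel_measurable borel" for k :: "real \<Rightarrow> ennreal" and t
  proof -
    have n: "norm (t *\<^sub>R \<theta>)^2 = t\<^sup>2" using assms by simp
    have tt: "\<theta> \<bullet> \<theta> = 1" using assms by (simp add: norm_eq_1)
    have "(\<integral>\<^sup>+x. k (x + t) \<partial>\<mu>) = (\<integral>\<^sup>+z. k (\<theta> \<bullet> (z + t *\<^sub>R \<theta>)) \<partial>gauss)"
      unfolding \<mu>_def by (subst nn_integral_distr) (auto simp: inner_add_right tt)
    also have "\<dots> = (\<integral>\<^sup>+z. k (\<theta> \<bullet> z) \<partial>distr gauss borel (\<lambda>z. z + t *\<^sub>R \<theta>))"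
      by (subst nn_integral_distr) auto
    also have "\<dots> = (\<integral>\<^sup>+z. ennreal (exp (t * (\<theta> \<bullet> z) - t\<^sup>2 / 2)) * k (\<theta> \<bullet> z) \<partial>gauss)"
      unfolding distr_gauss_translate n by (subst nn_integral_density) auto
    also have "\<dots> = (\<integral>\<^sup>+x. ennreal (exp (t * x - t\<^sup>2 / 2)) * k x \<partial>\<mu>)"
      unfolding \<mu>_def by (subst nn_integral_distr) auto
    finally show ?thesis .
  qed
  fix A :: "real set" assume "A \<in> sets (distr gauss borel (\<lambda>z. \<theta> \<bullet> z))"
  then have A[measurable]: "A \<in> sets borel" by simp
  let ?\<phi> = "\<lambda>x. ennreal (std_normal_density x)"
  let ?k = "\<lambda>x. ?\<phi> x * indicator A x"
  have one: "(\<integral>\<^sup>+t. ?\<phi> (x + t) \<partial>lborel) = 1" for x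
    using prob_space.emeasure_space_1[OF prob_space_gauss[where 'a=real]]
      nn_integral_real_affine[of ?\<phi> 1 x] unfolding gauss_real by (simp add: emeasure_density)
  have "emeasure gauss A = (\<integral>\<^sup>+t. ?k t \<partial>lborel)"
    unfolding gauss_real by (simp add: emeasure_density)
  also have "\<dots> = (\<integral>\<^sup>+x. \<integral>\<^sup>+t. ?k t \<partial>lborel \<partial>\<mu>)"
    by (simp add: \<mu>.emeasure_space_1)
  also have "\<dots> = (\<integral>\<^sup>+x. \<integral>\<^sup>+t. ?k (x + t) \<partial>lborel \<partial>\<mu>)"
    using nn_integral_real_affine[of ?k 1] by simp
  also have "\<dots> = (\<integral>\<^sup>+t. \<integral>\<^sup>+x. ?k (x + t) \<partial>\<mu> \<partial>lborel)"
    by (rule Fubini'[symmetric]) auto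
  also have "\<dots> = (\<integral>\<^sup>+t. \<integral>\<^sup>+x. ennreal (exp (t * x - t\<^sup>2 / 2)) * ?k x \<partial>\<mu> \<partial>lborel)"
    by (intro nn_integral_cong shift) auto
  also have "\<dots> = (\<integral>\<^sup>+t. \<integral>\<^sup>+x. ?\<phi> (- x + t) * indicator A x \<partial>\<mu> \<partial>lborel)"
  proof -
    have "std_normal_density (- x + t) = exp (t * x - t\<^sup>2 / 2) * std_normal_density x" for x t
      by (simp add: std_normal_density_def exp_add[symmetric] power2_eq_square field_simps)
    then show ?thesis by (simp add: ennreal_mult' mult.assoc)
  qed
  also have "\<dots> = (\<integral>\<^sup>+x. \<integral>\<^sup>+t. ?\<phi> (- x + t) * indicator A x \<partial>lborel \<partial>\<mu>)"
    by (rule Fubini') auto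
  also have "\<dots> = (\<integral>\<^sup>+x. indicator A x \<partial>\<mu>)"
  proof (rule nn_integral_cong)
    fix x show "(\<integral>\<^sup>+t. ?\<phi> (- x + t) * indicator A x \<partial>lborel) = indicator A x"
      by (subst nn_integral_multc) (auto simp only: one[of "- x"] mult_1, auto)
  qed
  finally show "emeasure (distr gauss borel (\<lambda>z. \<theta> \<bullet> z)) A = emeasure gauss A"
    by (simp add: \<mu>_def)
qed simp

lemma gauss_marginal:
  fixes \<theta> :: "'a::euclidean_space" and g :: "real \<Rightarrow> 'b::{banach, second_countable_topology}"
  assumes "norm \<theta> = 1" and [measurable]: "g \<in> borel_measurable borel"
  shows "(\<integral>z. g (\<theta> \<bullet> z) \<partial>gauss) = (\<integral>x. g x \<partial>gauss)"
    and "integrable gauss (\<lambda>z. g (\<theta> \<bullet> z)) \<longleftrightarrow> integrable gauss g"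
  by (simp_all add: distr_gauss_inner[OF assms(1), symmetric] integral_distr integrable_distr_eq)

lemma integrable_gauss_real_abs_power: "integrable gauss (\<lambda>x::real. \<bar>x\<bar> ^ k)"
  unfolding gauss_real
  by (subst integrable_density) (auto intro!: integrable_std_normal_moment_abs)

lemma integrable_gauss_norm_power: "integrable gauss (\<lambda>z::'a::euclidean_space. norm z ^ k)"
proof (rule Bochner_Integration.integrable_bound)
  show "integrable gauss (\<lambda>z::'a. \<Sum>b\<in>Basis. (real DIM('a) * \<bar>b \<bullet> z\<bar>) ^ k)"
    unfolding power_mult_distrib
    by (intro Bochner_Integration.integrable_sum integrable_mult_right)
       (subst gauss_marginal(2), auto intro!: integrable_gauss_real_abs_power)
  have "norm z ^ k \<le> (\<Sum>b\<in>Basis. (real DIM('a) * \<bar>b \<bullet> z\<bar>) ^ k)" for z :: 'a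
  proof -
    define m where "m = Max ((\<lambda>b. \<bar>b \<bullet> z\<bar>) ` Basis)"
    have "m \<in> (\<lambda>b. \<bar>b \<bullet> z\<bar>) ` Basis" unfolding m_def by (intro Max_in) auto
    then obtain b where b: "b \<in> Basis" "m = \<bar>b \<bullet> z\<bar>" by auto
    have "norm z \<le> (\<Sum>b\<in>Basis. \<bar>z \<bullet> b\<bar>)" by (rule norm_le_l1)
    also have "\<dots> \<le> real DIM('a) * m"
      unfolding m_def by (intro sum_bounded_above Max_ge) (auto simp: inner_commute)
    finally have "norm z ^ k \<le> (real DIM('a) * \<bar>b \<bullet> z\<bar>) ^ k"
      using b by (intro power_mono) auto
    also have "\<dots> \<le> (\<Sum>b\<in>Basis. (real DIM('a) * \<bar>b \<bullet> z\<bar>) ^ k)"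
      using b by (intro member_le_sum) auto
    finally show ?thesis .
  qed
  then show "AE z in gauss. norm (norm z ^ k) \<le> norm (\<Sum>b\<in>Basis. (real DIM('a) * \<bar>b \<bullet> (z::'a)\<bar>) ^ k)"
    by (auto simp: abs_of_nonneg sum_nonneg)
qed simp

lemma integrable_gauss_poly: "integrable gauss (\<lambda>z::'a::euclidean_space. (1 + norm z) ^ k)"
proof (rule Bochner_Integration.integrable_bound)
  show "integrable gauss (\<lambda>z::'a. 2 ^ k * (1 + norm z ^ k))"
    by (intro integrable_mult_right Bochner_Integration.integrable_add integrable_gauss_norm_power) simp
  have "(1 + norm z) ^ k \<le> 2 ^ k * (1 + norm z ^ k)" for z :: 'a
  proof -
    have "(1 + norm z) ^ k \<le> (2 * max 1 (norm z)) ^ k" by (intro power_mono) auto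
    also have "\<dots> \<le> 2 ^ k * (1 + norm z ^ k)" by (auto simp: power_mult_distrib max_def)
    finally show ?thesis .
  qed
  then show "AE z in gauss. norm ((1 + norm z) ^ k) \<le> norm (2 ^ k * (1 + norm (z::'a) ^ k))" by simp
qed simp

lemma integrable_gauss_dominated:
  fixes f :: "'a::euclidean_space \<Rightarrow> 'b::{banach, second_countable_topology}"
  assumes "f \<in> borel_measurable borel" "\<And>z. norm (f z) \<le> C * (1 + norm z) ^ k"
  shows "integrable gauss f"
proof (rule Bochner_Integration.integrable_bound)
  show "integrable gauss (\<lambda>z::'a. C * (1 + norm z) ^ k)"
    by (intro integrable_mult_right integrable_gauss_poly)
  show "AE z in gauss. norm (f z) \<le> norm (C * (1 + norm z) ^ k)"
  proof (rule AE_I2)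
    fix z show "norm (f z) \<le> norm (C * (1 + norm z) ^ k)"
      using assms(2)[of z] by (simp add: abs_mult) (smt (verit) abs_ge_self mult_right_mono norm_ge_zero zero_le_power)
  qed
qed (use assms in simp)

lemma integrable_gauss_inner [simp, intro]: "integrable gauss (\<lambda>z. q \<bullet> (z::'a::euclidean_space))"
  by (rule integrable_gauss_dominated[where C = "norm q" and k = 1])
     (auto intro: order.trans[OF Cauchy_Schwarz_ineq2] simp: distrib_left)

lemma integrable_gauss_inner2 [simp, intro]:
  "integrable gauss (\<lambda>z. (p \<bullet> z) * (q \<bullet> (z::'a::euclidean_space)))"
proof (rule integrable_gauss_dominated[where C = "norm p * norm q" and k = 2])
  fix z :: 'a
  have "\<bar>p \<bullet> z\<bar> * \<bar>q \<bullet> z\<bar> \<le> (norm p * (1 + norm z)) * (norm q * (1 + norm z))"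
    by (intro mult_mono order.trans[OF Cauchy_Schwarz_ineq2]) (auto simp: distrib_left)
  then show "norm ((p \<bullet> z) * (q \<bullet> z)) \<le> norm p * norm q * (1 + norm z)\<^sup>2"
    by (simp add: abs_mult power2_eq_square mult_ac)
qed simp

lemma integral_gauss_inner [simp]: "(\<integral>z. q \<bullet> (z::'a::euclidean_space) \<partial>gauss) = 0"
proof (cases "q = 0")
  case False
  have r0: "(\<integral>(x::real). x \<partial>gauss) = 0"
    using integral_std_normal_distribution_moment_odd[of 1] by (simp add: gauss_real)
  have "(\<integral>z. q \<bullet> z \<partial>gauss) = (\<integral>z. norm q * (((1 / norm q) *\<^sub>R q) \<bullet> z) \<partial>gauss)"
    using False by simp
  also have "\<dots> = norm q * (\<integral>z. ((1 / norm q) *\<^sub>R q) \<bullet> z \<partial>gauss)" by (rule integral_mult_right_zero)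
  also have "(\<integral>z. ((1 / norm q) *\<^sub>R q) \<bullet> z \<partial>gauss) = (\<integral>(x::real). x \<partial>gauss)"
    using False by (intro gauss_marginal) auto
  finally show ?thesis by (simp add: r0)
qed simp

lemma integral_gauss_inner_sq: "(\<integral>z. (q \<bullet> (z::'a::euclidean_space))\<^sup>2 \<partial>gauss) = (norm q)\<^sup>2"
proof (cases "q = 0")
  case False
  have r1: "(\<integral>(x::real). x\<^sup>2 \<partial>gauss) = 1"
    using std_normal_distribution_even_moments(1)[of 1] by (simp add: gauss_real)
  have "(\<integral>z. (q \<bullet> z)\<^sup>2 \<partial>gauss) = (\<integral>z. (norm q)\<^sup>2 * (((1 / norm q) *\<^sub>R q) \<bullet> z)\<^sup>2 \<partial>gauss)"
    using False by (simp add: power_divide)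
  also have "\<dots> = (norm q)\<^sup>2 * (\<integral>z. (((1 / norm q) *\<^sub>R q) \<bullet> z)\<^sup>2 \<partial>gauss)" by (rule integral_mult_right_zero)
  also have "(\<integral>z. (((1 / norm q) *\<^sub>R q) \<bullet> z)\<^sup>2 \<partial>gauss) = (\<integral>(x::real). x\<^sup>2 \<partial>gauss)"
    using False by (intro gauss_marginal) auto
  finally show ?thesis by (simp add: r1)
qed simp

lemma integral_gauss_inner_mult:
  "(\<integral>z. (p \<bullet> z) * (q \<bullet> (z::'a::euclidean_space)) \<partial>gauss) = p \<bullet> q"
proof -
  have i: "integrable gauss (\<lambda>z::'a. (r \<bullet> z)\<^sup>2)" for r
    unfolding power2_eq_square by (rule integrable_gauss_inner2)
  have "(\<integral>z. (p \<bullet> z) * (q \<bullet> z) \<partial>gauss) = (\<integral>z. (((p + q) \<bullet> z)\<^sup>2 - (p \<bullet> z)\<^sup>2 - (q \<bullet> z)\<^sup>2) / 2 \<partial>gauss)"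
    by (simp add: inner_add_left power2_eq_square algebra_simps)
  also have "\<dots> = ((norm (p + q))\<^sup>2 - (norm p)\<^sup>2 - (norm q)\<^sup>2) / 2"
    using i by (simp add: integral_gauss_inner_sq)
  also have "\<dots> = p \<bullet> q" by (simp add: power2_norm_eq_inner inner_add inner_commute)
  finally show ?thesis .
qed

text \<open>The second-order Taylor estimate, in mean, of the translation density. For \<open>norm q \<le> 1\<close> the second moment of the
remainder is \<open>exp (|q|\<^sup>2) - 1 - |q|\<^sup>2 \<le> |q|\<^sup>4\<close>; for \<open>norm q > 1\<close> each of the three terms is small enough by itself.\<close>

lemma gauss_exp_remainder:
  fixes q :: "'a::euclidean_space"
  defines "E \<equiv> \<lambda>z. exp (q \<bullet> z - (norm q)\<^sup>2 / 2)"
  shows "integrable gauss (\<lambda>z. \<bar>E z - 1 - q \<bullet> z\<bar>)"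
    and "(\<integral>z. \<bar>E z - 1 - q \<bullet> z\<bar> \<partial>gauss) \<le> 3 * (norm q)\<^sup>2"
proof -
  have [measurable]: "E \<in> borel_measurable borel" unfolding E_def by simp
  have E1: "integrable gauss E" "(\<integral>z. E z \<partial>gauss) = 1"
    using gauss_translate[of "\<lambda>_. 1::real" q] by (simp_all add: E_def prob_gauss_UNIV)
  have E2eq: "(E z)\<^sup>2 = exp ((norm q)\<^sup>2) * exp ((2 *\<^sub>R q) \<bullet> z - (norm (2 *\<^sub>R q))\<^sup>2 / 2)" for z
    by (simp add: E_def power2_eq_square exp_add[symmetric])
  have E2: "integrable gauss (\<lambda>z. (E z)\<^sup>2)" "(\<integral>z. (E z)\<^sup>2 \<partial>gauss) = exp ((norm q)\<^sup>2)"
    unfolding E2eq using gauss_translate[of "\<lambda>_. 1::real" "2 *\<^sub>R q"] by (simp_all add: prob_gauss_UNIV)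
  have Eq: "integrable gauss (\<lambda>z. E z * (q \<bullet> z))" "(\<integral>z. E z * (q \<bullet> z) \<partial>gauss) = (norm q)\<^sup>2"
    using gauss_translate[of "\<lambda>z. q \<bullet> z" q]
    by (simp_all add: E_def inner_add_right power2_norm_eq_inner prob_gauss_UNIV)
  have q2: "integrable gauss (\<lambda>z. (q \<bullet> z)\<^sup>2)" unfolding power2_eq_square by (rule integrable_gauss_inner2)
  let ?X = "\<lambda>z. E z - 1 - q \<bullet> z"
  show iX: "integrable gauss (\<lambda>z. \<bar>?X z\<bar>)" using E1 by simp
  have X2eq: "(?X z)\<^sup>2 = (E z)\<^sup>2 + 1 + (q \<bullet> z)\<^sup>2 - 2 * E z - 2 * (E z * (q \<bullet> z)) + 2 * (q \<bullet> z)" for z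
    by (simp add: power2_eq_square algebra_simps)
  have X2: "integrable gauss (\<lambda>z. (?X z)\<^sup>2)" "(\<integral>z. (?X z)\<^sup>2 \<partial>gauss) = exp ((norm q)\<^sup>2) - 1 - (norm q)\<^sup>2"
    unfolding X2eq using E1 E2 Eq q2
    by (simp_all add: prob_gauss_UNIV integral_gauss_inner_sq)
  \<comment> \<open>This replaces the Cauchy-Schwarz inequality: a first moment is bounded by a second moment, for any choice of \<open>r\<close>.\<close>
  have amgm: "\<bar>x\<bar> \<le> (r + x\<^sup>2 / r) / 2" if "0 < r" for x r :: real
  proof -
    have "0 \<le> (\<bar>x\<bar> - r)\<^sup>2" by simp
    then have "2 * \<bar>x\<bar> * r \<le> r\<^sup>2 + x\<^sup>2" by (simp add: power2_diff)
    then show ?thesis using that by (simp add: field_simps power2_eq_square)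
  qed
  show "(\<integral>z. \<bar>?X z\<bar> \<partial>gauss) \<le> 3 * (norm q)\<^sup>2"
  proof (cases "q = 0")
    case True then show ?thesis by (simp add: E_def)
  next
    case False
    show ?thesis
    proof (cases "norm q \<le> 1")
      case True
      have "(\<integral>z. \<bar>?X z\<bar> \<partial>gauss) \<le> (\<integral>z. ((norm q)\<^sup>2 + (?X z)\<^sup>2 / (norm q)\<^sup>2) / 2 \<partial>gauss)"
        using False by (intro integral_mono amgm iX) (auto simp: X2)
      also have "\<dots> = ((norm q)\<^sup>2 + (exp ((norm q)\<^sup>2) - 1 - (norm q)\<^sup>2) / (norm q)\<^sup>2) / 2"
        using X2 by (simp add: prob_gauss_UNIV)
      also have "\<dots> \<le> ((norm q)\<^sup>2 + ((norm q)\<^sup>2)\<^sup>2 / (norm q)\<^sup>2) / 2"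
        using exp_bound[of "(norm q)\<^sup>2"] True
        by (intro divide_right_mono add_left_mono) (auto simp: abs_square_le_1)
      also have "\<dots> \<le> 3 * (norm q)\<^sup>2" using False by (simp add: power2_eq_square)
      finally show ?thesis .
    next
      case False
      then have n1: "1 \<le> norm q" by simp
      have "(\<integral>z. \<bar>?X z\<bar> \<partial>gauss) \<le> (\<integral>z. E z + 1 + (norm q + (q \<bullet> z)\<^sup>2 / norm q) / 2 \<partial>gauss)"
      proof (intro integral_mono iX)
        show "integrable gauss (\<lambda>z. E z + 1 + (norm q + (q \<bullet> z)\<^sup>2 / norm q) / 2)" using E1 q2 by simp
        fix z
        have "0 < norm q" using n1 by linarith
        from amgm[OF this, of "q \<bullet> z"] show "\<bar>?X z\<bar> \<le> E z + 1 + (norm q + (q \<bullet> z)\<^sup>2 / norm q) / 2"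
          using exp_ge_zero[of "q \<bullet> z - (norm q)\<^sup>2 / 2"] unfolding E_def by linarith
      qed
      also have "\<dots> = 2 + norm q"
        using E1 q2 n1 by (simp add: prob_gauss_UNIV integral_gauss_inner_sq) (simp add: power2_eq_square)
      also have "\<dots> \<le> 3 * (norm q)\<^sup>2"
      proof -
        have "norm q * 1 \<le> norm q * norm q" using n1 by (intro mult_left_mono) auto
        then show ?thesis using n1 by (simp add: power2_eq_square)
      qed
      finally show ?thesis .
    qed
  qed
qed

section \<open>Second-order expansion of Gaussian averages\<close>

lemma integrable_gauss_bounded:
  fixes f :: "'a::euclidean_space \<Rightarrow> 'b::{banach, second_countable_topology}"
  assumes "f \<in> borel_measurable borel" "\<And>x. norm (f x) \<le> B"
  shows "integrable gauss f"
  using assms by (intro gauss.integrable_const_bound[where B = B]) auto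

lemma gauss_integral_bounded:
  fixes f :: "'a::euclidean_space \<Rightarrow> real"
  assumes "f \<in> borel_measurable borel" "\<And>x. a \<le> f x" "\<And>x. f x \<le> b"
  shows "a \<le> (\<integral>x. f x \<partial>gauss)" "(\<integral>x. f x \<partial>gauss) \<le> b"
proof -
  have i: "integrable gauss f"
  proof (rule integrable_gauss_bounded[OF assms(1)])
    fix x show "norm (f x) \<le> max \<bar>a\<bar> \<bar>b\<bar>" using assms(2,3)[of x] by (auto simp: max_def)
  qed
  show "a \<le> (\<integral>x. f x \<partial>gauss)"
    using integral_mono[OF _ i, of "\<lambda>_. a"] assms by (simp add: prob_gauss_UNIV)
  show "(\<integral>x. f x \<partial>gauss) \<le> b"
    using integral_mono[OF i, of "\<lambda>_. b"] assms by (simp add: prob_gauss_UNIV)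
qed

text \<open>With \<open>c\<^sup>2 + s\<^sup>2 = 1\<close> this is the Ornstein-Uhlenbeck average of \<open>k\<close> at correlation \<open>s\<close>. The two coefficients are separate
parameters because the same average with unnormalised coefficients appears in the formula for half-spaces.\<close>

definition mehler :: "real \<Rightarrow> real \<Rightarrow> ('a::euclidean_space \<Rightarrow> real) \<Rightarrow> 'a \<Rightarrow> real" where
  "mehler s c k z = (\<integral>w. k (s *\<^sub>R z + c *\<^sub>R w) \<partial>gauss)"

lemma borel_measurable_mehler [measurable]:
  assumes [measurable]: "k \<in> borel_measurable borel"
  shows "mehler s c k \<in> borel_measurable borel"
  unfolding mehler_def by measurable

lemma mehler_bounds:
  assumes [measurable]: "k \<in> borel_measurable borel" and "\<And>x. a \<le> k x" "\<And>x. k x \<le> b"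
  shows "a \<le> mehler s c k z" "mehler s c k z \<le> b"
  unfolding mehler_def using assms by (auto intro!: gauss_integral_bounded)

lemma integral_mehler:
  fixes k :: "'a::euclidean_space \<Rightarrow> real"
  assumes cs: "c\<^sup>2 + s\<^sup>2 = 1" and c: "0 < c"
    and [measurable]: "k \<in> borel_measurable borel" and b: "\<And>x. \<bar>k x\<bar> \<le> B"
  shows "(\<integral>z. mehler s c k z \<partial>gauss) = (\<integral>z. k z \<partial>gauss)"
proof -
  have "integrable (gauss \<Otimes>\<^sub>M gauss) (\<lambda>(x::'a, y::'a). k x)"
    by (rule gauss_pair.P.integrable_const_bound[where B = B]) (use b in auto)
  from gauss_rotate[OF cs c _ this] show ?thesis
    by (simp add: mehler_def prob_gauss_UNIV)
qed

definition gauss_moment :: "('a::euclidean_space \<Rightarrow> real) \<Rightarrow> 'a" where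
  "gauss_moment k = (\<integral>z. k z *\<^sub>R z \<partial>gauss)"

lemma integrable_gauss_moment:
  fixes k :: "'a::euclidean_space \<Rightarrow> real"
  assumes [measurable]: "k \<in> borel_measurable borel" and b: "\<And>x. \<bar>k x\<bar> \<le> 1"
  shows "integrable gauss (\<lambda>z. k z *\<^sub>R z)" "integrable gauss (\<lambda>z. k z * (\<theta> \<bullet> z))"
proof -
  show "integrable gauss (\<lambda>z. k z *\<^sub>R z)"
  proof (rule integrable_gauss_dominated[where C = 1 and k = 1])
    fix z show "norm (k z *\<^sub>R z) \<le> 1 * (1 + norm z) ^ 1"
      using mult_right_mono[OF b[of z], of "norm z"] by simp
  qed simp
  then have "integrable gauss (\<lambda>z. \<theta> \<bullet> (k z *\<^sub>R z))" by (rule integrable_inner_right)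
  then show "integrable gauss (\<lambda>z. k z * (\<theta> \<bullet> z))" by simp
qed

lemma inner_gauss_moment:
  fixes k :: "'a::euclidean_space \<Rightarrow> real"
  assumes [measurable]: "k \<in> borel_measurable borel" and b: "\<And>x. \<bar>k x\<bar> \<le> 1"
  shows "\<theta> \<bullet> gauss_moment k = (\<integral>z. k z * (\<theta> \<bullet> z) \<partial>gauss)"
proof -
  have "(\<integral>z. \<theta> \<bullet> (k z *\<^sub>R z) \<partial>gauss) = \<theta> \<bullet> (\<integral>z. k z *\<^sub>R z \<partial>gauss)"
    by (rule integral_inner_right) (use integrable_gauss_moment(1)[OF assms] in auto)
  then show ?thesis by (simp add: gauss_moment_def)
qed

lemma norm_gauss_moment_le:
  fixes k :: "'a::euclidean_space \<Rightarrow> real"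
  assumes [measurable]: "k \<in> borel_measurable borel" and b: "\<And>x. \<bar>k x\<bar> \<le> 1"
  shows "norm (gauss_moment k) \<le> (\<integral>(z::'a). norm z \<partial>gauss)"
proof -
  have "norm (gauss_moment k) \<le> (\<integral>z. norm (k z *\<^sub>R z) \<partial>gauss)"
    unfolding gauss_moment_def by (rule integral_norm_bound)
  also have "\<dots> \<le> (\<integral>(z::'a). norm z \<partial>gauss)"
  proof (rule integral_mono)
    show "integrable gauss (\<lambda>z. norm (k z *\<^sub>R z))" by (intro integrable_norm integrable_gauss_moment(1) assms)
    show "integrable gauss (\<lambda>z::'a. norm z)" using integrable_gauss_norm_power[of 1] by simp
    show "norm (k z *\<^sub>R z) \<le> norm z" for z using mult_right_mono[OF b[of z], of "norm z"] by simp
  qed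
  finally show ?thesis .
qed

text \<open>Averaging \<open>k\<close> shrinks its Gaussian moment by the factor \<open>s\<close>: in the rotated coordinates \<open>z = s x + c y\<close>, and the part
\<open>c y\<close> is independent of \<open>k x\<close> and has mean zero.\<close>

lemma mehler_moment:
  fixes k :: "'a::euclidean_space \<Rightarrow> real"
  assumes cs: "c\<^sup>2 + s\<^sup>2 = 1" and c: "0 < c"
    and [measurable]: "k \<in> borel_measurable borel" and b: "\<And>x. \<bar>k x\<bar> \<le> 1"
  shows "(\<integral>z. mehler s c k z * (\<theta> \<bullet> z) \<partial>gauss) = s * (\<theta> \<bullet> gauss_moment k)"
proof -
  have int: "integrable (gauss \<Otimes>\<^sub>M gauss) (\<lambda>(x::'a, y::'a). k x * (\<theta> \<bullet> (s *\<^sub>R x + c *\<^sub>R y)))"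
  proof (rule gauss_pair.Fubini_integrable)
    have i: "integrable gauss (\<lambda>y. k x * (\<theta> \<bullet> (s *\<^sub>R x + c *\<^sub>R y)))" for x
      by (simp add: inner_add_right)
    show "AE x in gauss. integrable gauss (\<lambda>y. (case (x, y) of (x, y) \<Rightarrow> k x * (\<theta> \<bullet> (s *\<^sub>R x + c *\<^sub>R y))))"
      using i by simp
    let ?C = "(\<integral>(y::'a). 1 + norm y \<partial>gauss)"
    have iy: "integrable gauss (\<lambda>y::'a. 1 + norm y)" using integrable_gauss_poly[of 1] by simp
    have "s\<^sup>2 \<le> 1" "c\<^sup>2 \<le> 1" using cs zero_le_power2[of s] zero_le_power2[of c] by linarith+
    then have s1: "\<bar>s\<bar> \<le> 1" "\<bar>c\<bar> \<le> 1" by (auto simp: abs_square_le_1)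
    show "integrable gauss (\<lambda>x. \<integral>y. norm (case (x, y) of (x, y) \<Rightarrow> k x * (\<theta> \<bullet> (s *\<^sub>R x + c *\<^sub>R y))) \<partial>gauss)"
    proof (rule integrable_gauss_dominated[where C = "norm \<theta> * ?C" and k = 1])
      fix x
      have p: "norm (k x * (\<theta> \<bullet> (s *\<^sub>R x + c *\<^sub>R y))) \<le> norm \<theta> * (1 + norm x) * (1 + norm y)" for y
      proof -
        have "norm (s *\<^sub>R x + c *\<^sub>R y) \<le> \<bar>s\<bar> * norm x + \<bar>c\<bar> * norm y"
          by (intro order.trans[OF norm_triangle_ineq]) simp
        also have "\<dots> \<le> 1 * norm x + 1 * norm y"
          by (intro add_mono mult_right_mono s1) auto
        also have "\<dots> \<le> (1 + norm x) * (1 + norm y)" by (simp add: algebra_simps)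
        finally have "norm \<theta> * norm (s *\<^sub>R x + c *\<^sub>R y) \<le> norm \<theta> * ((1 + norm x) * (1 + norm y))"
          by (intro mult_left_mono) auto
        with Cauchy_Schwarz_ineq2[of \<theta> "s *\<^sub>R x + c *\<^sub>R y"]
        have "\<bar>\<theta> \<bullet> (s *\<^sub>R x + c *\<^sub>R y)\<bar> \<le> norm \<theta> * ((1 + norm x) * (1 + norm y))" by linarith
        then have "\<bar>k x\<bar> * \<bar>\<theta> \<bullet> (s *\<^sub>R x + c *\<^sub>R y)\<bar> \<le> 1 * (norm \<theta> * ((1 + norm x) * (1 + norm y)))"
          using b[of x] by (intro mult_mono) auto
        then show ?thesis by (simp add: abs_mult mult.assoc)
      qed
      have "(\<integral>y. norm (k x * (\<theta> \<bullet> (s *\<^sub>R x + c *\<^sub>R y))) \<partial>gauss)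
          \<le> (\<integral>(y::'a). norm \<theta> * (1 + norm x) * (1 + norm y) \<partial>gauss)"
        using i[of x] iy by (intro integral_mono p) auto
      also have "\<dots> = norm \<theta> * (1 + norm x) * ?C" by simp
      finally show "norm (\<integral>y. norm (case (x, y) of (x, y) \<Rightarrow> k x * (\<theta> \<bullet> (s *\<^sub>R x + c *\<^sub>R y))) \<partial>gauss)
          \<le> norm \<theta> * ?C * (1 + norm x) ^ 1"
        by (simp add: mult_ac)
    qed simp
  qed simp
  have inv_rot: "s *\<^sub>R (s *\<^sub>R y + c *\<^sub>R x) + c *\<^sub>R (c *\<^sub>R y - s *\<^sub>R x) = y" for x y :: 'a
  proof -
    have "s *\<^sub>R (s *\<^sub>R y + c *\<^sub>R x) + c *\<^sub>R (c *\<^sub>R y - s *\<^sub>R x) = (c\<^sup>2 + s\<^sup>2) *\<^sub>R y"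
      by (simp add: algebra_simps power2_eq_square)
    then show ?thesis by (simp add: cs)
  qed
  have "(\<integral>z. mehler s c k z * (\<theta> \<bullet> z) \<partial>gauss)
      = (\<integral>y. \<integral>x. k (s *\<^sub>R y + c *\<^sub>R x) * (\<theta> \<bullet> y) \<partial>gauss \<partial>gauss)"
    by (simp add: mehler_def)
  also have "\<dots> = (\<integral>x. \<integral>y. k x * (\<theta> \<bullet> (s *\<^sub>R x + c *\<^sub>R y)) \<partial>gauss \<partial>gauss)"
    using gauss_rotate[OF cs c _ int] by (simp only: inv_rot) simp
  also have "\<dots> = (\<integral>x. s * (k x * (\<theta> \<bullet> x)) \<partial>gauss)"
    by (simp add: inner_add_right prob_gauss_UNIV mult.left_commute)
  also have "\<dots> = s * (\<theta> \<bullet> gauss_moment k)"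
    using b by (simp add: inner_gauss_moment)
  finally show ?thesis .
qed

text \<open>A Gaussian average of a bounded function is smooth whatever the function is: the shift \<open>s z\<close> can be moved from \<open>k\<close> to
the density, where it is expanded by \<open>gauss_exp_remainder\<close>.\<close>

lemma mehler_expansion:
  fixes k :: "'a::euclidean_space \<Rightarrow> real"
  assumes c: "0 < c" and [measurable]: "k \<in> borel_measurable borel" and b: "\<And>x. \<bar>k x\<bar> \<le> 1"
  shows "\<bar>mehler s c k z - mehler s c k 0 - (s / c) * (gauss_moment (\<lambda>w. k (c *\<^sub>R w)) \<bullet> z)\<bar>
      \<le> 3 * (s / c)\<^sup>2 * (norm z)\<^sup>2"
proof -
  define q where "q = (s / c) *\<^sub>R z"
  let ?E = "\<lambda>w. exp (q \<bullet> w - (norm q)\<^sup>2 / 2)"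
  define g where "g w = k (c *\<^sub>R w)" for w
  have [measurable]: "g \<in> borel_measurable borel" unfolding g_def by simp
  have gb: "\<bar>g w\<bar> \<le> 1" for w unfolding g_def by (rule b)
  have ig: "integrable gauss g" using gb by (intro integrable_gauss_bounded[where B = 1]) auto
  have "s *\<^sub>R z + c *\<^sub>R w = c *\<^sub>R (w + q)" for w using c by (simp add: q_def scaleR_add_right add.commute)
  then have m: "mehler s c k z = (\<integral>w. g (w + q) \<partial>gauss)" by (simp add: mehler_def g_def)
  have "integrable gauss (\<lambda>w. g (w + q))" using gb by (intro integrable_gauss_bounded[where B = 1]) auto
  then have iE: "integrable gauss (\<lambda>w. ?E w * g w)" using gauss_translate(2)[of g q] by simp
  have mz: "mehler s c k z = (\<integral>w. ?E w * g w \<partial>gauss)"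
    unfolding m using gauss_translate(1)[of g q] by simp
  have m0: "mehler s c k 0 = (\<integral>w. g w \<partial>gauss)" by (simp add: mehler_def g_def)
  have i2: "integrable gauss (\<lambda>w. g w * (q \<bullet> w))" using gb by (intro integrable_gauss_moment) auto
  have md: "(s / c) * (gauss_moment g \<bullet> z) = (\<integral>w. g w * (q \<bullet> w) \<partial>gauss)"
    using inner_gauss_moment[of g q] gb by (simp add: q_def inner_commute)
  have "mehler s c k z - mehler s c k 0 - (s / c) * (gauss_moment g \<bullet> z)
      = (\<integral>w. g w * (?E w - 1 - q \<bullet> w) \<partial>gauss)"
    unfolding mz m0 md using iE ig i2 by (simp add: right_diff_distrib mult.commute)
  also have "\<bar>\<dots>\<bar> \<le> (\<integral>w. \<bar>?E w - 1 - q \<bullet> w\<bar> \<partial>gauss)"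
  proof (rule order.trans[OF integral_abs_bound], rule integral_mono)
    show "integrable gauss (\<lambda>w. \<bar>g w * (?E w - 1 - q \<bullet> w)\<bar>)"
      using iE ig i2 by (simp add: right_diff_distrib mult.commute)
    show "integrable gauss (\<lambda>w. \<bar>?E w - 1 - q \<bullet> w\<bar>)" by (rule gauss_exp_remainder)
    show "\<bar>g w * (?E w - 1 - q \<bullet> w)\<bar> \<le> \<bar>?E w - 1 - q \<bullet> w\<bar>" for w
      unfolding abs_mult using gb[of w] by (intro mult_left_le_one_le) auto
  qed
  also have "\<dots> \<le> 3 * (norm q)\<^sup>2" by (rule gauss_exp_remainder)
  also have "\<dots> = 3 * (s / c)\<^sup>2 * (norm z)\<^sup>2" by (simp add: q_def power_mult_distrib power_divide)
  finally show ?thesis unfolding g_def .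
qed

text \<open>The increment of the average has variance \<open>s\<^sup>2\<close> times the squared length of the moment, up to third order, uniformly
in \<open>k\<close>. The linear term of the expansion involves the moment of the rescaled function \<open>k (c w)\<close>; it is traded for the
moment of \<open>k\<close> itself by means of the exact identity \<open>mehler_moment\<close>.\<close>

lemma mehler_increment_moments:
  "\<exists>C\<ge>0. \<forall>(k::'a::euclidean_space \<Rightarrow> real) s c.
     k \<in> borel_measurable borel \<longrightarrow> (\<forall>x. \<bar>k x\<bar> \<le> 1) \<longrightarrow> 0 < c \<longrightarrow> 0 \<le> s \<longrightarrow> s \<le> c \<longrightarrow> c\<^sup>2 + s\<^sup>2 = 1 \<longrightarrow>
     (\<integral>z. (mehler s c k z - (\<integral>w. k w \<partial>gauss))\<^sup>2 \<partial>gauss) \<le> s\<^sup>2 * (norm (gauss_moment k))\<^sup>2 + C * s ^ 3 \<and>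
     (\<integral>z. \<bar>mehler s c k z - (\<integral>w. k w \<partial>gauss)\<bar> ^ 3 \<partial>gauss) \<le> C * s ^ 3"
proof -
  let ?W = "\<lambda>z::'a. 1 + norm z"
  define M where "M = (\<integral>z. ?W z ^ 6 \<partial>gauss)"
  have W1: "1 \<le> ?W z" for z by simp
  have pw: "?W z ^ i \<le> ?W z ^ 6" if "i \<le> 6" for z i by (rule power_increasing[OF that]) simp
  have EW: "(\<integral>z. ?W z ^ i \<partial>gauss) \<le> M" if "i \<le> 6" for i
    unfolding M_def by (intro integral_mono integrable_gauss_poly pw that)
  have M1: "1 \<le> M" using EW[of 0] by (simp add: prob_gauss_UNIV)
  have nM: "(\<integral>(z::'a). norm z \<partial>gauss) \<le> M"
  proof -
    have "(\<integral>(z::'a). norm z \<partial>gauss) \<le> (\<integral>z. ?W z ^ 1 \<partial>gauss)"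
      using integrable_gauss_norm_power[of 1, where 'a='a] integrable_gauss_poly[of 1, where 'a='a]
      by (intro integral_mono) auto
    also have "\<dots> \<le> M" by (rule EW) simp
    finally show ?thesis .
  qed
  \<comment> \<open>A crude value: all errors below are at most \<open>343 * 8 = 2744\<close> times \<open>M ^ 4 * s ^ 3\<close>.\<close>
  define C where "C = 3000 * M ^ 4"
  show ?thesis
  proof (intro exI[of _ C] conjI allI impI)
    show "0 \<le> C" unfolding C_def using M1 by simp
    fix k :: "'a \<Rightarrow> real" and s c :: real
    assume k[measurable]: "k \<in> borel_measurable borel" and b: "\<forall>x. \<bar>k x\<bar> \<le> 1"
      and c: "0 < c" and s: "0 \<le> s" "s \<le> c" and cs: "c\<^sup>2 + s\<^sup>2 = 1"
    define m where "m = (\<integral>w. k w \<partial>gauss)"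
    define D where "D = gauss_moment k"
    define D' where "D' = gauss_moment (\<lambda>w. k (c *\<^sub>R w))"
    define t where "t = s / c"
    define y where "y = mehler s c k"
    have [measurable]: "y \<in> borel_measurable borel" unfolding y_def by simp
    have kb: "- 1 \<le> k x" "k x \<le> 1" for x using b[rule_format, of x] by (auto simp: abs_le_iff)
    have yb: "- 1 \<le> y z" "y z \<le> 1" for z unfolding y_def using mehler_bounds[OF k kb] by auto
    have iy: "integrable gauss y" using yb by (intro integrable_gauss_bounded[where B = 1]) (auto simp: abs_le_iff minus_le_iff)
    have t0: "0 \<le> t" unfolding t_def using c s by simp
    have t1: "t \<le> 1" unfolding t_def using c s by simp
    have "1/2 \<le> c\<^sup>2" using cs power_mono[OF s(2,1), of 2] by simp
    then have "(1/2)\<^sup>2 \<le> c\<^sup>2" by (simp add: power2_eq_square)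
    then have "1/2 \<le> c" using c by (simp add: power2_le_iff_abs_le)
    then have ts: "t \<le> 2 * s" unfolding t_def using c s mult_left_mono[of 1 "2 * c" s] by (simp add: field_simps)
    have nD: "norm D \<le> M" unfolding D_def using norm_gauss_moment_le[OF k] b nM by force
    have nD': "norm D' \<le> M"
      unfolding D'_def using norm_gauss_moment_le[of "\<lambda>w. k (c *\<^sub>R w)"] b nM by force
    define R where "R z = y z - y 0 - t * (D' \<bullet> z)" for z
    have [measurable]: "R \<in> borel_measurable borel" unfolding R_def by simp
    have R: "\<bar>R z\<bar> \<le> 3 * t\<^sup>2 * (norm z)\<^sup>2" for z
      unfolding R_def y_def t_def D'_def by (rule mehler_expansion[OF c k]) (use b in auto)
    have iR: "integrable gauss R" unfolding R_def using iy by simp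
    define r where "r = (\<integral>z. R z \<partial>gauss)"
    have Ey: "(\<integral>z. y z \<partial>gauss) = m"
      unfolding y_def m_def by (rule integral_mehler[OF cs c k, of 1]) (use b in auto)
    then have r_eq: "r = m - y 0" unfolding r_def R_def using iy by (simp add: prob_gauss_UNIV)
    have nW: "(norm z)\<^sup>2 \<le> ?W z ^ 2" for z :: 'a by (intro power_mono) auto
    have rb: "\<bar>r\<bar> \<le> 3 * t\<^sup>2 * M"
    proof -
      have "\<bar>r\<bar> \<le> (\<integral>z. \<bar>R z\<bar> \<partial>gauss)" unfolding r_def by (rule integral_abs_bound)
      also have "\<dots> \<le> (\<integral>z. 3 * t\<^sup>2 * ?W z ^ 2 \<partial>gauss)"
      proof (intro integral_mono integrable_mult_right integrable_gauss_poly)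
        show "integrable gauss (\<lambda>z. \<bar>R z\<bar>)" using iR by simp
        fix z show "\<bar>R z\<bar> \<le> 3 * t\<^sup>2 * ?W z ^ 2"
          by (rule order.trans[OF R mult_left_mono[OF nW]]) simp
      qed
      also have "\<dots> = 3 * t\<^sup>2 * (\<integral>z. ?W z ^ 2 \<partial>gauss)" by (rule integral_mult_right_zero)
      also have "\<dots> \<le> 3 * t\<^sup>2 * M" by (intro mult_left_mono EW) auto
      finally show ?thesis .
    qed
    \<comment> \<open>The remainder is centred, so that \<open>y - m\<close> is the linear term plus \<open>Q\<close> with no constant left over.\<close>
    define Q where "Q z = R z - r" for z
    have [measurable]: "Q \<in> borel_measurable borel" unfolding Q_def by simp
    have yQ: "y z - m = t * (D' \<bullet> z) + Q z" for z unfolding Q_def r_eq R_def by simp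
    have Q: "\<bar>Q z\<bar> \<le> 6 * t\<^sup>2 * M * ?W z ^ 2" for z
    proof -
      have a: "(norm z)\<^sup>2 \<le> M * ?W z ^ 2"
        using mult_mono[OF M1 nW] M1 by simp
      have b: "M \<le> M * ?W z ^ 2" using mult_left_mono[OF one_le_power[OF W1[of z], of 2], of M] M1 by simp
      have "\<bar>Q z\<bar> \<le> 3 * t\<^sup>2 * (norm z)\<^sup>2 + 3 * t\<^sup>2 * M" unfolding Q_def using R[of z] rb by linarith
      also have "\<dots> \<le> 3 * t\<^sup>2 * (M * ?W z ^ 2) + 3 * t\<^sup>2 * (M * ?W z ^ 2)"
        by (intro add_mono mult_left_mono a b) auto
      finally show ?thesis by (simp add: mult_ac)
    qed
    have yb2: "\<bar>y z - m\<bar> \<le> 7 * t * M * ?W z ^ 2" for z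
    proof -
      have "\<bar>D' \<bullet> z\<bar> \<le> M * ?W z ^ 2"
      proof -
        have "\<bar>D' \<bullet> z\<bar> \<le> norm D' * norm z" by (rule Cauchy_Schwarz_ineq2)
        also have "\<dots> \<le> M * ?W z ^ 2"
          using nD' M1 self_le_power[OF W1[of z], of 2] by (intro mult_mono) auto
        finally show ?thesis .
      qed
      then have "t * \<bar>D' \<bullet> z\<bar> \<le> t * (M * ?W z ^ 2)" using t0 by (intro mult_left_mono)
      moreover have "6 * t\<^sup>2 * M * ?W z ^ 2 \<le> 6 * t * M * ?W z ^ 2"
        using t0 t1 M1 mult_left_le[of t t] by (intro mult_right_mono mult_left_mono) (auto simp: power2_eq_square)
      moreover have "\<bar>y z - m\<bar> \<le> t * \<bar>D' \<bullet> z\<bar> + \<bar>Q z\<bar>"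
        unfolding yQ using abs_triangle_ineq[of "t * (D' \<bullet> z)" "Q z"] t0 by (simp add: abs_mult)
      ultimately show ?thesis using Q[of z] by linarith
    qed
    have W0: "0 \<le> ?W z ^ i" for z i by simp
    have y3: "\<bar>y z - m\<bar> ^ 3 \<le> 343 * t ^ 3 * M ^ 3 * ?W z ^ 6" for z
    proof -
      have "\<bar>y z - m\<bar> ^ 3 \<le> (7 * t * M * ?W z ^ 2) ^ 3" by (intro power_mono yb2) simp
      also have "\<dots> = 343 * t ^ 3 * M ^ 3 * ?W z ^ 6"
        by (simp add: power_mult_distrib flip: power_mult)
      finally show ?thesis .
    qed
    have t3: "t ^ 3 \<le> 8 * s ^ 3" using power_mono[OF ts t0, of 3] by (simp add: power_mult_distrib)
    have M34: "M ^ 3 \<le> M ^ 4" "0 \<le> M ^ 3" using M1 by (auto intro: power_increasing)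
    have s3: "0 \<le> s ^ 3" using s by simp
    have t3M: "t ^ 3 * X \<le> 8 * s ^ 3 * M ^ 4" if "X \<le> M ^ 4" "0 \<le> X" for X
      using t3 that s3 M1 by (intro mult_mono) auto
    have "(\<integral>z. \<bar>y z - m\<bar> ^ 3 \<partial>gauss) \<le> (\<integral>z. 343 * t ^ 3 * M ^ 3 * ?W z ^ 6 \<partial>gauss)"
    proof (intro integral_mono integrable_mult_right integrable_gauss_poly y3)
      show "integrable gauss (\<lambda>z. \<bar>y z - m\<bar> ^ 3)"
        using y3 by (intro integrable_gauss_dominated[where k = 6]) auto
    qed
    also have "\<dots> = 343 * (t ^ 3 * M ^ 4)" unfolding M_def[symmetric] by (simp add: M_def[symmetric] power_Suc2[symmetric] mult.assoc del: power_Suc)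
    also have "\<dots> \<le> C * s ^ 3"
    proof -
      have "t ^ 3 * M ^ 4 \<le> 8 * s ^ 3 * M ^ 4" using M1 by (intro t3M) auto
      moreover have "0 \<le> s ^ 3 * M ^ 4" using M1 s3 by simp
      ultimately have "343 * (t ^ 3 * M ^ 4) \<le> 3000 * (s ^ 3 * M ^ 4)" by linarith
      then show ?thesis by (simp add: C_def mult_ac)
    qed
    finally show "(\<integral>z. \<bar>mehler s c k z - (\<integral>w. k w \<partial>gauss)\<bar> ^ 3 \<partial>gauss) \<le> C * s ^ 3"
      unfolding y_def m_def .
    have iQ: "integrable gauss Q" unfolding Q_def using iR by simp
    have bQ: "\<bar>(D \<bullet> z) * Q z\<bar> \<le> 6 * t\<^sup>2 * M\<^sup>2 * ?W z ^ 3" for z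
    proof -
      have "\<bar>D \<bullet> z\<bar> \<le> M * ?W z"
        using nD M1 by (intro order.trans[OF Cauchy_Schwarz_ineq2] mult_mono) auto
      then have "\<bar>D \<bullet> z\<bar> * \<bar>Q z\<bar> \<le> (M * ?W z) * (6 * t\<^sup>2 * M * ?W z ^ 2)"
        using M1 by (intro mult_mono Q) auto
      then show ?thesis by (simp add: abs_mult power2_eq_square power3_eq_cube mult_ac)
    qed
    have iDQ: "integrable gauss (\<lambda>z. (D \<bullet> z) * Q z)"
      using bQ by (intro integrable_gauss_dominated[where k = 3]) auto
    have eDQ: "\<bar>\<integral>z. (D \<bullet> z) * Q z \<partial>gauss\<bar> \<le> 6 * t\<^sup>2 * M ^ 3"
    proof -
      have "\<bar>\<integral>z. (D \<bullet> z) * Q z \<partial>gauss\<bar> \<le> (\<integral>z. \<bar>(D \<bullet> z) * Q z\<bar> \<partial>gauss)" by (rule integral_abs_bound)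
      also have "\<dots> \<le> (\<integral>z. 6 * t\<^sup>2 * M\<^sup>2 * ?W z ^ 3 \<partial>gauss)"
        using iDQ by (intro integral_mono bQ integrable_mult_right integrable_gauss_poly) auto
      also have "\<dots> = 6 * t\<^sup>2 * M\<^sup>2 * (\<integral>z. ?W z ^ 3 \<partial>gauss)" by (rule integral_mult_right_zero)
      also have "\<dots> \<le> 6 * t\<^sup>2 * M\<^sup>2 * M" by (intro mult_left_mono EW) auto
      finally show ?thesis by (simp add: power2_eq_square power3_eq_cube)
    qed
    have byQ: "\<bar>(y z - m) * Q z\<bar> \<le> 42 * t ^ 3 * M\<^sup>2 * ?W z ^ 4" for z
    proof -
      have "\<bar>y z - m\<bar> * \<bar>Q z\<bar> \<le> (7 * t * M * ?W z ^ 2) * (6 * t\<^sup>2 * M * ?W z ^ 2)"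
        using M1 t0 by (intro mult_mono Q yb2) auto
      also have "\<dots> = 42 * t ^ 3 * M\<^sup>2 * ?W z ^ 4"
        by (simp add: power2_eq_square numeral_eq_Suc)
      finally show ?thesis by (simp add: abs_mult)
    qed
    have iyQ: "integrable gauss (\<lambda>z. (y z - m) * Q z)"
      using byQ by (intro integrable_gauss_dominated[where k = 4]) auto
    have eyQ: "(\<integral>z. (y z - m) * Q z \<partial>gauss) \<le> 42 * t ^ 3 * M ^ 3"
    proof -
      have "(\<integral>z. (y z - m) * Q z \<partial>gauss) \<le> (\<integral>z. 42 * t ^ 3 * M\<^sup>2 * ?W z ^ 4 \<partial>gauss)"
        using iyQ byQ by (intro integral_mono integrable_mult_right integrable_gauss_poly) (auto intro: order.trans[OF abs_ge_self])
      also have "\<dots> = 42 * t ^ 3 * M\<^sup>2 * (\<integral>z. ?W z ^ 4 \<partial>gauss)" by (rule integral_mult_right_zero)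
      also have "\<dots> \<le> 42 * t ^ 3 * M\<^sup>2 * M" using t0 by (intro mult_left_mono EW) auto
      finally show ?thesis by (simp add: power2_eq_square power3_eq_cube)
    qed
    have iyi: "integrable gauss (\<lambda>z. y z * (\<theta> \<bullet> z))" for \<theta>
      using yb by (intro integrable_gauss_moment) (auto simp: abs_le_iff minus_le_iff)
    have Eyi: "(\<integral>z. (y z - m) * (\<theta> \<bullet> z) \<partial>gauss) = s * (\<theta> \<bullet> D)" for \<theta>
      using mehler_moment[OF cs c k, of \<theta>] b iyi[of \<theta>] by (simp add: left_diff_distrib y_def D_def)
    have i1: "integrable gauss (\<lambda>z. (y z - m) * (\<theta> \<bullet> z))" for \<theta>
      using iyi[of \<theta>] by (simp add: left_diff_distrib)
    \<comment> \<open>The exact moment identity, tested against the moment itself, compares the two linear terms.\<close>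
    have sDD: "s * (D \<bullet> D) = t * (D' \<bullet> D) + (\<integral>z. (D \<bullet> z) * Q z \<partial>gauss)"
    proof -
      have "s * (D \<bullet> D) = (\<integral>z. t * ((D' \<bullet> z) * (D \<bullet> z)) + (D \<bullet> z) * Q z \<partial>gauss)"
        unfolding Eyi[of D, symmetric] yQ by (simp add: algebra_simps)
      also have "\<dots> = t * (D' \<bullet> D) + (\<integral>z. (D \<bullet> z) * Q z \<partial>gauss)"
        using iDQ by (subst Bochner_Integration.integral_add) (auto simp: integral_gauss_inner_mult)
      finally show ?thesis .
    qed
    have "(\<integral>z. (y z - m)\<^sup>2 \<partial>gauss) = (\<integral>z. t * ((y z - m) * (D' \<bullet> z)) + (y z - m) * Q z \<partial>gauss)"
      using yQ by (intro Bochner_Integration.integral_cong) (auto simp: power2_eq_square algebra_simps)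
    also have "\<dots> = t * (s * (D' \<bullet> D)) + (\<integral>z. (y z - m) * Q z \<partial>gauss)"
      using i1[of D'] iyQ by (subst Bochner_Integration.integral_add) (auto simp: Eyi)
    also have "t * (s * (D' \<bullet> D)) = s * (s * (D \<bullet> D) - (\<integral>z. (D \<bullet> z) * Q z \<partial>gauss))"
      unfolding sDD by simp
    finally have "(\<integral>z. (y z - m)\<^sup>2 \<partial>gauss) = s\<^sup>2 * (norm D)\<^sup>2 - s * (\<integral>z. (D \<bullet> z) * Q z \<partial>gauss) + (\<integral>z. (y z - m) * Q z \<partial>gauss)"
      unfolding power2_norm_eq_inner power2_eq_square[of s] by (simp only: right_diff_distrib mult.assoc)
    moreover have "- (s * (\<integral>z. (D \<bullet> z) * Q z \<partial>gauss)) \<le> 24 * s ^ 3 * M ^ 4"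
    proof -
      have "- (s * (\<integral>z. (D \<bullet> z) * Q z \<partial>gauss)) \<le> s * \<bar>\<integral>z. (D \<bullet> z) * Q z \<partial>gauss\<bar>"
        unfolding mult_minus_right[symmetric] using s by (intro mult_left_mono) auto
      also have "\<dots> \<le> s * (6 * t\<^sup>2 * M ^ 3)" using s by (intro mult_left_mono eDQ)
      also have "\<dots> \<le> s * (6 * (2 * s)\<^sup>2 * M ^ 4)"
        using s ts t0 M34 M1 by (intro mult_left_mono mult_mono power_mono) auto
      also have "\<dots> = 24 * s ^ 3 * M ^ 4" by (simp add: power2_eq_square power3_eq_cube)
      finally show ?thesis .
    qed
    moreover have "(\<integral>z. (y z - m) * Q z \<partial>gauss) \<le> 336 * s ^ 3 * M ^ 4"
      using eyQ t3M[OF M34] by linarith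
    ultimately have "(\<integral>z. (y z - m)\<^sup>2 \<partial>gauss) \<le> s\<^sup>2 * (norm D)\<^sup>2 + 360 * (s ^ 3 * M ^ 4)" by linarith
    also have "\<dots> \<le> s\<^sup>2 * (norm D)\<^sup>2 + C * s ^ 3"
    proof -
      have "0 \<le> s ^ 3 * M ^ 4" using M1 s3 by simp
      then show ?thesis by (simp add: C_def mult.commute[of _ "s ^ 3"] mult.assoc[symmetric])
    qed
    finally show "(\<integral>z. (mehler s c k z - (\<integral>w. k w \<partial>gauss))\<^sup>2 \<partial>gauss) \<le> s\<^sup>2 * (norm (gauss_moment k))\<^sup>2 + C * s ^ 3"
      unfolding y_def m_def D_def .
  qed
qed

section \<open>The normal distribution function and half-spaces\<close>

abbreviation Phi :: "real \<Rightarrow> real" where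
  "Phi \<equiv> cdf gauss"

abbreviation \<phi> :: "real \<Rightarrow> real" where
  "\<phi> \<equiv> std_normal_density"

interpretation gauss_real: real_distribution "gauss :: real measure"
  by (simp add: real_distribution_def real_distribution_axioms_def prob_space_gauss)

lemma phi_pos: "0 < \<phi> x" by (simp add: normal_density_pos)

lemma phi_le_1: "\<phi> x \<le> 1"
proof -
  have "1 \<le> 2 * pi" using pi_gt3 by linarith
  then have "1 / sqrt (2 * pi) \<le> 1" by simp
  then have "1 / sqrt (2 * pi) * exp (- x\<^sup>2 / 2) \<le> 1 * 1" by (intro mult_mono) auto
  then show ?thesis by (simp add: std_normal_density_def)
qed

lemma abs_mult_phi_le_1: "\<bar>x\<bar> * \<phi> x \<le> 1"
proof -
  have "\<bar>x\<bar> \<le> 1 + x\<^sup>2 / 2"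
  proof -
    have "0 \<le> (\<bar>x\<bar> - 1)\<^sup>2" by simp
    then show ?thesis by (simp add: power2_diff)
  qed
  also have "\<dots> \<le> exp (x\<^sup>2 / 2)" by (rule exp_ge_add_one_self)
  finally have "\<bar>x\<bar> * exp (- x\<^sup>2 / 2) \<le> 1" by (simp add: exp_minus field_simps)
  moreover have "1 \<le> 2 * pi" using pi_gt3 by linarith
  then have "1 / sqrt (2 * pi) \<le> 1" by simp
  ultimately have "1 / sqrt (2 * pi) * (\<bar>x\<bar> * exp (- x\<^sup>2 / 2)) \<le> 1 * 1" by (intro mult_mono) auto
  then show ?thesis by (simp add: std_normal_density_def mult_ac)
qed

lemma phi_antimono_abs: "\<bar>x\<bar> \<le> A \<Longrightarrow> \<phi> A \<le> \<phi> x"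
  by (auto simp: std_normal_density_def divide_right_mono abs_le_square_iff[symmetric])

lemma phi_deriv: "(\<phi> has_real_derivative - x * \<phi> x) (at x)"
proof -
  have "((\<lambda>x. (1 / sqrt (2 * pi)) * exp (- x\<^sup>2 / 2)) has_real_derivative
      (1 / sqrt (2 * pi)) * (exp (- x\<^sup>2 / 2) * - x)) (at x)"
    by (intro DERIV_cmult) (auto intro!: derivative_eq_intros)
  then show ?thesis by (simp add: std_normal_density_def[abs_def] mult_ac)
qed

lemma Phi_deriv: "(Phi has_real_derivative \<phi> x) (at x)"
proof -
  let ?a = "x - 1" and ?b = "x + 1"
  have cont: "continuous_on S \<phi>" for S
    using phi_deriv by (intro DERIV_continuous_on[where D = "\<lambda>x. - x * \<phi> x"]) (blast intro: DERIV_subset)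
  have "((\<lambda>y. Phi ?a + integral {?a..y} \<phi>) has_real_derivative \<phi> x) (at x within {?a..?b})"
    using integral_has_real_derivative[of ?a ?b \<phi> x] cont
    by (auto intro!: derivative_eq_intros)
  then have d: "((\<lambda>y. Phi ?a + integral {?a..y} \<phi>) has_real_derivative \<phi> x) (at x)"
    by (subst (asm) at_within_Icc_at) auto
  have eq: "Phi y = Phi ?a + integral {?a..y} \<phi>" if "?a < y" for y
  proof -
    have "Phi y - Phi ?a = measure gauss {?a<..y}" using gauss_real.cdf_diff_eq[OF that] .
    also have "\<dots> = (\<integral>t. indicator {?a<..y} t \<partial>gauss)" by simp
    also have "\<dots> = (\<integral>t. \<phi> t * indicator {?a<..y} t \<partial>lborel)"
      unfolding gauss_real by (subst integral_density) auto
    also have "\<dots> = (LINT t:{?a..y}|lborel. \<phi> t)"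
      unfolding set_lebesgue_integral_def
      by (intro integral_cong_AE) (use AE_lborel_singleton[of ?a] in \<open>auto simp: indicator_def split: if_splits\<close>)
    also have "\<dots> = integral {?a..y} \<phi>"
      by (intro set_borel_integral_eq_integral borel_integrable_atLeastAtMost')
         (rule cont)
    finally show ?thesis by simp
  qed
  show ?thesis
    by (rule has_field_derivative_transform_within_open[OF d, of "{?a<..}"]) (auto simp: eq)
qed

lemma isCont_Phi: "isCont Phi x"
  using Phi_deriv DERIV_isCont by blast

lemma Phi_strict_mono: "a < b \<Longrightarrow> Phi a < Phi b"
  by (rule DERIV_pos_imp_increasing) (use Phi_deriv phi_pos in blast)+

lemma Phi_le_iff [simp]: "Phi a \<le> Phi b \<longleftrightarrow> a \<le> b"
  and Phi_eq_iff [simp]: "Phi a = Phi b \<longleftrightarrow> a = b"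
  using Phi_strict_mono[of a b] Phi_strict_mono[of b a] by (cases a b rule: linorder_cases; force)+

lemma Phi_pos: "0 < Phi a" and Phi_less_1: "Phi a < 1"
  using Phi_strict_mono[of "a - 1" a] Phi_strict_mono[of a "a + 1"]
    gauss_real.cdf_nonneg[of "a - 1"] gauss_real.cdf_bounded_prob[of "a + 1"] by linarith+

lemma borel_measurable_Phi [measurable]: "Phi \<in> borel_measurable borel"
  by (rule borel_measurable_continuous_onI) (auto intro: continuous_at_imp_continuous_on isCont_Phi)

text \<open>Only used on the open interval from 0 to 1, where the preimage exists and is unique.\<close>

definition quantile :: "real \<Rightarrow> real" where
  "quantile m = (THE a. Phi a = m)"

lemma quantile_Phi [simp]: "quantile (Phi a) = a"
  unfolding quantile_def by (rule the_equality) auto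

lemma Phi_surj: "0 < m \<Longrightarrow> m < 1 \<Longrightarrow> \<exists>a. Phi a = m"
proof -
  assume m: "0 < m" "m < 1"
  have "eventually (\<lambda>x. Phi x < m) at_bot"
    using order_tendstoD(2)[OF gauss_real.cdf_lim_at_bot m(1)] .
  then obtain l where l: "Phi l < m" by (auto simp: eventually_at_bot_linorder)
  have "eventually (\<lambda>x. m < Phi x) at_top"
    using order_tendstoD(1)[OF gauss_real.cdf_lim_at_top_prob m(2)] .
  then obtain u where u: "m < Phi u" by (auto simp: eventually_at_top_linorder)
  have "l \<le> u" using l u Phi_le_iff[of u l] by linarith
  then show ?thesis using IVT[of Phi l m u] l u isCont_Phi by auto
qed

lemma Phi_quantile [simp]: "0 < m \<Longrightarrow> m < 1 \<Longrightarrow> Phi (quantile m) = m"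
  using Phi_surj by fastforce

lemma quantile_mono: "0 < x \<Longrightarrow> x \<le> y \<Longrightarrow> y < 1 \<Longrightarrow> quantile x \<le> quantile y"
  by (subst Phi_le_iff[symmetric]) auto

lemma quantile_deriv:
  assumes "0 < m" "m < 1"
  shows "(quantile has_real_derivative 1 / \<phi> (quantile m)) (at m)"
proof -
  have "isCont quantile (Phi (quantile m))"
    by (rule isCont_inverse_function[where d = 1]) (auto simp: isCont_Phi)
  then have "isCont quantile m" using assms by simp
  then have "(quantile has_real_derivative inverse (\<phi> (quantile m))) (at m)"
    using assms phi_pos[of "quantile m"] Phi_deriv
    by (intro DERIV_inverse_function[where f = Phi and a = 0 and b = 1]) auto
  then show ?thesis by (simp add: inverse_eq_divide)
qed

lemma measure_gauss_halfspace:
  fixes \<theta> :: "'a::euclidean_space"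
  assumes "norm \<theta> = 1"
  shows "measure gauss {z. - (\<theta> \<bullet> z) \<le> a} = Phi a"
proof -
  have "measure gauss {z. - (\<theta> \<bullet> z) \<le> a} = measure (distr gauss borel (\<lambda>z. (- \<theta>) \<bullet> z)) {..a}"
    by (subst measure_distr) (auto intro: arg_cong[where f = "measure gauss"])
  also have "\<dots> = Phi a" using assms by (subst distr_gauss_inner) (auto simp: cdf_def)
  finally show ?thesis .
qed

lemma mehler_halfspace:
  fixes \<theta> :: "'a::euclidean_space"
  assumes "norm \<theta> = 1" and "0 < c"
  shows "mehler s c (indicator {z. - (\<theta> \<bullet> z) \<le> a}) z = Phi ((a + s * (\<theta> \<bullet> z)) / c)"
proof -
  have "mehler s c (indicator {z. - (\<theta> \<bullet> z) \<le> a}) z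
      = (\<integral>w. indicator {w. - (\<theta> \<bullet> w) \<le> (a + s * (\<theta> \<bullet> z)) / c} w \<partial>gauss)"
    unfolding mehler_def using \<open>0 < c\<close>
    by (intro Bochner_Integration.integral_cong) (auto simp: indicator_def inner_add_right field_simps)
  then show ?thesis using measure_gauss_halfspace[OF assms(1)] by simp
qed

lemma deriv_of_quadratic_bound:
  fixes f :: "real \<Rightarrow> real"
  assumes "\<And>t. \<bar>f (x + t) - f x - t * D\<bar> \<le> C * t\<^sup>2"
  shows "(f has_real_derivative D) (at x)"
proof -
  have "((\<lambda>t. (f (x + t) - f x) / t - D) \<longlongrightarrow> 0) (at 0)"
  proof (rule Lim_null_comparison)
    show "\<forall>\<^sub>F t in at 0. norm ((f (x + t) - f x) / t - D) \<le> C * \<bar>t\<bar>"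
    proof (rule eventually_at_filter[THEN iffD2], intro always_eventually allI impI)
      fix t :: real assume t: "t \<noteq> 0"
      then have "(f (x + t) - f x) / t - D = (f (x + t) - f x - t * D) / t" by (simp add: field_simps)
      then have "norm ((f (x + t) - f x) / t - D) \<le> C * t\<^sup>2 / \<bar>t\<bar>"
        using assms[of t] t by (simp add: divide_right_mono)
      also have "\<dots> = C * \<bar>t\<bar>" using t by (simp add: power2_eq_square field_simps flip: abs_mult)
      finally show "norm ((f (x + t) - f x) / t - D) \<le> C * \<bar>t\<bar>" .
    qed
    show "((\<lambda>t. C * \<bar>t\<bar>) \<longlongrightarrow> 0) (at 0)" by (auto intro!: tendsto_eq_intros)
  qed
  then have "((\<lambda>t. (f (x + t) - f x) / t) \<longlongrightarrow> D) (at 0)" by (simp add: LIM_zero_iff)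
  then show ?thesis by (simp add: DERIV_def)
qed

text \<open>By \<open>mehler_expansion\<close> with \<open>c = 1\<close>, this moment is the derivative of the measure of the half-space under translation
along \<open>\<theta>\<close>, that is, the derivative of \<open>Phi\<close> at \<open>a\<close>.\<close>

lemma gauss_moment_halfspace:
  fixes \<theta> :: "'a::euclidean_space"
  assumes "norm \<theta> = 1"
  shows "\<theta> \<bullet> gauss_moment (indicator {z. - (\<theta> \<bullet> z) \<le> a}) = \<phi> a"
proof -
  let ?k = "indicator {z. - (\<theta> \<bullet> z) \<le> a} :: 'a \<Rightarrow> real"
  have tt: "\<theta> \<bullet> \<theta> = 1" using assms by (simp add: norm_eq_1)
  have "\<bar>Phi (a + t) - Phi a - t * (\<theta> \<bullet> gauss_moment ?k)\<bar> \<le> 3 * t\<^sup>2" for t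
    using mehler_expansion[of 1 ?k t \<theta>]
    by (simp add: assms mehler_halfspace[OF assms] tt inner_commute[of "gauss_moment ?k" \<theta>])
  from DERIV_unique[OF deriv_of_quadratic_bound[OF this] Phi_deriv] show ?thesis .
qed

text \<open>The bathtub principle. With \<open>h\<close> the indicator of the half-space of the same mean, \<open>(h z - k z) * (\<theta> \<bullet> z + a)\<close> is
nonnegative everywhere, and its integral is the difference of the two moments in direction \<open>\<theta>\<close>. In the case of
equality it vanishes almost everywhere, and the boundary hyperplane is a null set.\<close>

lemma gauss_moment_le_phi:
  fixes k :: "'a::euclidean_space \<Rightarrow> real"
  assumes k[measurable]: "k \<in> borel_measurable borel" and k0: "\<And>x. 0 \<le> k x" and k1: "\<And>x. k x \<le> 1"
    and th: "norm \<theta> = 1" and m: "(\<integral>x. k x \<partial>gauss) = Phi a"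
  shows "\<theta> \<bullet> gauss_moment k \<le> \<phi> a"
    and "\<theta> \<bullet> gauss_moment k = \<phi> a \<Longrightarrow> AE z in gauss. k z = indicator {z. - (\<theta> \<bullet> z) \<le> a} z"
proof -
  let ?h = "indicator {z. - (\<theta> \<bullet> z) \<le> a} :: 'a \<Rightarrow> real"
  have kb: "\<bar>k x\<bar> \<le> 1" for x using k0[of x] k1[of x] by simp
  have i: "integrable gauss k" "integrable gauss ?h" "integrable gauss (\<lambda>z. k z * (\<theta> \<bullet> z))"
    "integrable gauss (\<lambda>z. ?h z * (\<theta> \<bullet> z))"
    using kb by (auto intro!: integrable_gauss_bounded[where B = 1] integrable_gauss_moment)
  let ?d = "\<lambda>z. (?h z - k z) * (\<theta> \<bullet> z + a)"
  have d0: "0 \<le> ?d z" for z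
    using k0[of z] k1[of z]
    by (cases "- (\<theta> \<bullet> z) \<le> a") (auto intro: mult_nonneg_nonneg mult_nonneg_nonpos)
  have deq: "?d z = ?h z * (\<theta> \<bullet> z) - k z * (\<theta> \<bullet> z) + a * ?h z - a * k z" for z
    by (simp add: algebra_simps)
  have id: "integrable gauss ?d" unfolding deq using i by simp
  have "(\<integral>z. ?d z \<partial>gauss) = \<theta> \<bullet> gauss_moment ?h - \<theta> \<bullet> gauss_moment k"
    unfolding deq using i kb m measure_gauss_halfspace[OF th] by (simp add: inner_gauss_moment)
  then have d: "(\<integral>z. ?d z \<partial>gauss) = \<phi> a - \<theta> \<bullet> gauss_moment k"
    using gauss_moment_halfspace[OF th] by simp
  moreover have "0 \<le> (\<integral>z. ?d z \<partial>gauss)" using d0 by (intro integral_nonneg_AE) auto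
  ultimately show "\<theta> \<bullet> gauss_moment k \<le> \<phi> a" by simp
  assume "\<theta> \<bullet> gauss_moment k = \<phi> a"
  then have "AE z in gauss. ?d z = 0"
    using integral_nonneg_eq_0_iff_AE[OF id] d0 d by simp
  moreover have "AE z in gauss. \<theta> \<bullet> z \<noteq> - a"
  proof -
    have "AE x in (gauss :: real measure). x \<noteq> - a"
      unfolding AE_gauss_iff by (rule AE_lborel_singleton)
    then show ?thesis unfolding distr_gauss_inner[OF th, symmetric] by (subst (asm) AE_distr_iff) auto
  qed
  ultimately show "AE z in gauss. k z = ?h z" by eventually_elim auto
qed

lemma norm_gauss_moment_le_phi:
  fixes k :: "'a::euclidean_space \<Rightarrow> real"
  assumes "k \<in> borel_measurable borel" "\<And>x. 0 \<le> k x" "\<And>x. k x \<le> 1" "(\<integral>x. k x \<partial>gauss) = Phi a"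
  shows "norm (gauss_moment k) \<le> \<phi> a"
proof (cases "gauss_moment k = 0")
  case True then show ?thesis using phi_pos[of a] by simp
next
  case False
  let ?\<theta> = "(1 / norm (gauss_moment k)) *\<^sub>R gauss_moment k"
  have "?\<theta> \<bullet> gauss_moment k = norm (gauss_moment k)"
    using False by (simp add: power2_norm_eq_inner[symmetric] power2_eq_square)
  with gauss_moment_le_phi(1)[OF assms(1-3) _ assms(4), of ?\<theta>] False show ?thesis by simp
qed

section \<open>The value attained by half-spaces\<close>

lemma integral_gauss_real:
  fixes f :: "real \<Rightarrow> real"
  assumes "f \<in> borel_measurable borel"
  shows "(\<integral>x. f x \<partial>gauss) = (\<integral>x. \<phi> x * f x \<partial>lborel)"
  unfolding gauss_real using assms by (subst integral_density) auto

lemma abs_mehler_le: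
  assumes "k \<in> borel_measurable borel" and "\<And>x. \<bar>k x\<bar> \<le> B"
  shows "\<bar>mehler s c k z\<bar> \<le> B"
proof -
  have "- B \<le> k x" "k x \<le> B" for x using assms(2)[of x] by (auto simp: abs_le_iff)
  then show ?thesis using mehler_bounds[OF assms(1), of "- B" B s c z] by (simp add: abs_le_iff)
qed

text \<open>Differentiation under the integral, by dominated convergence of the difference quotients.\<close>

lemma mehler_real_deriv:
  fixes g :: "real \<Rightarrow> real"
  assumes d: "\<And>x. (g has_real_derivative g' x) (at x)" and b: "\<And>x. \<bar>g x\<bar> \<le> B0"
    and b': "\<And>x. \<bar>g' x\<bar> \<le> B" and [measurable]: "g' \<in> borel_measurable borel"
  shows "(mehler s c g has_real_derivative s * mehler s c g' a) (at a)"
proof -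
  have "continuous_on UNIV g" by (intro continuous_at_imp_continuous_on ballI DERIV_isCont[OF d])
  then have g[measurable]: "g \<in> borel_measurable borel" by (rule borel_measurable_continuous_onI)
  have d1: "((\<lambda>y. g (s * y + c * w)) has_real_derivative s * g' (s * y + c * w)) (at y)" for y w
  proof -
    have "((\<lambda>y. s * y + c * w) has_real_derivative s) (at y)" by (auto intro!: derivative_eq_intros)
    from DERIV_chain2[OF d this] show ?thesis by (simp add: mult.commute)
  qed
  have lip: "\<bar>g (s * y + c * w) - g (s * a + c * w)\<bar> \<le> \<bar>s\<bar> * B * \<bar>y - a\<bar>" for y w
  proof -
    have "norm (g (s * y + c * w) - g (s * a + c * w)) \<le> \<bar>s\<bar> * B * norm (y - a)"
      by (rule field_differentiable_bound[where S = UNIV and f = "\<lambda>y. g (s * y + c * w)" and f' = "\<lambda>y. s * g' (s * y + c * w)"])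
         (auto simp: abs_mult intro!: mult_left_mono d1 b')
    then show ?thesis by simp
  qed
  have ig: "integrable gauss (\<lambda>w. g (s * y + c * w))" for y
    using b by (intro integrable_gauss_bounded[where B = B0]) auto
  have "((\<lambda>y. (mehler s c g y - mehler s c g a) / (y - a)) \<longlongrightarrow> s * mehler s c g' a) (at a)"
    unfolding tendsto_at_iff_sequentially
  proof (intro allI impI)
    fix X :: "nat \<Rightarrow> real" assume X: "\<forall>i. X i \<in> UNIV - {a}" and Xa: "X \<longlonglongrightarrow> a"
    have "(\<lambda>i. \<integral>w. (g (s * X i + c * w) - g (s * a + c * w)) / (X i - a) \<partial>gauss)
        \<longlonglongrightarrow> (\<integral>w. s * g' (s * a + c * w) \<partial>gauss)"
    proof (rule integral_dominated_convergence[where w = "\<lambda>_. \<bar>s\<bar> * B"])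
      show "AE w in gauss. (\<lambda>i. (g (s * X i + c * w) - g (s * a + c * w)) / (X i - a)) \<longlonglongrightarrow> s * g' (s * a + c * w)"
      proof (rule AE_I2)
        fix w :: real
        have "((\<lambda>y. (g (s * y + c * w) - g (s * a + c * w)) / (y - a)) \<longlongrightarrow> s * g' (s * a + c * w)) (at a)"
          using d1[of w a] unfolding has_field_derivative_iff .
        then show "(\<lambda>i. (g (s * X i + c * w) - g (s * a + c * w)) / (X i - a)) \<longlonglongrightarrow> s * g' (s * a + c * w)"
          unfolding tendsto_at_iff_sequentially using X Xa by (auto simp: comp_def)
      qed
      fix i
      show "AE w in gauss. norm ((g (s * X i + c * w) - g (s * a + c * w)) / (X i - a)) \<le> \<bar>s\<bar> * B"
        using lip[of "X i"] X by (auto simp: field_simps)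
    qed auto
    moreover have "(\<integral>w. (g (s * X i + c * w) - g (s * a + c * w)) / (X i - a) \<partial>gauss)
        = (mehler s c g (X i) - mehler s c g a) / (X i - a)" for i
      using ig by (simp add: mehler_def)
    moreover have "(\<integral>w. s * g' (s * a + c * w) \<partial>gauss) = s * mehler s c g' a" by (simp add: mehler_def)
    ultimately show "((\<lambda>y. (mehler s c g y - mehler s c g a) / (y - a)) \<circ> X) \<longlonglongrightarrow> s * mehler s c g' a"
      by (simp only: comp_def)
  qed
  then show ?thesis unfolding has_field_derivative_iff .
qed

text \<open>Convex functions on \<open>[0, 1]\<close> with three bounded derivatives in the interior. The third derivative is needed to
control the cubic remainder of the value function.\<close>

locale smooth_convex_profile =
  fixes \<psi> \<psi>1 \<psi>2 \<psi>3 :: "real \<Rightarrow> real" and B :: real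
  assumes measurable_profile [measurable]: "\<psi> \<in> borel_measurable borel" "\<psi>1 \<in> borel_measurable borel"
      "\<psi>2 \<in> borel_measurable borel" "\<psi>3 \<in> borel_measurable borel"
    and deriv1: "\<And>t. 0 < t \<Longrightarrow> t < 1 \<Longrightarrow> (\<psi> has_real_derivative \<psi>1 t) (at t)"
    and deriv2: "\<And>t. 0 < t \<Longrightarrow> t < 1 \<Longrightarrow> (\<psi>1 has_real_derivative \<psi>2 t) (at t)"
    and deriv3: "\<And>t. 0 < t \<Longrightarrow> t < 1 \<Longrightarrow> (\<psi>2 has_real_derivative \<psi>3 t) (at t)"
    and continuous_profile: "continuous_on {0..1} \<psi>"
    and bound0: "\<And>t. 0 \<le> t \<Longrightarrow> t \<le> 1 \<Longrightarrow> \<bar>\<psi> t\<bar> \<le> B"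
    and bound1: "\<And>t. 0 < t \<Longrightarrow> t < 1 \<Longrightarrow> \<bar>\<psi>1 t\<bar> \<le> B"
    and bound2: "\<And>t. 0 < t \<Longrightarrow> t < 1 \<Longrightarrow> \<bar>\<psi>2 t\<bar> \<le> B"
    and bound3: "\<And>t. 0 < t \<Longrightarrow> t < 1 \<Longrightarrow> \<bar>\<psi>3 t\<bar> \<le> B"
    and convex: "\<And>t. 0 < t \<Longrightarrow> t < 1 \<Longrightarrow> 0 \<le> \<psi>2 t"

text \<open>The expectation of \<open>\<psi>\<close> at the end of the martingale of a half-space that currently has the value \<open>m\<close>, where \<open>c\<^sup>2\<close> is the
ratio of the remaining variance at the end to the one now. At the end points 0 and 1 the martingale is constant and the
value is \<open>\<psi> m\<close>; outside the unit interval this formula is a default that keeps the function measurable.\<close>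

definition halfspace_value :: "(real \<Rightarrow> real) \<Rightarrow> real \<Rightarrow> real \<Rightarrow> real" where
  "halfspace_value \<psi> c m =
     (if 0 < m \<and> m < 1
      then mehler (1 / c) (sqrt (1 - c\<^sup>2) / c) (\<lambda>x. \<psi> (Phi x)) (quantile m) else \<psi> m)"

lemma halfspace_value_Phi:
  "halfspace_value \<psi> c (Phi a) = (\<integral>z. \<psi> (Phi ((a + sqrt (1 - c\<^sup>2) * z) / c)) \<partial>gauss)"
  by (simp add: halfspace_value_def Phi_pos Phi_less_1 mehler_def add_divide_distrib)

lemma halfspace_value_1 [simp]: "halfspace_value \<psi> 1 m = \<psi> m"
  by (simp add: halfspace_value_def mehler_def prob_gauss_UNIV)

context smooth_convex_profile
begin

abbreviation "V \<equiv> halfspace_value \<psi>"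

text \<open>The derivative of the profile, read in the coordinate \<open>a\<close> with \<open>m = Phi a\<close>, and its first two derivatives in
\<open>a\<close>. The Gaussian factors keep the latter bounded on the whole line.\<close>

definition L1 :: "real \<Rightarrow> real" where "L1 a = \<psi>1 (Phi a)"
definition L2 :: "real \<Rightarrow> real" where "L2 a = \<psi>2 (Phi a) * \<phi> a"
definition L3 :: "real \<Rightarrow> real" where "L3 a = \<psi>3 (Phi a) * \<phi> a * \<phi> a + \<psi>2 (Phi a) * (- a * \<phi> a)"

lemma measurable_L [measurable]: "L1 \<in> borel_measurable borel" "L2 \<in> borel_measurable borel" "L3 \<in> borel_measurable borel"
  unfolding L1_def L2_def L3_def by measurable

lemma deriv_L1: "(L1 has_real_derivative L2 a) (at a)"
  unfolding L1_def L2_def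
  by (rule DERIV_chain2[OF deriv2 Phi_deriv]) (auto simp: Phi_pos Phi_less_1)

lemma deriv_L2: "(L2 has_real_derivative L3 a) (at a)"
proof -
  have "((\<lambda>a. \<psi>2 (Phi a)) has_real_derivative \<psi>3 (Phi a) * \<phi> a) (at a)"
    by (rule DERIV_chain2[OF deriv3 Phi_deriv]) (auto simp: Phi_pos Phi_less_1)
  from DERIV_mult[OF this phi_deriv] show ?thesis
    unfolding L2_def[abs_def] L3_def by (simp add: algebra_simps)
qed

lemma B_nonneg: "0 \<le> B" using bound0[of 0] by simp

lemma bound_L: "\<bar>L1 a\<bar> \<le> B" "\<bar>L2 a\<bar> \<le> B" "\<bar>L3 a\<bar> \<le> 2 * B"
proof -
  have m: "0 < Phi a" "Phi a < 1" by (simp_all add: Phi_pos Phi_less_1)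
  have p: "\<bar>\<phi> a\<bar> \<le> 1" using phi_le_1[of a] phi_pos[of a] by simp
  show "\<bar>L1 a\<bar> \<le> B" unfolding L1_def using bound1[OF m] .
  have "\<bar>L2 a\<bar> \<le> B * 1" unfolding L2_def abs_mult using bound2[OF m] p B_nonneg by (intro mult_mono) auto
  then show "\<bar>L2 a\<bar> \<le> B" by simp
  have "\<bar>\<psi>3 (Phi a) * \<phi> a * \<phi> a\<bar> \<le> B * 1 * 1"
    unfolding abs_mult using bound3[OF m] p B_nonneg by (intro mult_mono) auto
  moreover have "\<bar>- a * \<phi> a\<bar> \<le> 1" using abs_mult_phi_le_1[of a] phi_pos[of a] by (simp add: abs_mult)
  then have "\<bar>\<psi>2 (Phi a)\<bar> * \<bar>- a * \<phi> a\<bar> \<le> B * 1"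
    using bound2[OF m] B_nonneg by (intro mult_mono) auto
  ultimately show "\<bar>L3 a\<bar> \<le> 2 * B" unfolding L3_def abs_mult[of "\<psi>2 (Phi a)", symmetric] by linarith
qed

lemma L2_nonneg: "0 \<le> L2 a"
  unfolding L2_def using convex[of "Phi a"] by (simp add: Phi_pos Phi_less_1)

text \<open>Derivatives of \<open>V c\<close> in \<open>m\<close>, written in the coordinate \<open>a = quantile m\<close>.\<close>

definition V1 :: "real \<Rightarrow> real \<Rightarrow> real" where
  "V1 c m = mehler c (sqrt (1 - c\<^sup>2)) L1 (quantile m)"
definition V2 :: "real \<Rightarrow> real \<Rightarrow> real" where
  "V2 c m = c * mehler c (sqrt (1 - c\<^sup>2)) L2 (quantile m) / \<phi> (quantile m)"
definition V3 :: "real \<Rightarrow> real \<Rightarrow> real" where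
  "V3 c m = (let a = quantile m in (c\<^sup>2 * mehler c (sqrt (1 - c\<^sup>2)) L3 a + c * mehler c (sqrt (1 - c\<^sup>2)) L2 a * a) / (\<phi> a)\<^sup>2)"

text \<open>Differentiating in \<open>a\<close> produces the weight \<open>\<phi> ((a + \<kappa> z) / c)\<close> under a Gaussian integral. Its product with the
density of \<open>z\<close> factors, after the substitution \<open>z = c w - \<kappa> a\<close>, as \<open>\<phi> w * \<phi> a\<close>, and \<open>\<phi> a\<close> cancels against the
derivative of the quantile. The outcome is an average of the increasing function \<open>L1\<close> at a point increasing in \<open>m\<close>,
which is why \<open>V c\<close> is convex.\<close>

lemma V_deriv:
  assumes c: "0 < c" "c \<le> 1" and m: "0 < m" "m < 1"
  shows "(V c has_real_derivative V1 c m) (at m)"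
proof -
  define \<kappa> where "\<kappa> = sqrt (1 - c\<^sup>2)"
  have ck: "c\<^sup>2 + \<kappa>\<^sup>2 = 1" unfolding \<kappa>_def using c by (simp add: power_le_one)
  define a where "a = quantile m"
  let ?g = "\<lambda>x. \<psi> (Phi x)" and ?g' = "\<lambda>x. \<psi>1 (Phi x) * \<phi> x"
  have dg: "(?g has_real_derivative ?g' x) (at x)" for x
    by (rule DERIV_chain2[OF deriv1 Phi_deriv]) (auto simp: Phi_pos Phi_less_1)
  have bg: "\<bar>?g x\<bar> \<le> B" for x using bound0[of "Phi x"] Phi_pos[of x] Phi_less_1[of x] by simp
  have bg': "\<bar>?g' x\<bar> \<le> B" for x
  proof -
    have "\<bar>?g' x\<bar> \<le> B * 1"
      unfolding abs_mult using bound1[of "Phi x"] Phi_pos[of x] Phi_less_1[of x] phi_le_1[of x] phi_pos[of x] B_nonneg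
      by (intro mult_mono) auto
    then show ?thesis by simp
  qed
  have d: "(mehler (1 / c) (\<kappa> / c) ?g has_real_derivative (1 / c) * mehler (1 / c) (\<kappa> / c) ?g' a) (at a)"
    by (rule mehler_real_deriv[OF dg bg bg']) simp
  have key: "(1 / c) * mehler (1 / c) (\<kappa> / c) ?g' a = \<phi> a * mehler c \<kappa> L1 a"
  proof -
    \<comment> \<open>The pair of arguments is a rotation of \<open>(w, a)\<close>.\<close>
    have e: "\<phi> (c * w - \<kappa> * a) * \<phi> (c * a + \<kappa> * w) = \<phi> w * \<phi> a" for w
    proof -
      have "(c * w - \<kappa> * a)\<^sup>2 + (c * a + \<kappa> * w)\<^sup>2 = (c\<^sup>2 + \<kappa>\<^sup>2) * (w\<^sup>2 + a\<^sup>2)"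
        by (simp add: power2_eq_square algebra_simps)
      then have "(c * w - \<kappa> * a)\<^sup>2 + (c * a + \<kappa> * w)\<^sup>2 = w\<^sup>2 + a\<^sup>2" by (simp add: ck)
      then have "- (c * w - \<kappa> * a)\<^sup>2 / 2 + - (c * a + \<kappa> * w)\<^sup>2 / 2 = - w\<^sup>2 / 2 + - a\<^sup>2 / 2"
        by linarith
      then have "exp (- (c * w - \<kappa> * a)\<^sup>2 / 2) * exp (- (c * a + \<kappa> * w)\<^sup>2 / 2) = exp (- w\<^sup>2 / 2) * exp (- a\<^sup>2 / 2)"
        unfolding exp_add[symmetric] by simp
      then show ?thesis by (simp add: std_normal_density_def)
    qed
    have arg: "(1 / c) * a + (\<kappa> / c) * (- (\<kappa> * a) + c * w) = c * a + \<kappa> * w" for w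
    proof -
      have "c * ((1 / c) * a + (\<kappa> / c) * (- (\<kappa> * a) + c * w)) = (1 - \<kappa>\<^sup>2) * a + \<kappa> * c * w"
        using c by (simp add: field_simps power2_eq_square)
      also have "1 - \<kappa>\<^sup>2 = c\<^sup>2" using ck by simp
      finally have "c * ((1 / c) * a + (\<kappa> / c) * (- (\<kappa> * a) + c * w)) = c * (c * a + \<kappa> * w)"
        by (simp add: algebra_simps power2_eq_square)
      then show ?thesis using c by simp
    qed
    have "mehler (1 / c) (\<kappa> / c) ?g' a = (\<integral>z. \<phi> z * ?g' ((1 / c) * a + (\<kappa> / c) * z) \<partial>lborel)"
      unfolding mehler_def by (subst integral_gauss_real) auto
    also have "\<dots> = \<bar>c\<bar> *\<^sub>R (\<integral>w. \<phi> (- (\<kappa> * a) + c * w) * ?g' ((1 / c) * a + (\<kappa> / c) * (- (\<kappa> * a) + c * w)) \<partial>lborel)"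
      using c by (intro lborel_integral_real_affine) auto
    also have "\<dots> = c * (\<integral>w. \<phi> (c * w - \<kappa> * a) * ?g' (c * a + \<kappa> * w) \<partial>lborel)"
      unfolding arg using c by (simp add: add.commute)
    also have "(\<integral>w. \<phi> (c * w - \<kappa> * a) * ?g' (c * a + \<kappa> * w) \<partial>lborel) = (\<integral>w. \<phi> a * (\<phi> w * L1 (c * a + \<kappa> * w)) \<partial>lborel)"
    proof (rule Bochner_Integration.integral_cong[OF refl])
      fix w
      have "\<phi> (c * w - \<kappa> * a) * ?g' (c * a + \<kappa> * w) = (\<phi> (c * w - \<kappa> * a) * \<phi> (c * a + \<kappa> * w)) * L1 (c * a + \<kappa> * w)"
        by (simp add: L1_def)
      then show "\<phi> (c * w - \<kappa> * a) * ?g' (c * a + \<kappa> * w) = \<phi> a * (\<phi> w * L1 (c * a + \<kappa> * w))"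
        unfolding e by simp
    qed
    also have "\<dots> = \<phi> a * (\<integral>w. \<phi> w * L1 (c * a + \<kappa> * w) \<partial>lborel)" by (rule integral_mult_right_zero)
    also have "(\<integral>w. \<phi> w * L1 (c * a + \<kappa> * w) \<partial>lborel) = mehler c \<kappa> L1 a"
      unfolding mehler_def by (subst integral_gauss_real) auto
    finally show ?thesis using c by simp
  qed
  have "((\<lambda>m. mehler (1 / c) (\<kappa> / c) ?g (quantile m)) has_real_derivative
      (\<phi> a * mehler c \<kappa> L1 a) * (1 / \<phi> a)) (at m)"
    unfolding a_def by (rule DERIV_chain2[OF d[unfolded key, unfolded a_def] quantile_deriv[OF m]])
  then have "((\<lambda>m. mehler (1 / c) (\<kappa> / c) ?g (quantile m)) has_real_derivative V1 c m) (at m)"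
    using phi_pos[of a] by (simp add: V1_def a_def \<kappa>_def)
  then show ?thesis
    by (rule has_field_derivative_transform_within_open[where S = "{0<..<1}"])
       (use m in \<open>auto simp: halfspace_value_def \<kappa>_def\<close>)
qed

lemma V1_deriv:
  assumes m: "0 < m" "m < 1"
  shows "(V1 c has_real_derivative V2 c m) (at m)"
  unfolding V1_def[abs_def] V2_def
  using DERIV_chain2[OF mehler_real_deriv[OF deriv_L1 bound_L(1) bound_L(2) measurable_L(2)] quantile_deriv[OF m]]
  by simp

lemma V2_deriv:
  assumes m: "0 < m" "m < 1"
  shows "(V2 c has_real_derivative V3 c m) (at m)"
proof -
  let ?\<kappa> = "sqrt (1 - c\<^sup>2)" and ?a = "quantile m"
  have "((\<lambda>a. c * mehler c ?\<kappa> L2 a / \<phi> a) has_real_derivative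
      (c * (c * mehler c ?\<kappa> L3 ?a) * \<phi> ?a - c * mehler c ?\<kappa> L2 ?a * (- ?a * \<phi> ?a)) / (\<phi> ?a * \<phi> ?a)) (at ?a)"
    using phi_pos[of ?a]
    by (intro DERIV_divide DERIV_cmult mehler_real_deriv[OF deriv_L2 bound_L(2) bound_L(3) measurable_L(3)] phi_deriv) auto
  from DERIV_chain2[OF this quantile_deriv[OF m]]
  show ?thesis unfolding V2_def[abs_def] V3_def Let_def
    by (rule DERIV_cong) (use phi_pos[of ?a] in \<open>simp add: power2_eq_square field_simps\<close>)
qed

lemma measurable_V [measurable]:
  assumes "0 < c" "c \<le> 1"
  shows "V c \<in> borel_measurable borel"
proof -
  have "continuous_on {0<..<1} (V c)"
    using V_deriv[OF assms] by (intro continuous_at_imp_continuous_on ballI) (auto intro: DERIV_isCont)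
  then have i: "(\<lambda>m. indicator {0<..<1} m *\<^sub>R V c m) \<in> borel_measurable borel"
    by (intro borel_measurable_continuous_on_indicator) auto
  have "(\<lambda>m. if m \<in> {0<..<1} then indicator {0<..<1} m *\<^sub>R V c m else \<psi> m) \<in> borel_measurable borel"
    by (rule measurable_If_set[OF i measurable_profile(1)]) auto
  moreover have "(\<lambda>m. if m \<in> {0<..<1} then indicator {0<..<1} m *\<^sub>R V c m else \<psi> m) = V c"
    by (rule ext) (auto simp: halfspace_value_def)
  ultimately show ?thesis by simp
qed

lemma bound_V: "0 \<le> m \<Longrightarrow> m \<le> 1 \<Longrightarrow> \<bar>V c m\<bar> \<le> B"
  unfolding halfspace_value_def
  by (auto intro!: abs_mehler_le bound0 simp: Phi_pos Phi_less_1 less_imp_le)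

lemma V2_nonneg: "0 \<le> c \<Longrightarrow> 0 \<le> V2 c m"
  unfolding V2_def using phi_pos[of "quantile m"]
  by (auto intro!: divide_nonneg_pos mult_nonneg_nonneg integral_nonneg_AE simp: mehler_def L2_nonneg)

text \<open>The constant does not depend on \<open>c\<close>. The point \<open>y\<close> may be anywhere in \<open>[0, 1]\<close>, although the derivatives of \<open>V c\<close> can
blow up at the end points: away from \<open>m\<close> the cubic bound follows from boundedness alone.\<close>

lemma V_Taylor:
  assumes \<epsilon>: "0 < \<epsilon>"
  shows "\<exists>K\<ge>0. \<forall>c m y. 0 < c \<longrightarrow> c \<le> 1 \<longrightarrow> \<epsilon> \<le> m \<longrightarrow> m \<le> 1 - \<epsilon> \<longrightarrow> 0 \<le> y \<longrightarrow> y \<le> 1 \<longrightarrow>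
    V2 c m \<le> K \<and> \<bar>V c y - V c m - V1 c m * (y - m) - V2 c m / 2 * (y - m)\<^sup>2\<bar> \<le> K * \<bar>y - m\<bar> ^ 3"
proof -
  define \<delta> where "\<delta> = \<epsilon> / 2"
  define A where "A = \<bar>quantile \<delta>\<bar> + \<bar>quantile (1 - \<delta>)\<bar>"
  define p where "p = \<phi> A"
  have p: "0 < p" unfolding p_def by (rule phi_pos)
  define K1 where "K1 = (2 * B + B * A) / p\<^sup>2"
  define K where "K = max (B / p) (max K1 ((3 * B + B / p) / \<delta> ^ 3))"
  have \<delta>: "0 < \<delta>" using \<epsilon> by (simp add: \<delta>_def)
  have A0: "0 \<le> A" by (simp add: A_def)
  have K0: "0 \<le> K" unfolding K_def using B_nonneg p by (auto simp: le_max_iff_disj)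
  show ?thesis
  proof (rule exI[of _ K], rule conjI[OF K0], intro allI impI)
    fix c m y :: real
    assume c: "0 < c" "c \<le> 1" and m: "\<epsilon> \<le> m" "m \<le> 1 - \<epsilon>" and y: "0 \<le> y" "y \<le> 1"
    have m': "\<delta> \<le> m" "m \<le> 1 - \<delta>" using m \<epsilon> by (auto simp: \<delta>_def)
    have qb: "\<bar>quantile x\<bar> \<le> A" if "\<delta> \<le> x" "x \<le> 1 - \<delta>" for x
      using quantile_mono[of \<delta> x] quantile_mono[of x "1 - \<delta>"] that \<delta> unfolding A_def by linarith
    have \<phi>b: "p \<le> \<phi> (quantile x)" if "\<delta> \<le> x" "x \<le> 1 - \<delta>" for x
      unfolding p_def using phi_antimono_abs[OF qb[OF that]] .
    let ?\<kappa> = "sqrt (1 - c\<^sup>2)"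
    have M2: "\<bar>mehler c ?\<kappa> L2 a\<bar> \<le> B" and M3: "\<bar>mehler c ?\<kappa> L3 a\<bar> \<le> 2 * B" for a
      by (intro abs_mehler_le bound_L measurable_L)+
    have V2b: "\<bar>V2 c m\<bar> \<le> B / p"
    proof -
      have "\<bar>c * mehler c ?\<kappa> L2 (quantile m)\<bar> \<le> 1 * B"
        unfolding abs_mult using c M2 B_nonneg by (intro mult_mono) auto
      then show ?thesis
        unfolding V2_def abs_divide using \<phi>b[OF m'] p B_nonneg by (intro frac_le) auto
    qed
    have V3b: "\<bar>V3 c x\<bar> \<le> K1" if x: "\<delta> \<le> x" "x \<le> 1 - \<delta>" for x
    proof -
      let ?a = "quantile x"
      have "\<bar>c\<^sup>2 * mehler c ?\<kappa> L3 ?a\<bar> \<le> 1 * (2 * B)"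
        unfolding abs_mult using c M3 B_nonneg by (intro mult_mono) (auto simp: power_le_one)
      moreover have "\<bar>c * mehler c ?\<kappa> L2 ?a * ?a\<bar> \<le> 1 * B * A"
        unfolding abs_mult using c M2 B_nonneg qb[OF x] by (intro mult_mono) auto
      ultimately have "\<bar>c\<^sup>2 * mehler c ?\<kappa> L3 ?a + c * mehler c ?\<kappa> L2 ?a * ?a\<bar> \<le> 2 * B + B * A" by linarith
      then show ?thesis
        unfolding V3_def Let_def K1_def abs_divide using \<phi>b[OF x] p B_nonneg A0
        by (intro frac_le) (auto intro!: power_mono)
    qed
    show "V2 c m \<le> K \<and> \<bar>V c y - V c m - V1 c m * (y - m) - V2 c m / 2 * (y - m)\<^sup>2\<bar> \<le> K * \<bar>y - m\<bar> ^ 3"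
    proof
      show "V2 c m \<le> K" using V2b unfolding K_def by linarith
      show "\<bar>V c y - V c m - V1 c m * (y - m) - V2 c m / 2 * (y - m)\<^sup>2\<bar> \<le> K * \<bar>y - m\<bar> ^ 3"
      proof (cases "\<delta> \<le> y \<and> y \<le> 1 - \<delta>")
        case inside: True
        show ?thesis
        proof (cases "y = m")
          case False
          let ?D = "\<lambda>n::nat. if n = 0 then V c else if n = 1 then V1 c else if n = 2 then V2 c else V3 c"
          have dd: "\<forall>n t. n < 3 \<and> \<delta> \<le> t \<and> t \<le> 1 - \<delta> \<longrightarrow> (?D n has_real_derivative ?D (Suc n) t) (at t)"
          proof (intro allI impI)
            fix n :: nat and t assume nt: "n < 3 \<and> \<delta> \<le> t \<and> t \<le> 1 - \<delta>"
            then have "0 < t" "t < 1" using \<delta> by auto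
            moreover have "n = 0 \<or> n = 1 \<or> n = 2" using nt by auto
            ultimately show "(?D n has_real_derivative ?D (Suc n) t) (at t)"
              using V_deriv[OF c] V1_deriv V2_deriv by auto
          qed
          obtain t where t: "if y < m then y < t \<and> t < m else m < t \<and> t < y"
            and eq: "V c y = (\<Sum>n<3. (?D n m / fact n) * (y - m) ^ n) + (?D 3 t / fact 3) * (y - m) ^ 3"
            using Taylor[OF _ _ dd, of "V c" m y] inside m' False by auto
          have "\<delta> \<le> t" "t \<le> 1 - \<delta>" using t inside m' by (auto split: if_splits)
          then have V3t: "\<bar>V3 c t\<bar> \<le> K" using V3b[of t] unfolding K_def by linarith
          have "V c y - V c m - V1 c m * (y - m) - V2 c m / 2 * (y - m)\<^sup>2 = V3 c t / 6 * (y - m) ^ 3"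
            using eq by (simp add: lessThan_nat_numeral fact_numeral numeral_eq_Suc)
          also have "\<bar>\<dots>\<bar> = \<bar>V3 c t\<bar> / 6 * \<bar>y - m\<bar> ^ 3" by (simp add: abs_mult power_abs)
          also have "\<dots> \<le> K * \<bar>y - m\<bar> ^ 3" using V3t K0 by (intro mult_right_mono) auto
          finally show ?thesis .
        qed simp
      next
        case False
        have "\<delta> \<le> \<bar>y - m\<bar>" using False m \<epsilon> unfolding \<delta>_def by linarith
        then have far: "\<delta> ^ 3 \<le> \<bar>y - m\<bar> ^ 3" using \<delta> by (intro power_mono) auto
        have ym: "\<bar>y - m\<bar> \<le> 1" using y m \<epsilon> by auto
        have a: "\<bar>V c y\<bar> \<le> B" by (rule bound_V[OF y])
        have b: "\<bar>V c m\<bar> \<le> B" using m \<epsilon> by (intro bound_V) auto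
        have "\<bar>V1 c m\<bar> \<le> B" unfolding V1_def by (intro abs_mehler_le bound_L measurable_L)
        then have c1: "\<bar>V1 c m * (y - m)\<bar> \<le> B * 1" unfolding abs_mult using ym B_nonneg by (intro mult_mono) auto
        have "\<bar>y - m\<bar>\<^sup>2 \<le> 1" using ym by (intro power_le_one) auto
        moreover have "\<bar>V2 c m / 2\<bar> \<le> B / p" using V2b by linarith
        ultimately have d1: "\<bar>V2 c m / 2 * (y - m)\<^sup>2\<bar> \<le> B / p * 1" unfolding abs_mult
          by (intro mult_mono) (auto simp: B_nonneg less_imp_le[OF p])
        have "\<bar>V c y - V c m - V1 c m * (y - m) - V2 c m / 2 * (y - m)\<^sup>2\<bar> \<le> 3 * B + B / p"
          using a b c1 d1 by linarith
        also have "\<dots> = (3 * B + B / p) / \<delta> ^ 3 * \<delta> ^ 3" using \<delta> by simp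
        also have "\<dots> \<le> K * \<bar>y - m\<bar> ^ 3"
          using far K0 \<delta> unfolding K_def by (intro mult_mono) auto
        finally show ?thesis .
      qed
    qed
  qed
qed

text \<open>The averages \<open>Phi ((a + s z) / c1)\<close> are those of the half-line of mean \<open>Phi a\<close>. Along them the value function is
reproduced exactly, because two independent Gaussian steps combine into one.\<close>

lemma integral_V_halfline:
  assumes c: "0 < c" "c \<le> 1" and s: "0 \<le> s" and c1: "0 < c1" and cs: "c1\<^sup>2 + s\<^sup>2 = 1"
  shows "(\<integral>z. V c (Phi ((a + s * z) / c1)) \<partial>gauss) = V (c * c1) (Phi a)"
proof (cases "c = 1")
  case True
  have "sqrt (1 - c1\<^sup>2) = s" using cs s by (simp add: real_sqrt_unique)
  then show ?thesis using True by (simp add: halfspace_value_Phi prob_gauss_UNIV)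
next
  case False
  then have "c < 1" using c by simp
  define \<kappa> where "\<kappa> = sqrt (1 - c\<^sup>2)"
  have "c\<^sup>2 < 1" using \<open>c < 1\<close> c by (simp add: power_less_one_iff)
  then have \<kappa>: "0 < \<kappa>" "c\<^sup>2 + \<kappa>\<^sup>2 = 1" unfolding \<kappa>_def by auto
  have sq: "(c1 * \<kappa>)\<^sup>2 + s\<^sup>2 = 1 - (c * c1)\<^sup>2"
  proof -
    have "(c1 * \<kappa>)\<^sup>2 = c1\<^sup>2 * (1 - c\<^sup>2)" using \<kappa>(2) by (simp add: power_mult_distrib eq_diff_eq[symmetric])
    then show ?thesis using cs by (simp add: power_mult_distrib algebra_simps)
  qed
  define r where "r = sqrt (1 - (c * c1)\<^sup>2)"
  have "0 < (c1 * \<kappa>)\<^sup>2" using c1 \<kappa> by simp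
  then have "0 < 1 - (c * c1)\<^sup>2" using sq zero_le_power2[of s] by linarith
  then have r: "0 < r" "r\<^sup>2 = 1 - (c * c1)\<^sup>2" unfolding r_def by auto
  let ?g = "\<lambda>x. \<psi> (Phi ((a + r * x) / (c * c1)))"
  have "(\<integral>z. V c (Phi ((a + s * z) / c1)) \<partial>gauss)
      = (\<integral>z. \<integral>w. \<psi> (Phi (((a + s * z) / c1 + \<kappa> * w) / c)) \<partial>gauss \<partial>gauss)"
    by (simp add: halfspace_value_Phi \<kappa>_def)
  also have "\<dots> = (\<integral>z. mehler (s / r) (c1 * \<kappa> / r) ?g z \<partial>gauss)"
  proof -
    have "((a + s * z) / c1 + \<kappa> * w) / c = (a + r * (s / r * z + c1 * \<kappa> / r * w)) / (c * c1)" for z w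
      using c c1 r(1) by (simp add: field_simps)
    then show ?thesis by (simp add: mehler_def)
  qed
  also have "\<dots> = (\<integral>z. ?g z \<partial>gauss)"
  proof (rule integral_mehler[where B = B])
    have "((c1 * \<kappa>)\<^sup>2 + s\<^sup>2) / r\<^sup>2 = 1" unfolding sq r(2)[symmetric] using r(1) by simp
    then show "(c1 * \<kappa> / r)\<^sup>2 + (s / r)\<^sup>2 = 1" by (simp add: power_divide add_divide_distrib)
    show "0 < c1 * \<kappa> / r" using c1 \<kappa> r by simp
    show "\<bar>?g x\<bar> \<le> B" for x by (intro bound0) (auto simp: Phi_pos Phi_less_1 less_imp_le)
  qed simp
  finally show ?thesis by (simp add: halfspace_value_Phi r_def)
qed

end

section \<open>Comparison along the heat flow\<close>

definition heat :: "real \<Rightarrow> ('a::euclidean_space \<Rightarrow> real) \<Rightarrow> 'a \<Rightarrow> real" where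
  "heat v f x = (\<integral>z. f (x + sqrt v *\<^sub>R z) \<partial>gauss)"

lemma heat_0 [simp]: "heat 0 f = f"
  by (rule ext) (simp add: heat_def prob_gauss_UNIV)

lemma borel_measurable_heat [measurable]:
  assumes [measurable]: "f \<in> borel_measurable borel"
  shows "heat v f \<in> borel_measurable borel"
  unfolding heat_def by measurable

lemma heat_bounds:
  assumes [measurable]: "f \<in> borel_measurable borel" and "\<And>x. a \<le> f x" "\<And>x. f x \<le> b"
  shows "a \<le> heat v f x" "heat v f x \<le> b"
  unfolding heat_def using assms by (auto intro!: gauss_integral_bounded)

text \<open>Rescaling space by \<open>sqrt (u + h)\<close> turns one step of the heat flow into a normalised average.\<close>

lemma heat_eq_mehler:
  assumes "0 < u" "0 \<le> h"
  shows "heat u f (x + sqrt h *\<^sub>R z)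
       = mehler (sqrt (h / (u + h))) (sqrt (u / (u + h))) (\<lambda>y. f (x + sqrt (u + h) *\<^sub>R y)) z"
proof -
  have "sqrt (u + h) * sqrt (h / (u + h)) = sqrt h" "sqrt (u + h) * sqrt (u / (u + h)) = sqrt u"
    unfolding real_sqrt_mult[symmetric] using assms by simp_all
  then show ?thesis by (simp add: heat_def mehler_def scaleR_add_right add.assoc)
qed

lemma heat_heat:
  assumes [measurable]: "f \<in> borel_measurable borel" and b: "\<And>x. \<bar>f x\<bar> \<le> B" and "0 \<le> u" "0 \<le> h"
  shows "heat h (heat u f) x = heat (u + h) f x"
proof (cases "u = 0")
  case False
  then have u: "0 < u" using assms by simp
  have "heat h (heat u f) x = (\<integral>z. mehler (sqrt (h / (u + h))) (sqrt (u / (u + h))) (\<lambda>y. f (x + sqrt (u + h) *\<^sub>R y)) z \<partial>gauss)"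
    unfolding heat_def[of h] heat_eq_mehler[OF u \<open>0 \<le> h\<close>] ..
  also have "\<dots> = (\<integral>z. f (x + sqrt (u + h) *\<^sub>R z) \<partial>gauss)"
    using u \<open>0 \<le> h\<close> b
    by (intro integral_mehler[where B = B]) (auto simp: add_divide_distrib[symmetric])
  finally show ?thesis by (simp add: heat_def)
qed simp

lemma heat_halfspace:
  fixes \<theta> :: "'a::euclidean_space"
  assumes th: "norm \<theta> = 1" and v: "0 < v"
  shows "heat v (indicator {x. t \<le> \<theta> \<bullet> x}) x = Phi ((\<theta> \<bullet> x - t) / sqrt v)"
proof -
  have "heat v (indicator {x. t \<le> \<theta> \<bullet> x}) x = (\<integral>z. indicator {z. - (\<theta> \<bullet> z) \<le> (\<theta> \<bullet> x - t) / sqrt v} z \<partial>gauss)"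
    unfolding heat_def using v
    by (intro Bochner_Integration.integral_cong) (auto simp: indicator_def inner_add_right field_simps)
  then show ?thesis using measure_gauss_halfspace[OF th] by simp
qed

lemma heat_profile_halfspace:
  fixes \<theta> :: "'a::euclidean_space" and t :: real
  assumes th: "norm \<theta> = 1" and w: "0 < w" "w \<le> v" and [measurable]: "\<psi> \<in> borel_measurable borel"
  defines "k \<equiv> indicator {x. t \<le> \<theta> \<bullet> x}"
  shows "heat (v - w) (\<lambda>y. \<psi> (heat w k y)) x = halfspace_value \<psi> (sqrt (w / v)) (heat v k x)"
proof -
  have v: "0 < v" using w by simp
  have "heat (v - w) (\<lambda>y. \<psi> (heat w k y)) x
     = (\<integral>z. \<psi> (Phi ((\<theta> \<bullet> x - t + sqrt (v - w) * (\<theta> \<bullet> z)) / sqrt w)) \<partial>gauss)"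
    unfolding heat_def[of "v - w"] k_def heat_halfspace[OF th w(1)] by (simp add: inner_add_right algebra_simps)
  also have "\<dots> = (\<integral>z. \<psi> (Phi ((\<theta> \<bullet> x - t + sqrt (v - w) * z) / sqrt w)) \<partial>gauss)"
    by (intro gauss_marginal[OF th]) simp
  also have "\<dots> = halfspace_value \<psi> (sqrt (w / v)) (Phi ((\<theta> \<bullet> x - t) / sqrt v))"
  proof -
    have e: "sqrt (1 - (sqrt (w / v))\<^sup>2) = sqrt (v - w) / sqrt v"
      using w v by (simp add: real_sqrt_divide[symmetric] diff_divide_distrib)
    have alg: "(X / r + Z / r * z) / (q / r) = (X + Z * z) / q" if "0 < r" "0 < q" for X Z z r q :: real
      using that by (simp add: field_simps)
    have "((\<theta> \<bullet> x - t) / sqrt v + sqrt (1 - (sqrt (w / v))\<^sup>2) * z) / sqrt (w / v)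
        = (\<theta> \<bullet> x - t + sqrt (v - w) * z) / sqrt w" for z
      unfolding e unfolding real_sqrt_divide[of w v] using w v by (intro alg) auto
    then show ?thesis by (simp add: halfspace_value_Phi)
  qed
  finally show ?thesis unfolding k_def heat_halfspace[OF th v] .
qed

context smooth_convex_profile
begin

text \<open>One step of the comparison. Both the averages of \<open>k\<close> and those of the half-line with the same mean are inserted into the
second-order expansion of \<open>V c\<close>; the linear terms vanish since both have mean \<open>m\<close>. For \<open>k\<close> the second moment is
known from above by \<open>mehler_increment_moments\<close>, for the half-line it is known from below by testing against \<open>z\<close>.\<close>

lemma V_step:
  assumes \<epsilon>: "0 < \<epsilon>"
  shows "\<exists>C\<ge>0. \<forall>(k::'a::euclidean_space \<Rightarrow> real) c s c1.
     k \<in> borel_measurable borel \<longrightarrow> (\<forall>x. 0 \<le> k x \<and> k x \<le> 1) \<longrightarrow>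
     \<epsilon> \<le> (\<integral>x. k x \<partial>gauss) \<longrightarrow> (\<integral>x. k x \<partial>gauss) \<le> 1 - \<epsilon> \<longrightarrow>
     0 < c \<longrightarrow> c \<le> 1 \<longrightarrow> 0 < c1 \<longrightarrow> 0 \<le> s \<longrightarrow> s \<le> c1 \<longrightarrow> c1\<^sup>2 + s\<^sup>2 = 1 \<longrightarrow>
     (\<integral>z. V c (mehler s c1 k z) \<partial>gauss) \<le> V (c * c1) (\<integral>x. k x \<partial>gauss)
       + V2 c (\<integral>x. k x \<partial>gauss) / 2 * s\<^sup>2
          * ((norm (gauss_moment k))\<^sup>2 - (\<phi> (quantile (\<integral>x. k x \<partial>gauss)))\<^sup>2)
       + C * s ^ 3"
proof -
  obtain K where K0: "0 \<le> K" and K: "\<And>c m y. 0 < c \<Longrightarrow> c \<le> 1 \<Longrightarrow> \<epsilon> \<le> m \<Longrightarrow> m \<le> 1 - \<epsilon> \<Longrightarrow> 0 \<le> y \<Longrightarrow> y \<le> 1 \<Longrightarrow>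
      V2 c m \<le> K \<and> \<bar>V c y - V c m - V1 c m * (y - m) - V2 c m / 2 * (y - m)\<^sup>2\<bar> \<le> K * \<bar>y - m\<bar> ^ 3"
    using V_Taylor[OF \<epsilon>] by blast
  obtain C1 where C1: "0 \<le> C1" and inc: "\<And>(k::'a \<Rightarrow> real) s c.
     k \<in> borel_measurable borel \<Longrightarrow> (\<forall>x. \<bar>k x\<bar> \<le> 1) \<Longrightarrow> 0 < c \<Longrightarrow> 0 \<le> s \<Longrightarrow> s \<le> c \<Longrightarrow> c\<^sup>2 + s\<^sup>2 = 1 \<Longrightarrow>
     (\<integral>z. (mehler s c k z - (\<integral>w. k w \<partial>gauss))\<^sup>2 \<partial>gauss) \<le> s\<^sup>2 * (norm (gauss_moment k))\<^sup>2 + C1 * s ^ 3 \<and>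
     (\<integral>z. \<bar>mehler s c k z - (\<integral>w. k w \<partial>gauss)\<bar> ^ 3 \<partial>gauss) \<le> C1 * s ^ 3"
    using mehler_increment_moments[where 'a='a] by blast
  obtain C2 where C2: "0 \<le> C2" and inc2: "\<And>(k::real \<Rightarrow> real) s c.
     k \<in> borel_measurable borel \<Longrightarrow> (\<forall>x. \<bar>k x\<bar> \<le> 1) \<Longrightarrow> 0 < c \<Longrightarrow> 0 \<le> s \<Longrightarrow> s \<le> c \<Longrightarrow> c\<^sup>2 + s\<^sup>2 = 1 \<Longrightarrow>
     (\<integral>z. \<bar>mehler s c k z - (\<integral>w. k w \<partial>gauss)\<bar> ^ 3 \<partial>gauss) \<le> C2 * s ^ 3"
    using mehler_increment_moments[where 'a=real] by blast
  have expand: "\<bar>(\<integral>z. V c (y z) \<partial>gauss) - V c m - V2 c m / 2 * (\<integral>z. (y z - m)\<^sup>2 \<partial>gauss)\<bar>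
      \<le> K * (\<integral>z. \<bar>y z - m\<bar> ^ 3 \<partial>gauss)"
    if [measurable]: "y \<in> borel_measurable borel" and y: "\<And>z. 0 \<le> y z" "\<And>z. y z \<le> 1"
      and m: "m = (\<integral>z. y z \<partial>gauss)" "\<epsilon> \<le> m" "m \<le> 1 - \<epsilon>" and c: "0 < c" "c \<le> 1"
    for y :: "'b::euclidean_space \<Rightarrow> real" and c m
  proof -
    note [measurable] = measurable_V[OF c]
    have "\<bar>y z - m\<bar> \<le> 1" for z using y[of z] m \<epsilon> by auto
    then have p: "\<bar>y z - m\<bar> ^ i \<le> 1" for z i by (intro power_le_one) auto
    have i0: "integrable gauss (\<lambda>z. V c (y z))"
      using bound_V y by (intro integrable_gauss_bounded[where B = B]) auto
    have i1: "integrable gauss y" using y by (intro integrable_gauss_bounded[where B = 1]) auto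
    have i2: "integrable gauss (\<lambda>z. (y z - m)\<^sup>2)"
      using p[of _ 2] by (intro integrable_gauss_bounded[where B = 1]) auto
    have i3: "integrable gauss (\<lambda>z. \<bar>y z - m\<bar> ^ 3)"
      using p[of _ 3] by (intro integrable_gauss_bounded[where B = 1]) auto
    note i = i0 i1 i2 i3
    let ?r = "\<lambda>z. V c (y z) - V c m - V1 c m * (y z - m) - V2 c m / 2 * (y z - m)\<^sup>2"
    have eq: "(\<integral>z. V c (y z) \<partial>gauss) - V c m - V2 c m / 2 * (\<integral>z. (y z - m)\<^sup>2 \<partial>gauss) = (\<integral>z. ?r z \<partial>gauss)"
    proof -
      have "(\<integral>z. ?r z \<partial>gauss) = (\<integral>z. V c (y z) \<partial>gauss) - V c m - V1 c m * ((\<integral>z. y z \<partial>gauss) - m)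
          - V2 c m / 2 * (\<integral>z. (y z - m)\<^sup>2 \<partial>gauss)"
        using i by (simp add: prob_gauss_UNIV)
      then show ?thesis unfolding m(1)[symmetric] by simp
    qed
    have "\<bar>\<integral>z. ?r z \<partial>gauss\<bar> \<le> (\<integral>z. \<bar>?r z\<bar> \<partial>gauss)" by (rule integral_abs_bound)
    also have "\<dots> \<le> (\<integral>z. K * \<bar>y z - m\<bar> ^ 3 \<partial>gauss)"
    proof (rule integral_mono)
      show "integrable gauss (\<lambda>z. \<bar>?r z\<bar>)" "integrable gauss (\<lambda>z. K * \<bar>y z - m\<bar> ^ 3)" using i by auto
      show "\<bar>?r z\<bar> \<le> K * \<bar>y z - m\<bar> ^ 3" for z using K[OF c m(2,3) y] by blast
    qed
    finally show ?thesis unfolding eq by simp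
  qed
  define C where "C = K / 2 * C1 + K * C1 + K * C2"
  show ?thesis
  proof (rule exI[of _ C], rule conjI, goal_cases)
    case 1 then show ?case unfolding C_def using K0 C1 C2 by simp
  next
    case 2
    show ?case
    proof (intro allI impI)
      fix k :: "'a \<Rightarrow> real" and c s c1 :: real
      assume k[measurable]: "k \<in> borel_measurable borel" and kb: "\<forall>x. 0 \<le> k x \<and> k x \<le> 1"
        and m: "\<epsilon> \<le> (\<integral>x. k x \<partial>gauss)" "(\<integral>x. k x \<partial>gauss) \<le> 1 - \<epsilon>"
        and c: "0 < c" "c \<le> 1" and c1: "0 < c1" and s: "0 \<le> s" "s \<le> c1" and cs: "c1\<^sup>2 + s\<^sup>2 = 1"
      define m where "m = (\<integral>x. k x \<partial>gauss)"
      note m = m[folded m_def]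
      define a where "a = quantile m"
      have Pa: "Phi a = m" unfolding a_def using m \<epsilon> by simp
      have k1: "\<forall>x. \<bar>k x\<bar> \<le> 1" using kb by auto
      define y where "y = mehler s c1 k"
      have "(\<integral>z. y z \<partial>gauss) = m"
        unfolding y_def m_def by (rule integral_mehler[OF cs c1 k, of 1]) (use k1 in auto)
      then have ey: "\<bar>(\<integral>z. V c (y z) \<partial>gauss) - V c m - V2 c m / 2 * (\<integral>z. (y z - m)\<^sup>2 \<partial>gauss)\<bar>
          \<le> K * (\<integral>z. \<bar>y z - m\<bar> ^ 3 \<partial>gauss)"
        using kb by (intro expand m c) (auto simp: y_def intro!: mehler_bounds)
      have y23: "(\<integral>z. (y z - m)\<^sup>2 \<partial>gauss) \<le> s\<^sup>2 * (norm (gauss_moment k))\<^sup>2 + C1 * s ^ 3"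
          "(\<integral>z. \<bar>y z - m\<bar> ^ 3 \<partial>gauss) \<le> C1 * s ^ 3"
        using inc[OF k k1 c1 s cs] by (auto simp: y_def m_def)
      let ?l = "indicator {z. - (1 \<bullet> z) \<le> a} :: real \<Rightarrow> real"
      define h where "h = mehler s c1 ?l"
      have l: "?l \<in> borel_measurable borel" "\<forall>x. \<bar>?l x\<bar> \<le> 1" "\<And>x. 0 \<le> ?l x" "\<And>x. ?l x \<le> 1" by auto
      have lm: "(\<integral>z. ?l z \<partial>gauss) = m" using measure_gauss_halfspace[of "1::real" a] Pa by simp
      have h_eq: "h z = Phi ((a + s * z) / c1)" for z
        unfolding h_def using mehler_halfspace[of "1::real" c1 s a z] c1 by simp
      have hm: "(\<integral>z. h z \<partial>gauss) = m"
        unfolding h_def lm[symmetric] by (rule integral_mehler[OF cs c1 l(1), of 1]) auto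
      have hb: "0 \<le> h z" "h z \<le> 1" for z unfolding h_def using mehler_bounds[OF l(1,3,4)] by auto
      have [measurable]: "h \<in> borel_measurable borel" unfolding h_def using l(1) by simp
      have eh: "\<bar>(\<integral>z. V c (h z) \<partial>gauss) - V c m - V2 c m / 2 * (\<integral>z. (h z - m)\<^sup>2 \<partial>gauss)\<bar>
          \<le> K * (\<integral>z. \<bar>h z - m\<bar> ^ 3 \<partial>gauss)"
        using hm hb by (intro expand m c) auto
      have h3: "(\<integral>z. \<bar>h z - m\<bar> ^ 3 \<partial>gauss) \<le> C2 * s ^ 3"
        using inc2[OF l(1,2) c1 s cs] unfolding lm h_def .
      \<comment> \<open>The Cauchy-Schwarz inequality against \<open>z\<close>: the covariance of \<open>h\<close> and \<open>z\<close> is \<open>s * \<phi> a\<close>.\<close>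
      have h2: "s\<^sup>2 * (\<phi> a)\<^sup>2 \<le> (\<integral>z. (h z - m)\<^sup>2 \<partial>gauss)"
      proof -
        have mom: "(\<integral>z. h z * z \<partial>gauss) = s * \<phi> a"
          using mehler_moment[OF cs c1 l(1), of 1] gauss_moment_halfspace[of "1::real" a]
          by (simp add: h_def)
        have hb1: "\<bar>h z\<bar> \<le> 1" for z using hb[of z] by simp
        have ihz: "integrable gauss (\<lambda>z. h z * z)"
          using integrable_gauss_moment(2)[of h 1] hb1 by simp
        have iz: "integrable gauss (\<lambda>z::real. z)" "(\<integral>(z::real). z \<partial>gauss) = 0"
          using integrable_gauss_inner[of "1::real"] integral_gauss_inner[of "1::real"] by simp_all
        have iz2: "integrable gauss (\<lambda>z::real. z\<^sup>2)" "(\<integral>(z::real). z\<^sup>2 \<partial>gauss) = 1"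
          using integrable_gauss_inner2[of "1::real" 1] integral_gauss_inner_sq[of "1::real"] by (simp_all add: power2_eq_square)
        have "\<bar>h z - m\<bar> \<le> 1" for z using hb[of z] m \<epsilon> by auto
        then have "(h z - m)\<^sup>2 \<le> 1" for z by (simp add: abs_square_le_1)
        then have ih2: "integrable gauss (\<lambda>z. (h z - m)\<^sup>2)"
          by (intro integrable_gauss_bounded[where B = 1]) auto
        let ?r = "s * \<phi> a"
        have "0 \<le> (\<integral>z. (h z - m - ?r * z)\<^sup>2 \<partial>gauss)" by simp
        also have "\<dots> = (\<integral>z. (h z - m)\<^sup>2 - 2 * ?r * (h z * z) + 2 * ?r * m * z + ?r\<^sup>2 * z\<^sup>2 \<partial>gauss)"
          by (intro Bochner_Integration.integral_cong) (auto simp: power2_eq_square algebra_simps)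
        also have "\<dots> = (\<integral>z. (h z - m)\<^sup>2 \<partial>gauss) - 2 * ?r * ?r + 2 * ?r * m * 0 + ?r\<^sup>2 * 1"
          using ih2 ihz iz iz2 mom by simp
        finally show ?thesis by (simp add: power2_eq_square algebra_simps)
      qed
      have Vh: "(\<integral>z. V c (h z) \<partial>gauss) = V (c * c1) m"
        unfolding h_eq using integral_V_halfline[OF c s(1) c1 cs] Pa by simp
      have V2: "0 \<le> V2 c m" "V2 c m \<le> K" using V2_nonneg[of c m] K[OF c m, of m] c m \<epsilon> by auto
      have s3: "0 \<le> C1 * s ^ 3" using C1 s by simp
      have "V2 c m / 2 * (\<integral>z. (y z - m)\<^sup>2 \<partial>gauss) \<le> V2 c m / 2 * (s\<^sup>2 * (norm (gauss_moment k))\<^sup>2 + C1 * s ^ 3)"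
        using V2 by (intro mult_left_mono y23) auto
      also have "\<dots> \<le> V2 c m / 2 * (s\<^sup>2 * (norm (gauss_moment k))\<^sup>2) + K / 2 * (C1 * s ^ 3)"
        unfolding distrib_left using V2 s3 by (intro add_left_mono mult_right_mono) auto
      finally have A: "V2 c m / 2 * (\<integral>z. (y z - m)\<^sup>2 \<partial>gauss) \<le> V2 c m / 2 * (s\<^sup>2 * (norm (gauss_moment k))\<^sup>2) + K / 2 * (C1 * s ^ 3)" .
      have B: "V2 c m / 2 * (s\<^sup>2 * (\<phi> a)\<^sup>2) \<le> V2 c m / 2 * (\<integral>z. (h z - m)\<^sup>2 \<partial>gauss)"
        using V2 by (intro mult_left_mono h2) auto
      have C: "K * (\<integral>z. \<bar>y z - m\<bar> ^ 3 \<partial>gauss) \<le> K * (C1 * s ^ 3)" using K0 by (intro mult_left_mono y23)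
      have D: "K * (\<integral>z. \<bar>h z - m\<bar> ^ 3 \<partial>gauss) \<le> K * (C2 * s ^ 3)" using K0 by (intro mult_left_mono h3)
      have "(\<integral>z. V c (y z) \<partial>gauss) \<le> V (c * c1) m
          + (V2 c m / 2 * (s\<^sup>2 * (norm (gauss_moment k))\<^sup>2) - V2 c m / 2 * (s\<^sup>2 * (\<phi> a)\<^sup>2))
          + (K / 2 * (C1 * s ^ 3) + K * (C1 * s ^ 3) + K * (C2 * s ^ 3))"
        using ey eh A B C D unfolding Vh by linarith
      also have "\<dots> = V (c * c1) m + V2 c m / 2 * s\<^sup>2 * ((norm (gauss_moment k))\<^sup>2 - (\<phi> a)\<^sup>2) + C * s ^ 3"
        unfolding C_def by (simp add: algebra_simps)
      finally show "(\<integral>z. V c (mehler s c1 k z) \<partial>gauss) \<le> V (c * c1) (\<integral>x. k x \<partial>gauss)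
       + V2 c (\<integral>x. k x \<partial>gauss) / 2 * s\<^sup>2
          * ((norm (gauss_moment k))\<^sup>2 - (\<phi> (quantile (\<integral>x. k x \<partial>gauss)))\<^sup>2) + C * s ^ 3"
        unfolding y_def m_def a_def .
    qed
  qed
qed

text \<open>The values of \<open>f\<close> are kept away from 0 and 1 so that one constant serves all steps and all base points: every
\<open>heat u f\<close> then takes values in the interval where \<open>V_step\<close> is uniform.\<close>

lemma heat_profile_le_interior:
  fixes f :: "'a::euclidean_space \<Rightarrow> real"
  assumes f[measurable]: "f \<in> borel_measurable borel" and \<epsilon>: "0 < \<epsilon>"
    and fb: "\<And>x. \<epsilon> \<le> f x" "\<And>x. f x \<le> 1 - \<epsilon>" and w: "0 < w" "w \<le> v"
  shows "heat (v - w) (\<lambda>y. \<psi> (heat w f y)) x \<le> V (sqrt (w / v)) (heat v f x)"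
proof -
  obtain C where C0: "0 \<le> C" and C: "\<And>(k::'a \<Rightarrow> real) c s c1.
     k \<in> borel_measurable borel \<Longrightarrow> (\<forall>x. 0 \<le> k x \<and> k x \<le> 1) \<Longrightarrow>
     \<epsilon> \<le> (\<integral>x. k x \<partial>gauss) \<Longrightarrow> (\<integral>x. k x \<partial>gauss) \<le> 1 - \<epsilon> \<Longrightarrow>
     0 < c \<Longrightarrow> c \<le> 1 \<Longrightarrow> 0 < c1 \<Longrightarrow> 0 \<le> s \<Longrightarrow> s \<le> c1 \<Longrightarrow> c1\<^sup>2 + s\<^sup>2 = 1 \<Longrightarrow>
     (\<integral>z. V c (mehler s c1 k z) \<partial>gauss) \<le> V (c * c1) (\<integral>x. k x \<partial>gauss)
       + V2 c (\<integral>x. k x \<partial>gauss) / 2 * s\<^sup>2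
          * ((norm (gauss_moment k))\<^sup>2 - (\<phi> (quantile (\<integral>x. k x \<partial>gauss)))\<^sup>2)
       + C * s ^ 3"
    using V_step[OF \<epsilon>, where 'a='a] by blast
  have f01: "0 \<le> f x" "f x \<le> 1" for x using fb[of x] \<epsilon> by auto
  have hb: "0 \<le> heat u f y" "heat u f y \<le> 1" for u y by (rule heat_bounds[OF f f01])+
  define g where "g y = \<psi> (heat w f y)" for y
  have g[measurable]: "g \<in> borel_measurable borel" unfolding g_def by simp
  have gb: "\<bar>g y\<bar> \<le> B" for y unfolding g_def by (rule bound0[OF hb])
  have one_step: "heat h (\<lambda>y. V (sqrt (w / u)) (heat u f y)) x
      \<le> V (sqrt (w / (u + h))) (heat (u + h) f x) + C * (sqrt (h / w)) ^ 3"
    if u: "w \<le> u" and h: "0 \<le> h" "h \<le> w" for u h x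
  proof -
    define k where "k y = f (x + sqrt (u + h) *\<^sub>R y)" for y
    define s where "s = sqrt (h / (u + h))"
    define c1 where "c1 = sqrt (u / (u + h))"
    have u0: "0 < u" using u w by simp
    have [measurable]: "k \<in> borel_measurable borel" unfolding k_def by simp
    have kb: "0 \<le> k y \<and> k y \<le> 1" "\<epsilon> \<le> k y" "k y \<le> 1 - \<epsilon>" for y unfolding k_def using f01 fb by auto
    have m: "\<epsilon> \<le> (\<integral>y. k y \<partial>gauss)" "(\<integral>y. k y \<partial>gauss) \<le> 1 - \<epsilon>"
      by (auto intro!: gauss_integral_bounded kb)
    have mk: "(\<integral>y. k y \<partial>gauss) = heat (u + h) f x" by (simp add: heat_def k_def)
    have c: "0 < sqrt (w / u)" "sqrt (w / u) \<le> 1" using w u by auto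
    have c1: "0 < c1" unfolding c1_def using u0 h by simp
    have s: "0 \<le> s" "s \<le> c1" unfolding s_def c1_def using u h w by (auto intro!: divide_right_mono)
    have cs: "c1\<^sup>2 + s\<^sup>2 = 1" unfolding s_def c1_def using u0 h by (simp add: add_divide_distrib[symmetric])
    have cc: "sqrt (w / u) * c1 = sqrt (w / (u + h))" unfolding c1_def real_sqrt_mult[symmetric] using u0 by simp
    have sw: "s \<le> sqrt (h / w)" unfolding s_def using h u w by (auto intro!: divide_left_mono)
    have "norm (gauss_moment k) \<le> \<phi> (quantile (heat (u + h) f x))"
      using m \<epsilon> kb unfolding mk by (intro norm_gauss_moment_le_phi) (auto simp: mk)
    then have "(norm (gauss_moment k))\<^sup>2 \<le> (\<phi> (quantile (heat (u + h) f x)))\<^sup>2" by (intro power_mono) auto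
    then have neg: "V2 (sqrt (w / u)) (heat (u + h) f x) / 2 * s\<^sup>2 *
        ((norm (gauss_moment k))\<^sup>2 - (\<phi> (quantile (heat (u + h) f x)))\<^sup>2) \<le> 0"
      using V2_nonneg[of "sqrt (w / u)"] c by (intro mult_nonneg_nonpos) auto
    have "heat h (\<lambda>y. V (sqrt (w / u)) (heat u f y)) x = (\<integral>z. V (sqrt (w / u)) (mehler s c1 k z) \<partial>gauss)"
      unfolding heat_def[of h] heat_eq_mehler[OF u0 h(1)] s_def c1_def k_def ..
    also have "\<dots> \<le> V (sqrt (w / (u + h))) (heat (u + h) f x) + C * s ^ 3"
      using C[OF \<open>k \<in> borel_measurable borel\<close> _ m c c1 s cs] kb(1) neg unfolding cc mk by auto
    also have "\<dots> \<le> V (sqrt (w / (u + h))) (heat (u + h) f x) + C * (sqrt (h / w)) ^ 3"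
      using C0 sw s by (intro add_left_mono mult_left_mono power_mono) auto
    finally show ?thesis .
  qed
  \<comment> \<open>The accumulated error of \<open>N\<close> steps is \<open>N * C * sqrt (r / N) ^ 3\<close>.\<close>
  define r where "r = (v - w) / w"
  have r0: "0 \<le> r" unfolding r_def using w by simp
  have N_steps: "heat (v - w) g x \<le> V (sqrt (w / v)) (heat v f x) + C * (r * sqrt (r / real N))"
    if N: "r \<le> real N" "0 < N" for N
  proof -
    define h where "h = (v - w) / real N"
    have h: "0 \<le> h" "h \<le> w"
    proof -
      show "0 \<le> h" unfolding h_def using w by simp
      have "v - w \<le> real N * w" using N w unfolding r_def by (simp add: field_simps)
      then show "h \<le> w" unfolding h_def using N by (simp add: field_simps)
    qed
    have "heat (real j * h) g x \<le> V (sqrt (w / (w + real j * h))) (heat (w + real j * h) f x) + real j * (C * (sqrt (h / w)) ^ 3)" for j x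
    proof (induction j arbitrary: x)
      case 0
      show ?case using w by (simp add: g_def)
    next
      case (Suc j)
      let ?u = "w + real j * h" and ?e = "C * (sqrt (h / w)) ^ 3"
      have u: "w \<le> ?u" using h by simp
      have c: "0 < sqrt (w / ?u)" "sqrt (w / ?u) \<le> 1"
        using w u by (auto intro!: divide_pos_pos simp: divide_le_eq_1)
      note [measurable] = measurable_V[OF c]
      have iV: "integrable gauss (\<lambda>z. V (sqrt (w / ?u)) (heat ?u f (x + sqrt h *\<^sub>R z)))"
        using bound_V[OF hb] by (intro integrable_gauss_bounded[where B = B]) auto
      have "heat (real (Suc j) * h) g x = heat h (heat (real j * h) g) x"
        using heat_heat[OF g gb, of "real j * h" h x] h by (simp add: algebra_simps)
      also have "\<dots> \<le> (\<integral>z. V (sqrt (w / ?u)) (heat ?u f (x + sqrt h *\<^sub>R z)) + real j * ?e \<partial>gauss)"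
        unfolding heat_def[of h]
      proof (rule integral_mono)
        have "\<bar>heat (real j * h) g y\<bar> \<le> B" for y
        proof -
          have "- B \<le> g y" "g y \<le> B" for y using gb[of y] by (auto simp: abs_le_iff)
          from heat_bounds[OF g this] show ?thesis by (simp add: abs_le_iff minus_le_iff)
        qed
        then show "integrable gauss (\<lambda>z. heat (real j * h) g (x + sqrt h *\<^sub>R z))"
          by (intro integrable_gauss_bounded[where B = B]) auto
        show "integrable gauss (\<lambda>z. V (sqrt (w / ?u)) (heat ?u f (x + sqrt h *\<^sub>R z)) + real j * ?e)"
          using iV by simp
      qed (rule Suc)
      also have "\<dots> = heat h (\<lambda>y. V (sqrt (w / ?u)) (heat ?u f y)) x + real j * ?e"
        unfolding heat_def[of h] using iV by (simp add: prob_gauss_UNIV)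
      also have "\<dots> \<le> V (sqrt (w / (?u + h))) (heat (?u + h) f x) + ?e + real j * ?e"
        using one_step[OF u h] by simp
      also have "?u + h = w + real (Suc j) * h" by (simp add: algebra_simps)
      finally show ?case by (simp add: algebra_simps)
    qed
    from this[of N x] have "heat (v - w) g x \<le> V (sqrt (w / v)) (heat v f x) + real N * (C * (sqrt (h / w)) ^ 3)"
      using N by (simp add: h_def)
    also have "real N * (C * (sqrt (h / w)) ^ 3) = C * (r * sqrt (r / real N))"
    proof -
      have "h / w = r / real N" by (simp add: h_def r_def)
      moreover have "(sqrt (r / real N)) ^ 3 = (r / real N) * sqrt (r / real N)"
        using r0 by (simp add: power3_eq_cube)
      ultimately show ?thesis using N by simp
    qed
    finally show ?thesis .
  qed
  have "(\<lambda>N. V (sqrt (w / v)) (heat v f x) + C * (r * sqrt (r / real N))) \<longlonglongrightarrow> V (sqrt (w / v)) (heat v f x) + C * (r * sqrt 0)"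
    by (intro tendsto_intros tendsto_divide_0[OF tendsto_const] filterlim_compose[OF filterlim_real_at_infinity_sequentially filterlim_ident])
  moreover have "\<exists>N0. \<forall>N\<ge>N0. heat (v - w) g x \<le> V (sqrt (w / v)) (heat v f x) + C * (r * sqrt (r / real N))"
  proof (intro exI[of _ "Suc (nat \<lceil>r\<rceil>)"] allI impI)
    fix N assume "Suc (nat \<lceil>r\<rceil>) \<le> N"
    then have "r \<le> real N" "0 < N" using r0 by linarith+
    then show "heat (v - w) g x \<le> V (sqrt (w / v)) (heat v f x) + C * (r * sqrt (r / real N))" by (rule N_steps)
  qed
  ultimately have "heat (v - w) g x \<le> V (sqrt (w / v)) (heat v f x) + C * (r * sqrt 0)"
    by (rule LIMSEQ_le_const)
  then show ?thesis by (simp add: g_def[abs_def])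
qed

text \<open>The restriction on the values is removed by applying the previous lemma to \<open>e + (1 - 2 e) f\<close> and letting \<open>e\<close> tend to 0.
If \<open>heat v f x\<close> is 0 or 1, the flow is constant almost everywhere.\<close>

lemma heat_profile_le:
  fixes f :: "'a::euclidean_space \<Rightarrow> real"
  assumes f[measurable]: "f \<in> borel_measurable borel" and fb: "\<And>x. 0 \<le> f x" "\<And>x. f x \<le> 1"
    and w: "0 < w" "w \<le> v"
  shows "heat (v - w) (\<lambda>y. \<psi> (heat w f y)) x \<le> V (sqrt (w / v)) (heat v f x)"
proof -
  have hb: "0 \<le> heat u f y" "heat u f y \<le> 1" for u y by (rule heat_bounds[OF f fb])+
  have hh: "heat (v - w) (heat w f) x = heat v f x"
  proof -
    have "\<bar>f y\<bar> \<le> 1" for y using fb[of y] by simp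
    from heat_heat[OF f this, of w "v - w" x] w show ?thesis by simp
  qed
  have ih: "integrable gauss (\<lambda>z. heat w f (x + sqrt (v - w) *\<^sub>R z))"
    using hb by (intro integrable_gauss_bounded[where B = 1]) auto
  consider "heat v f x = 0" | "heat v f x = 1" | "0 < heat v f x" "heat v f x < 1"
    using hb[of v x] by linarith
  then show ?thesis
  proof cases
    case 1
    then have "AE z in gauss. heat w f (x + sqrt (v - w) *\<^sub>R z) = 0"
      using hh hb integral_nonneg_eq_0_iff_AE[OF ih] by (simp add: heat_def[of "v - w"])
    then have "heat (v - w) (\<lambda>y. \<psi> (heat w f y)) x = (\<integral>z. \<psi> 0 \<partial>(gauss :: 'a measure))"
      unfolding heat_def[of "v - w"] by (intro integral_cong_AE) auto
    then show ?thesis using 1 by (simp add: halfspace_value_def prob_gauss_UNIV)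
  next
    case 2
    have "(\<integral>z. 1 - heat w f (x + sqrt (v - w) *\<^sub>R z) \<partial>gauss) = 0"
      using ih hh 2 by (simp add: heat_def[of "v - w"] prob_gauss_UNIV)
    then have "AE z in gauss. 1 - heat w f (x + sqrt (v - w) *\<^sub>R z) = 0"
      using hb ih by (subst (asm) integral_nonneg_eq_0_iff_AE) auto
    then have "AE z in gauss. heat w f (x + sqrt (v - w) *\<^sub>R z) = 1" by eventually_elim simp
    then have "heat (v - w) (\<lambda>y. \<psi> (heat w f y)) x = (\<integral>z. \<psi> 1 \<partial>(gauss :: 'a measure))"
      unfolding heat_def[of "v - w"] by (intro integral_cong_AE) auto
    then show ?thesis using 2 by (simp add: halfspace_value_def prob_gauss_UNIV)
  next
    case 3
    define e where "e n = 1 / (real n + 3)" for n :: nat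
    have e: "0 < e n" "e n \<le> 1/3" for n unfolding e_def by (auto simp: field_simps)
    have e0: "e \<longlonglongrightarrow> 0" unfolding e_def by real_asymp
    define F where "F n y = e n + (1 - 2 * e n) * f y" for n y
    have [measurable]: "F n \<in> borel_measurable borel" for n unfolding F_def by simp
    have Fb: "e n \<le> F n y" "F n y \<le> 1 - e n" for n y
    proof -
      have "(1 - 2 * e n) * f y \<le> 1 - 2 * e n" using e[of n] fb by (intro mult_right_le_one_le) auto
      moreover have "0 \<le> (1 - 2 * e n) * f y" using e[of n] fb by (intro mult_nonneg_nonneg) auto
      ultimately show "e n \<le> F n y" "F n y \<le> 1 - e n" unfolding F_def by simp_all
    qed
    have hF: "heat u (F n) y = e n + (1 - 2 * e n) * heat u f y" for u n y
    proof -
      have "integrable gauss (\<lambda>z. f (y + sqrt u *\<^sub>R z))"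
        using fb by (intro integrable_gauss_bounded[where B = 1]) auto
      then show ?thesis by (simp add: heat_def F_def prob_gauss_UNIV)
    qed
    have hFb: "0 \<le> heat u (F n) y" "heat u (F n) y \<le> 1" for u n y
    proof -
      have "0 \<le> F n y" "F n y \<le> 1" for y using Fb[of n y] e[of n] by auto
      then show "0 \<le> heat u (F n) y" "heat u (F n) y \<le> 1" by (auto intro!: heat_bounds)
    qed
    have lim: "(\<lambda>n. heat u (F n) y) \<longlonglongrightarrow> heat u f y" for u y
    proof -
      have "(\<lambda>n. e n + (1 - 2 * e n) * heat u f y) \<longlonglongrightarrow> 0 + (1 - 2 * 0) * heat u f y"
        by (intro tendsto_intros e0)
      then show ?thesis by (simp add: hF)
    qed
    have "(\<lambda>n. heat (v - w) (\<lambda>y. \<psi> (heat w (F n) y)) x) \<longlonglongrightarrow> heat (v - w) (\<lambda>y. \<psi> (heat w f y)) x"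
      unfolding heat_def[of "v - w"]
    proof (rule integral_dominated_convergence[where w = "\<lambda>_. B"])
      show "AE z in gauss. (\<lambda>n. \<psi> (heat w (F n) (x + sqrt (v - w) *\<^sub>R z))) \<longlonglongrightarrow> \<psi> (heat w f (x + sqrt (v - w) *\<^sub>R z))"
      proof (rule AE_I2)
        fix z :: 'a
        show "(\<lambda>n. \<psi> (heat w (F n) (x + sqrt (v - w) *\<^sub>R z))) \<longlonglongrightarrow> \<psi> (heat w f (x + sqrt (v - w) *\<^sub>R z))"
          by (rule continuous_on_tendsto_compose[OF continuous_profile lim]) (auto simp: hb hFb)
      qed
      show "AE z in gauss. norm (\<psi> (heat w (F n) (x + sqrt (v - w) *\<^sub>R z))) \<le> B" for n
        using bound0[OF hFb] by simp
    qed auto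
    moreover have "(\<lambda>n. V (sqrt (w / v)) (heat v (F n) x)) \<longlonglongrightarrow> V (sqrt (w / v)) (heat v f x)"
    proof (rule isCont_tendsto_compose[OF _ lim])
      have "0 < sqrt (w / v)" "sqrt (w / v) \<le> 1" using w by auto
      from V_deriv[OF this 3] show "isCont (V (sqrt (w / v))) (heat v f x)" by (rule DERIV_isCont)
    qed
    moreover have "heat (v - w) (\<lambda>y. \<psi> (heat w (F n) y)) x \<le> V (sqrt (w / v)) (heat v (F n) x)" for n
      using Fb e[of n] w by (intro heat_profile_le_interior[where \<epsilon> = "e n"]) auto
    ultimately show ?thesis by (intro LIMSEQ_le) auto
  qed
qed

text \<open>If the moment at the starting point is strictly shorter than that of a half-space, the first step of length \<open>s\<close> loses
at least a constant times \<open>s\<^sup>2\<close>, since \<open>V2\<close> is bounded below by strict convexity, whereas the error is of order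
\<open>s ^ 3\<close>. All later steps can be estimated by \<open>heat_profile_le\<close>.\<close>

lemma heat_profile_eq_imp:
  fixes f :: "'a::euclidean_space \<Rightarrow> real"
  assumes f[measurable]: "f \<in> borel_measurable borel" and fb: "\<And>x. 0 \<le> f x" "\<And>x. f x \<le> 1"
    and w: "0 < w" "w < v" and m: "0 < heat v f x" "heat v f x < 1"
    and strict: "\<And>t. 0 < t \<Longrightarrow> t < 1 \<Longrightarrow> 0 < \<psi>2 t"
    and eq: "heat (v - w) (\<lambda>y. \<psi> (heat w f y)) x = V (sqrt (w / v)) (heat v f x)"
  shows "norm (gauss_moment (\<lambda>z. f (x + sqrt v *\<^sub>R z))) = \<phi> (quantile (heat v f x))"
proof (rule ccontr)
  define k where "k z = f (x + sqrt v *\<^sub>R z)" for z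
  define m where "m = heat v f x"
  define a where "a = quantile m"
  have k[measurable]: "k \<in> borel_measurable borel" unfolding k_def by simp
  have kb: "0 \<le> k y" "k y \<le> 1" for y unfolding k_def using fb by auto
  have mk: "(\<integral>z. k z \<partial>gauss) = m" by (simp add: m_def heat_def k_def)
  have Pa: "Phi a = m" unfolding a_def using m by (simp add: m_def)
  have v: "0 < v" using w by simp
  define G where "G = (\<phi> a)\<^sup>2 - (norm (gauss_moment k))\<^sup>2"
  assume "norm (gauss_moment (\<lambda>z. f (x + sqrt v *\<^sub>R z))) \<noteq> \<phi> (quantile (heat v f x))"
  then have "norm (gauss_moment k) < \<phi> a"
    using norm_gauss_moment_le_phi[OF k kb, of a] mk Pa unfolding k_def[abs_def] a_def m_def by simp
  then have G: "0 < G" unfolding G_def by (simp add: power_strict_mono)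
  define \<epsilon> where "\<epsilon> = min m (1 - m)"
  have \<epsilon>: "0 < \<epsilon>" "\<epsilon> \<le> m" "m \<le> 1 - \<epsilon>" unfolding \<epsilon>_def using m by (auto simp: m_def)
  obtain C where C0: "0 \<le> C" and C: "\<And>(k::'a \<Rightarrow> real) c s c1.
     k \<in> borel_measurable borel \<Longrightarrow> (\<forall>x. 0 \<le> k x \<and> k x \<le> 1) \<Longrightarrow>
     \<epsilon> \<le> (\<integral>x. k x \<partial>gauss) \<Longrightarrow> (\<integral>x. k x \<partial>gauss) \<le> 1 - \<epsilon> \<Longrightarrow>
     0 < c \<Longrightarrow> c \<le> 1 \<Longrightarrow> 0 < c1 \<Longrightarrow> 0 \<le> s \<Longrightarrow> s \<le> c1 \<Longrightarrow> c1\<^sup>2 + s\<^sup>2 = 1 \<Longrightarrow>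
     (\<integral>z. V c (mehler s c1 k z) \<partial>gauss) \<le> V (c * c1) (\<integral>x. k x \<partial>gauss)
       + V2 c (\<integral>x. k x \<partial>gauss) / 2 * s\<^sup>2
          * ((norm (gauss_moment k))\<^sup>2 - (\<phi> (quantile (\<integral>x. k x \<partial>gauss)))\<^sup>2)
       + C * s ^ 3"
    using V_step[OF \<epsilon>(1), where 'a='a] by blast
  define c0 where "c0 = sqrt (w / v)"
  have c0: "0 < c0" unfolding c0_def using w by simp
  have "\<exists>\<beta>>0. \<forall>c. c0 \<le> c \<longrightarrow> c \<le> 1 \<longrightarrow> \<beta> \<le> V2 c m"
  proof -
    let ?I = "{- (\<bar>a\<bar> + 1) .. \<bar>a\<bar> + 1}"
    have "continuous_on ?I L2" using deriv_L2 by (intro continuous_at_imp_continuous_on ballI DERIV_isCont)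
    then have "\<exists>b\<in>?I. \<forall>x\<in>?I. L2 b \<le> L2 x" by (intro continuous_attains_inf) auto
    then obtain b where b: "\<And>x. x \<in> ?I \<Longrightarrow> L2 b \<le> L2 x" by blast
    have l: "0 < L2 b" unfolding L2_def using strict[OF Phi_pos Phi_less_1] phi_pos by simp
    let ?J = "{-1<..1} :: real set"
    have J: "measure gauss ?J = Phi 1 - Phi (- 1)" by (subst gauss_real.cdf_diff_eq) auto
    have J0: "0 < measure gauss ?J" unfolding J using Phi_strict_mono[of "-1" 1] by simp
    have "c0 * (L2 b * measure gauss ?J) / \<phi> a \<le> V2 c m" if c: "c0 \<le> c" "c \<le> 1" for c
    proof -
      let ?\<kappa> = "sqrt (1 - c\<^sup>2)"
      have c_pos: "0 < c" using c c0 by simp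
      have \<kappa>: "0 \<le> ?\<kappa>" "?\<kappa> \<le> 1" using c c_pos by (auto simp: power_le_one)
      have "L2 b * measure gauss ?J = (\<integral>z. L2 b * indicator ?J z \<partial>gauss)" by simp
      also have "\<dots> \<le> (\<integral>z. L2 (c * a + ?\<kappa> * z) \<partial>gauss)"
      proof (rule integral_mono)
        show "integrable gauss (\<lambda>z. L2 (c * a + ?\<kappa> * z))"
          using bound_L(2) by (intro integrable_gauss_bounded[where B = B]) auto
        fix z
        show "L2 b * indicator ?J z \<le> L2 (c * a + ?\<kappa> * z)"
        proof (cases "z \<in> ?J")
          case True
          then have "\<bar>z\<bar> \<le> 1" by auto
          then have "\<bar>?\<kappa> * z\<bar> \<le> 1 * 1" unfolding abs_mult using \<kappa> by (intro mult_mono) auto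
          moreover have "\<bar>c * a\<bar> \<le> 1 * \<bar>a\<bar>" unfolding abs_mult using c c_pos by (intro mult_right_mono) auto
          ultimately have "c * a + ?\<kappa> * z \<in> ?I" unfolding atLeastAtMost_iff by linarith
          then show ?thesis using b True by simp
        next
          case False then show ?thesis using L2_nonneg by simp
        qed
      qed (intro integrable_mult_right integrable_gauss_bounded[where B = 1], auto)
      also have "\<dots> = mehler c ?\<kappa> L2 a" by (simp add: mehler_def)
      finally have "c0 * (L2 b * measure gauss ?J) \<le> c * mehler c ?\<kappa> L2 a"
        using c c0 l J0 by (intro mult_mono) auto
      then show ?thesis unfolding V2_def a_def[symmetric] using phi_pos[of a] by (intro divide_right_mono) auto
    qed
    moreover have "0 < c0 * (L2 b * measure gauss ?J) / \<phi> a" using c0 l J0 phi_pos[of a] by simp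
    ultimately show ?thesis by blast
  qed
  then obtain \<beta> where \<beta>: "0 < \<beta>" and V2\<beta>: "\<And>c. c0 \<le> c \<Longrightarrow> c \<le> 1 \<Longrightarrow> \<beta> \<le> V2 c m" by blast
  \<comment> \<open>Small enough for the error to be at most half of the gain, and for the first step to stay within the available time.\<close>
  define s where "s = min (1/2) (min (sqrt (1 - w / v)) (\<beta> * G / (4 * (C + 1))))"
  have s: "0 < s" "s \<le> 1/2" "s \<le> sqrt (1 - w / v)" "s \<le> \<beta> * G / (4 * (C + 1))"
  proof -
    show "0 < s" unfolding s_def using w v \<beta> G C0 by auto
  qed (unfold s_def, linarith+)
  define h where "h = v * s\<^sup>2"
  define u where "u = v - h"
  have "s\<^sup>2 \<le> 1 - w / v" using power_mono[OF s(3), of 2] s(1) w v by simp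
  then have "h \<le> v * (1 - w / v)" unfolding h_def using v by (intro mult_left_mono) auto
  also have "\<dots> = v - w" using v by (simp add: field_simps)
  finally have wu: "w \<le> u" unfolding u_def by simp
  have u0: "0 < u" using wu w by simp
  have h0: "0 \<le> h" unfolding h_def using v by simp
  have uh: "u + h = v" by (simp add: u_def)
  define c1 where "c1 = sqrt (u / v)"
  have sh: "sqrt (h / v) = s" unfolding h_def using v s by simp
  have c1: "0 < c1" "c1\<^sup>2 + s\<^sup>2 = 1"
  proof -
    show "0 < c1" unfolding c1_def using u0 v by simp
    have "c1\<^sup>2 = u / v" unfolding c1_def using u0 v by simp
    also have "\<dots> = 1 - s\<^sup>2" unfolding u_def h_def using v by (simp add: field_simps)
    finally show "c1\<^sup>2 + s\<^sup>2 = 1" by simp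
  qed
  have sc1: "s \<le> c1"
  proof -
    have "s\<^sup>2 \<le> (1/2)\<^sup>2" using s by (intro power_mono) auto
    then have "s\<^sup>2 \<le> c1\<^sup>2" using c1(2) by (simp add: power2_eq_square)
    then show ?thesis using c1(1) s(1) by (simp add: power2_le_iff_abs_le)
  qed
  let ?c = "sqrt (w / u)"
  have c: "0 < ?c" "?c \<le> 1" "c0 \<le> ?c"
    using w wu u0 v h0 unfolding c0_def by (auto simp: u_def intro!: divide_left_mono)
  note [measurable] = measurable_V[OF c(1,2)]
  have hb: "0 \<le> heat u f y" "heat u f y \<le> 1" for u y by (rule heat_bounds[OF f fb])+
  let ?g = "\<lambda>y. \<psi> (heat w f y)"
  have gm[measurable]: "?g \<in> borel_measurable borel" by simp
  have gb: "\<bar>?g y\<bar> \<le> B" for y by (rule bound0[OF hb])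
  have "heat (v - w) ?g x = heat h (heat (u - w) ?g) x"
    using heat_heat[of ?g B "u - w" h x] gb wu h0 by (simp add: u_def)
  also have "\<dots> \<le> heat h (\<lambda>y. V ?c (heat u f y)) x"
    unfolding heat_def[of h]
  proof (rule integral_mono)
    have "\<bar>heat (u - w) ?g y\<bar> \<le> B" for y
    proof -
      have "- B \<le> ?g y" "?g y \<le> B" for y using gb[of y] by (auto simp: abs_le_iff)
      from heat_bounds[OF gm this] show ?thesis by (simp add: abs_le_iff minus_le_iff)
    qed
    then show "integrable gauss (\<lambda>z. heat (u - w) ?g (x + sqrt h *\<^sub>R z))"
      by (intro integrable_gauss_bounded[where B = B]) auto
    show "integrable gauss (\<lambda>z. V ?c (heat u f (x + sqrt h *\<^sub>R z)))"
      using bound_V[OF hb] by (intro integrable_gauss_bounded[where B = B]) auto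
    show "heat (u - w) ?g (x + sqrt h *\<^sub>R z) \<le> V ?c (heat u f (x + sqrt h *\<^sub>R z))" for z
      by (rule heat_profile_le[OF f fb w(1) wu])
  qed
  also have "\<dots> = (\<integral>z. V ?c (mehler s c1 k z) \<partial>gauss)"
    unfolding heat_def[of h] heat_eq_mehler[OF u0 h0] uh sh k_def c1_def ..
  also have "\<dots> \<le> V (?c * c1) m - V2 ?c m / 2 * s\<^sup>2 * G + C * s ^ 3"
    using C[OF k _ _ _ c(1,2) c1(1) _ sc1 c1(2)] kb \<epsilon> s(1) unfolding mk a_def[symmetric] G_def
    by (simp add: right_diff_distrib)
  also have "?c * c1 = c0" unfolding c1_def c0_def real_sqrt_mult[symmetric] using u0 by simp
  finally have "V2 ?c m / 2 * s\<^sup>2 * G \<le> C * s ^ 3" using eq by (simp add: c0_def m_def)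
  then have "s\<^sup>2 * (V2 ?c m / 2 * G) \<le> s\<^sup>2 * (C * s)" by (simp add: power2_eq_square power3_eq_cube mult_ac)
  then have "V2 ?c m / 2 * G \<le> C * s" using s(1) by simp
  moreover have "\<beta> * G / 2 \<le> V2 ?c m / 2 * G" using V2\<beta>[OF c(3,2)] G by simp
  moreover have "C * s < \<beta> * G / 2"
  proof -
    have "C * s \<le> (C + 1) * (\<beta> * G / (4 * (C + 1)))" using s C0 by (intro mult_mono) auto
    also have "\<dots> = \<beta> * G / 4" using C0 by (simp add: field_simps)
    also have "\<dots> < \<beta> * G / 2" using \<beta> G by simp
    finally show ?thesis .
  qed
  ultimately show False by linarith
qed

end

section \<open>Power profiles\<close>

lemma powr_profile_limit:
  fixes g :: "'a::euclidean_space \<Rightarrow> real"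
  assumes [measurable]: "g \<in> borel_measurable borel" and g: "\<And>z. 0 \<le> g z" "\<And>z. g z \<le> 1" and q: "1 < q"
    and e: "\<And>i. 0 < e i" "\<And>i. e i \<le> 1" "e \<longlonglongrightarrow> 0"
  shows "(\<lambda>i. \<integral>z. (g z + e i) powr q - \<kappa> * g z ^ n \<partial>gauss) \<longlonglongrightarrow> (\<integral>z. g z powr q - \<kappa> * g z ^ n \<partial>gauss)"
proof (rule integral_dominated_convergence[where w = "\<lambda>_. 2 powr q + \<bar>\<kappa>\<bar>"])
  show "AE z in gauss. (\<lambda>i. (g z + e i) powr q - \<kappa> * g z ^ n) \<longlonglongrightarrow> g z powr q - \<kappa> * g z ^ n"
  proof (rule AE_I2)
    fix z
    have "(\<lambda>i. g z + e i) \<longlonglongrightarrow> g z + 0" by (intro tendsto_intros e)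
    then have "(\<lambda>i. (g z + e i) powr q) \<longlonglongrightarrow> g z powr q"
      using q g(1)[of z] e(1) by (intro tendsto_powr'[OF _ tendsto_const]) (auto intro!: always_eventually less_imp_le add_nonneg_pos)
    then show "(\<lambda>i. (g z + e i) powr q - \<kappa> * g z ^ n) \<longlonglongrightarrow> g z powr q - \<kappa> * g z ^ n"
      by (intro tendsto_diff tendsto_const)
  qed
  fix i
  show "AE z in gauss. norm ((g z + e i) powr q - \<kappa> * g z ^ n) \<le> 2 powr q + \<bar>\<kappa>\<bar>"
  proof (rule AE_I2)
    fix z
    have "(g z + e i) powr q \<le> 2 powr q"
      using g[of z] e(1,2)[of i] q by (intro powr_mono2) auto
    moreover have "\<bar>\<kappa> * g z ^ n\<bar> \<le> \<bar>\<kappa>\<bar> * 1"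
      unfolding abs_mult using g[of z] by (intro mult_left_mono) (auto simp: power_le_one)
    ultimately show "norm ((g z + e i) powr q - \<kappa> * g z ^ n) \<le> 2 powr q + \<bar>\<kappa>\<bar>"
      using powr_ge_zero[of "g z + e i" q] unfolding real_norm_def by linarith
  qed
qed auto

lemma smooth_convex_profileI:
  assumes "\<psi> \<in> borel_measurable borel" "\<psi>1 \<in> borel_measurable borel"
      "\<psi>2 \<in> borel_measurable borel" "\<psi>3 \<in> borel_measurable borel"
    and d: "\<And>t. 0 < t \<Longrightarrow> t < 1 \<Longrightarrow> (\<psi> has_real_derivative \<psi>1 t) (at t)"
      "\<And>t. 0 < t \<Longrightarrow> t < 1 \<Longrightarrow> (\<psi>1 has_real_derivative \<psi>2 t) (at t)"
      "\<And>t. 0 < t \<Longrightarrow> t < 1 \<Longrightarrow> (\<psi>2 has_real_derivative \<psi>3 t) (at t)"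
    and c: "continuous_on {0..1} \<psi>" "continuous_on {0..1} \<psi>1" "continuous_on {0..1} \<psi>2" "continuous_on {0..1} \<psi>3"
    and p: "\<And>t. 0 < t \<Longrightarrow> t < 1 \<Longrightarrow> 0 \<le> \<psi>2 t"
  shows "\<exists>B. smooth_convex_profile \<psi> \<psi>1 \<psi>2 \<psi>3 B"
proof -
  have bd: "\<exists>b. \<forall>t\<in>{0..1}. \<bar>f t\<bar> \<le> b" if "continuous_on {0..1::real} f" for f :: "real \<Rightarrow> real"
    using compact_imp_bounded[OF compact_continuous_image[OF that compact_Icc]]
    by (auto simp: bounded_iff)
  obtain b0 b1 b2 b3 where
    b: "\<forall>t\<in>{0..1}. \<bar>\<psi> t\<bar> \<le> b0" "\<forall>t\<in>{0..1}. \<bar>\<psi>1 t\<bar> \<le> b1"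
       "\<forall>t\<in>{0..1}. \<bar>\<psi>2 t\<bar> \<le> b2" "\<forall>t\<in>{0..1}. \<bar>\<psi>3 t\<bar> \<le> b3"
    using bd[OF c(1)] bd[OF c(2)] bd[OF c(3)] bd[OF c(4)] by blast
  define B where "B = max (max b0 b1) (max b2 b3)"
  have B: "b0 \<le> B" "b1 \<le> B" "b2 \<le> B" "b3 \<le> B" unfolding B_def by auto
  have "\<bar>\<psi> t\<bar> \<le> B" if "0 \<le> t" "t \<le> 1" for t using b(1) B(1) that by (meson atLeastAtMost_iff order.trans)
  moreover have "\<bar>\<psi>1 t\<bar> \<le> B" "\<bar>\<psi>2 t\<bar> \<le> B" "\<bar>\<psi>3 t\<bar> \<le> B" if "0 < t" "t < 1" for t
    using b(2-4) B(2-4) that by (meson atLeastAtMost_iff less_imp_le order.trans)+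
  ultimately have "smooth_convex_profile \<psi> \<psi>1 \<psi>2 \<psi>3 B"
    by unfold_locales (use assms in blast)+
  then show ?thesis by blast
qed

lemma power_profile:
  assumes "3 \<le> n"
  shows "\<exists>B. smooth_convex_profile (\<lambda>t. t ^ n) (\<lambda>t. real n * t ^ (n - 1))
    (\<lambda>t. real n * (real (n - 1) * t ^ (n - 2))) (\<lambda>t. real n * (real (n - 1) * (real (n - 2) * t ^ (n - 3)))) B"
proof (rule smooth_convex_profileI)
  have n: "n - 2 = n - 1 - Suc 0" "n - 3 = n - 2 - Suc 0" by simp_all
  show "((\<lambda>t. t ^ n) has_real_derivative real n * t ^ (n - 1)) (at t)" for t
    using DERIV_pow[of n t] by simp
  show "((\<lambda>t. real n * t ^ (n - 1)) has_real_derivative real n * (real (n - 1) * t ^ (n - 2))) (at t)" for t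
    unfolding n(1) by (intro DERIV_cmult DERIV_pow)
  show "((\<lambda>t. real n * (real (n - 1) * t ^ (n - 2))) has_real_derivative
      real n * (real (n - 1) * (real (n - 2) * t ^ (n - 3)))) (at t)" for t
    unfolding n(2) by (intro DERIV_cmult DERIV_pow)
qed (auto intro!: continuous_intros)

text \<open>The shift by \<open>e\<close> makes all derivatives bounded, and \<open>\<kappa>\<close> is so small that subtracting the integer power keeps the
function convex: \<open>t ^ (n - 2) / 2 \<le> (t + e) powr (q - 2)\<close> for \<open>0 < t < 1\<close>, whichever sign \<open>q - 2\<close> has.\<close>

lemma powr_profile:
  assumes q: "1 < q" and e: "0 < e" "e \<le> 1" and n: "3 \<le> n" "q \<le> real n"
  defines "\<kappa> \<equiv> q * (q - 1) / (2 * (real n * real (n - 1)))"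
  shows "\<exists>\<psi>1 \<psi>2 \<psi>3 B. smooth_convex_profile (\<lambda>t. (t + e) powr q - \<kappa> * t ^ n) \<psi>1 \<psi>2 \<psi>3 B"
proof -
  have n2: "n - 2 = n - 1 - Suc 0" "n - 3 = n - 2 - Suc 0" by simp_all
  have dp: "((\<lambda>t. (t + e) powr p) has_real_derivative p * (t + e) powr (p - 1)) (at t)" if "0 < t" for p t
    using that e by (auto intro!: derivative_eq_intros)
  have cp: "continuous_on {0..1} (\<lambda>t. (t + e) powr p)" for p
    using e by (auto intro!: continuous_intros)
  let ?\<psi>1 = "\<lambda>t. q * (t + e) powr (q - 1) - \<kappa> * (real n * t ^ (n - 1))"
  let ?\<psi>2 = "\<lambda>t. q * ((q - 1) * (t + e) powr (q - 2)) - \<kappa> * (real n * (real (n - 1) * t ^ (n - 2)))"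
  let ?\<psi>3 = "\<lambda>t. q * ((q - 1) * ((q - 2) * (t + e) powr (q - 3))) - \<kappa> * (real n * (real (n - 1) * (real (n - 2) * t ^ (n - 3))))"
  have "\<exists>B. smooth_convex_profile (\<lambda>t. (t + e) powr q - \<kappa> * t ^ n) ?\<psi>1 ?\<psi>2 ?\<psi>3 B"
  proof (rule smooth_convex_profileI)
    fix t :: real assume t: "0 < t" "t < 1"
    show "((\<lambda>t. (t + e) powr q - \<kappa> * t ^ n) has_real_derivative ?\<psi>1 t) (at t)"
      using DERIV_pow[of n t] by (intro DERIV_diff DERIV_cmult dp t) auto
    have "((\<lambda>t. (t + e) powr (q - 1)) has_real_derivative (q - 1) * (t + e) powr (q - 2)) (at t)"
      using dp[OF t(1), of "q - 1"] by simp
    then show "(?\<psi>1 has_real_derivative ?\<psi>2 t) (at t)"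
      unfolding n2(1) by (intro DERIV_diff DERIV_cmult DERIV_pow)
    have "((\<lambda>t. (t + e) powr (q - 2)) has_real_derivative (q - 2) * (t + e) powr (q - 3)) (at t)"
      using dp[OF t(1), of "q - 2"] by simp
    then show "(?\<psi>2 has_real_derivative ?\<psi>3 t) (at t)"
      unfolding n2(2) by (intro DERIV_diff DERIV_cmult DERIV_pow)
    have "t ^ (n - 2) / 2 \<le> (t + e) powr (q - 2)"
    proof (cases "2 \<le> q")
      case True
      have "t ^ (n - 2) = t powr (real n - 2)"
        using t n by (subst powr_realpow[symmetric]) (auto simp: of_nat_diff)
      also have "\<dots> \<le> t powr (q - 2)" using t n by (intro powr_mono') auto
      also have "\<dots> \<le> (t + e) powr (q - 2)" using True t e by (intro powr_mono2) auto
      finally show ?thesis using zero_le_power[of t "n - 2"] t by linarith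
    next
      case False
      have "t ^ (n - 2) \<le> 1" using t by (intro power_le_one) auto
      then have "t ^ (n - 2) / 2 \<le> 1 / 2" by simp
      also have "\<dots> = 2 powr (- 1)" by (subst powr_minus) simp
      also have "\<dots> \<le> 2 powr (q - 2)" using q by (intro powr_mono) auto
      also have "\<dots> \<le> (t + e) powr (q - 2)" using False t e by (intro powr_mono2') auto
      finally show ?thesis .
    qed
    then have "q * (q - 1) * (t ^ (n - 2) / 2) \<le> q * (q - 1) * (t + e) powr (q - 2)"
      using q by (intro mult_left_mono) auto
    moreover have "\<kappa> * (real n * (real (n - 1) * t ^ (n - 2))) = q * (q - 1) * (t ^ (n - 2) / 2)"
      unfolding \<kappa>_def using n by (simp add: field_simps)
    ultimately have "\<kappa> * (real n * (real (n - 1) * t ^ (n - 2))) \<le> q * (q - 1) * (t + e) powr (q - 2)"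
      by linarith
    then show "0 \<le> ?\<psi>2 t" by (simp only: diff_ge_0_iff_ge mult.assoc)
  qed (auto intro!: continuous_intros cp)
  then show ?thesis by blast
qed

lemma integral_gauss_diff_cmult:
  fixes k l :: "'a::euclidean_space \<Rightarrow> real"
  assumes [measurable]: "k \<in> borel_measurable borel" "l \<in> borel_measurable borel"
    and b: "\<And>x. \<bar>k x\<bar> \<le> 1" "\<And>x. \<bar>l x\<bar> \<le> 1"
  shows "(\<integral>x. k x - \<kappa> * l x \<partial>gauss) = (\<integral>x. k x \<partial>gauss) - \<kappa> * (\<integral>x. l x \<partial>gauss)"
proof -
  have "integrable gauss k" "integrable gauss l"
    using b by (auto intro!: integrable_gauss_bounded[where B = 1])
  then show ?thesis by simp
qed

text \<open>The profile \<open>t powr q\<close> is the sum of \<open>t powr q - \<kappa> t ^ n\<close>, a limit of smooth convex profiles, and of \<open>\<kappa> t ^ n\<close>. The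
inequality holds for both parts, so equality for the sum forces equality for \<open>t ^ n\<close>, which is strictly convex.\<close>

lemma heat_powr_le:
  fixes f :: "'a::euclidean_space \<Rightarrow> real"
  assumes f[measurable]: "f \<in> borel_measurable borel" and fb: "\<And>x. 0 \<le> f x" "\<And>x. f x \<le> 1"
    and w: "0 < w" "w \<le> v" and q: "1 < q" and m: "0 < heat v f x" "heat v f x < 1"
  shows "heat (v - w) (\<lambda>y. heat w f y powr q) x \<le> halfspace_value (\<lambda>t. t powr q) (sqrt (w / v)) (heat v f x)"
    and "heat (v - w) (\<lambda>y. heat w f y powr q) x = halfspace_value (\<lambda>t. t powr q) (sqrt (w / v)) (heat v f x) \<Longrightarrow>
      w < v \<Longrightarrow> norm (gauss_moment (\<lambda>z. f (x + sqrt v *\<^sub>R z))) = \<phi> (quantile (heat v f x))"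
proof -
  define n where "n = nat \<lceil>q\<rceil> + 3"
  have n: "3 \<le> n" "q \<le> real n" unfolding n_def using q by linarith+
  define \<kappa> where "\<kappa> = q * (q - 1) / (2 * (real n * real (n - 1)))"
  have \<kappa>: "0 < \<kappa>" unfolding \<kappa>_def using q n by simp
  define e where "e i = 1 / (real i + 1)" for i :: nat
  have e: "0 < e i" "e i \<le> 1" for i unfolding e_def by auto
  have e0: "e \<longlonglongrightarrow> 0" unfolding e_def by real_asymp
  define a where "a = quantile (heat v f x)"
  have Pa: "heat v f x = Phi a" unfolding a_def using m by simp
  define g where "g z = heat w f (x + sqrt (v - w) *\<^sub>R z)" for z
  have hb: "0 \<le> heat u f y" "heat u f y \<le> 1" for u y by (rule heat_bounds[OF f fb])+
  have [measurable]: "g \<in> borel_measurable borel" unfolding g_def by simp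
  have g: "0 \<le> g z" "g z \<le> 1" for z unfolding g_def using hb by auto
  define c where "c = sqrt (w / v)"
  \<comment> \<open>The values of a half-space with the same mean, so that both sides are integrals of \<open>\<psi>\<close>.\<close>
  define G where "G z = Phi ((a + sqrt (1 - c\<^sup>2) * z) / c)" for z
  have [measurable]: "G \<in> borel_measurable borel" unfolding G_def by simp
  have G: "0 \<le> G z" "G z \<le> 1" for z unfolding G_def using Phi_pos Phi_less_1 by (auto intro: less_imp_le)
  have ineq: "(\<integral>z. \<psi> (g z) \<partial>gauss) \<le> (\<integral>z. \<psi> (G z) \<partial>gauss)" if "smooth_convex_profile \<psi> \<psi>1 \<psi>2 \<psi>3 B" for \<psi> \<psi>1 \<psi>2 \<psi>3 B
    using smooth_convex_profile.heat_profile_le[OF that f fb w, of x]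
    unfolding Pa halfspace_value_Phi heat_def[of "v - w"] g_def G_def c_def .
  have I1: "(\<integral>z. g z powr q - \<kappa> * g z ^ n \<partial>gauss) \<le> (\<integral>z. G z powr q - \<kappa> * G z ^ n \<partial>gauss)"
  proof (rule LIMSEQ_le[OF powr_profile_limit powr_profile_limit])
    show "\<exists>N. \<forall>i\<ge>N. (\<integral>z. (g z + e i) powr q - \<kappa> * g z ^ n \<partial>gauss) \<le> (\<integral>z. (G z + e i) powr q - \<kappa> * G z ^ n \<partial>gauss)"
    proof (intro exI allI impI)
      fix i
      obtain \<psi>1 \<psi>2 \<psi>3 B where "smooth_convex_profile (\<lambda>t. (t + e i) powr q - \<kappa> * t ^ n) \<psi>1 \<psi>2 \<psi>3 B"
        using powr_profile[OF q e[of i] n] unfolding \<kappa>_def by blast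
      from ineq[OF this] show "(\<integral>z. (g z + e i) powr q - \<kappa> * g z ^ n \<partial>gauss) \<le> (\<integral>z. (G z + e i) powr q - \<kappa> * G z ^ n \<partial>gauss)" .
    qed
  qed (use g G q e e0 in auto)
  obtain B where P: "smooth_convex_profile (\<lambda>t. t ^ n) (\<lambda>t. real n * t ^ (n - 1))
    (\<lambda>t. real n * (real (n - 1) * t ^ (n - 2))) (\<lambda>t. real n * (real (n - 1) * (real (n - 2) * t ^ (n - 3)))) B"
    using power_profile[OF n(1)] by blast
  have I2: "(\<integral>z. g z ^ n \<partial>gauss) \<le> (\<integral>z. G z ^ n \<partial>gauss)" by (rule ineq[OF P])
  have split: "(\<integral>z. k z powr q - \<kappa> * k z ^ n \<partial>gauss) = (\<integral>z. k z powr q \<partial>gauss) - \<kappa> * (\<integral>z. k z ^ n \<partial>gauss)"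
    if [measurable]: "k \<in> borel_measurable borel" and k: "\<And>z. 0 \<le> k z" "\<And>z. k z \<le> 1" for k :: "'b::euclidean_space \<Rightarrow> real"
  proof (rule integral_gauss_diff_cmult)
    show "\<bar>k z powr q\<bar> \<le> 1" for z using k[of z] q by (simp add: powr_le1)
    show "\<bar>k z ^ n\<bar> \<le> 1" for z using k[of z] by (simp add: power_le_one)
  qed auto
  have S: "heat (v - w) (\<lambda>y. heat w f y powr q) x = (\<integral>z. g z powr q \<partial>gauss)"
    "halfspace_value (\<lambda>t. t powr q) (sqrt (w / v)) (heat v f x) = (\<integral>z. G z powr q \<partial>gauss)"
    unfolding Pa halfspace_value_Phi heat_def[of "v - w"] g_def G_def c_def by simp_all
  have I1': "(\<integral>z. g z powr q \<partial>gauss) - \<kappa> * (\<integral>z. g z ^ n \<partial>gauss) \<le> (\<integral>z. G z powr q \<partial>gauss) - \<kappa> * (\<integral>z. G z ^ n \<partial>gauss)"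
    using I1 g G by (simp add: split)
  have I2': "\<kappa> * (\<integral>z. g z ^ n \<partial>gauss) \<le> \<kappa> * (\<integral>z. G z ^ n \<partial>gauss)" using I2 \<kappa> by (intro mult_left_mono) auto
  show "heat (v - w) (\<lambda>y. heat w f y powr q) x \<le> halfspace_value (\<lambda>t. t powr q) (sqrt (w / v)) (heat v f x)"
    unfolding S using I1' I2' by linarith
  assume eq: "heat (v - w) (\<lambda>y. heat w f y powr q) x = halfspace_value (\<lambda>t. t powr q) (sqrt (w / v)) (heat v f x)"
    and wv: "w < v"
  have "\<kappa> * (\<integral>z. G z ^ n \<partial>gauss) \<le> \<kappa> * (\<integral>z. g z ^ n \<partial>gauss)" using I1' eq unfolding S by linarith
  then have "(\<integral>z. g z ^ n \<partial>gauss) = (\<integral>z. G z ^ n \<partial>gauss)" using I2 \<kappa> by simp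
  then have "heat (v - w) (\<lambda>y. heat w f y ^ n) x = halfspace_value (\<lambda>t. t ^ n) (sqrt (w / v)) (heat v f x)"
    unfolding Pa halfspace_value_Phi heat_def[of "v - w"] g_def G_def c_def .
  then show "norm (gauss_moment (\<lambda>z. f (x + sqrt v *\<^sub>R z))) = \<phi> (quantile (heat v f x))"
    by (rule smooth_convex_profile.heat_profile_eq_imp[OF P f fb w(1) wv m, rotated]) (use n in auto)
qed

section \<open>Stability of Lebesgue measurable sets\<close>

lemma std_gaussian_eq_completion: "std_gaussian = completion gauss"
  unfolding std_gaussian_def gauss_def
  by (rule completion_density_eq[symmetric]) (auto simp: std_gaussian_density_pos)

lemma sets_std_gaussian [simp]: "sets std_gaussian = sets lebesgue"
  and space_std_gaussian [simp]: "space std_gaussian = UNIV"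
  by (simp_all add: std_gaussian_def)

lemma AE_std_gaussian_iff: "(AE x in std_gaussian. P x) \<longleftrightarrow> (AE x in gauss. P x)"
  unfolding std_gaussian_eq_completion by (rule AE_completion_iff)

lemma borel_representative:
  fixes A :: "'a::euclidean_space set"
  assumes "A \<in> sets lebesgue"
  shows "\<exists>B\<in>sets borel. AE x in gauss. x \<in> A \<longleftrightarrow> x \<in> B"
proof
  show "main_part lborel A \<in> sets borel" using main_part_sets[OF assms] by simp
  show "AE x in gauss. x \<in> A \<longleftrightarrow> x \<in> main_part lborel A"
    unfolding AE_gauss_iff using AE_in_main_part[OF assms] by eventually_elim simp
qed

lemma measure_std_gaussian_eq:
  assumes A: "A \<in> sets lebesgue" and B: "B \<in> sets borel" and ae: "AE x in gauss. x \<in> A \<longleftrightarrow> x \<in> B"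
  shows "measure std_gaussian A = measure gauss B"
proof -
  have "measure std_gaussian A = measure std_gaussian B"
    using A B ae by (intro measure_eq_AE) (auto simp: AE_std_gaussian_iff intro: sets_completionI_sets)
  also have "\<dots> = measure gauss B" using B by (simp add: std_gaussian_eq_completion)
  finally show ?thesis .
qed

lemma integral_std_gaussian_eq_gauss_moment:
  assumes A: "A \<in> sets lebesgue" and B[measurable]: "B \<in> sets borel" and ae: "AE x in gauss. x \<in> A \<longleftrightarrow> x \<in> B"
  shows "(\<integral>x\<in>A. x \<partial>std_gaussian) = gauss_moment (indicator B)"
proof -
  have [measurable]: "A \<in> sets std_gaussian" "B \<in> sets std_gaussian" using A B by (auto intro: sets_completionI_sets)
  have id: "(\<lambda>x::'a. x) \<in> borel_measurable std_gaussian"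
    unfolding std_gaussian_eq_completion by (intro measurable_completion) simp
  have "(\<integral>x\<in>A. x \<partial>std_gaussian) = (\<integral>x. indicator B x *\<^sub>R x \<partial>std_gaussian)"
    unfolding set_lebesgue_integral_def
  proof (rule integral_cong_AE)
    show "AE x in std_gaussian. indicator A x *\<^sub>R x = (indicator B x :: real) *\<^sub>R x"
      unfolding AE_std_gaussian_iff using ae by eventually_elim (auto simp: indicator_def)
  qed (intro borel_measurable_scaleR borel_measurable_indicator id, fact)+
  also have "\<dots> = gauss_moment (indicator B)"
    unfolding std_gaussian_eq_completion gauss_moment_def by (rule integral_completion) simp
  finally show ?thesis .
qed

lemma sym_diff_null_iff:
  assumes "A \<in> sets lebesgue" "H \<in> sets lebesgue"
  shows "emeasure std_gaussian (sym_diff A H) = 0 \<longleftrightarrow> (AE x in gauss. x \<in> A \<longleftrightarrow> x \<in> H)"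
proof -
  have "sym_diff A H = {x \<in> space std_gaussian. \<not> (x \<in> A \<longleftrightarrow> x \<in> H)}" by auto
  moreover have "sym_diff A H \<in> sets std_gaussian" using assms by auto
  ultimately show ?thesis
    unfolding AE_std_gaussian_iff[symmetric] by (subst AE_iff_measurable) auto
qed

context
  fixes M :: "'w measure" and X Y :: "'w \<Rightarrow> 'a::euclidean_space"
  assumes XY: "independent_std_gaussians M X Y"
begin

interpretation M: prob_space M
  using XY by (simp add: independent_std_gaussians_def)

lemma measurable_XY [measurable]: "X \<in> borel_measurable M" "Y \<in> borel_measurable M"
  using XY by (auto simp: independent_std_gaussians_def distributed_def)

lemma joint_distr_XY: "distr M (borel \<Otimes>\<^sub>M borel) (\<lambda>\<omega>. (X \<omega>, Y \<omega>)) = gauss \<Otimes>\<^sub>M gauss"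
proof -
  have "distr M borel X = gauss" "distr M borel Y = gauss"
    using XY by (auto simp: independent_std_gaussians_def distributed_def gauss_def cong: distr_cong)
  then show ?thesis
    using XY M.indep_var_distribution_eq[of borel X borel Y] by (simp add: independent_std_gaussians_def)
qed

lemma integral_XY:
  fixes F :: "'a \<Rightarrow> 'a \<Rightarrow> real"
  assumes [measurable]: "case_prod F \<in> borel_measurable (borel \<Otimes>\<^sub>M borel)" and b: "\<And>x y. \<bar>F x y\<bar> \<le> B"
  shows "(\<integral>\<omega>. F (X \<omega>) (Y \<omega>) \<partial>M) = (\<integral>x. \<integral>y. F x y \<partial>gauss \<partial>gauss)"
proof -
  have i: "integrable (gauss \<Otimes>\<^sub>M gauss) (case_prod F)"
    by (rule gauss_pair.P.integrable_const_bound[where B = B]) (use b in auto)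
  have "(\<integral>\<omega>. F (X \<omega>) (Y \<omega>) \<partial>M) = (\<integral>p. case_prod F p \<partial>distr M (borel \<Otimes>\<^sub>M borel) (\<lambda>\<omega>. (X \<omega>, Y \<omega>)))"
    by (subst integral_distr) auto
  also have "\<dots> = (\<integral>x. \<integral>y. F x y \<partial>gauss \<partial>gauss)"
    unfolding joint_distr_XY using gauss_pair.integral_fst'[OF i] by simp
  finally show ?thesis .
qed

lemma distr_noisy:
  assumes \<rho>: "0 \<le> \<rho>" "\<rho> < 1"
  shows "distr M borel (\<lambda>\<omega>. sqrt \<rho> *\<^sub>R X \<omega> + sqrt (1 - \<rho>) *\<^sub>R Y \<omega>) = gauss" (is "distr M borel ?Z = _")
proof (rule measure_eqI)
  fix N assume "N \<in> sets (distr M borel ?Z)"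
  then have N[measurable]: "N \<in> sets borel" by simp
  have "measure (distr M borel ?Z) N = (\<integral>\<omega>. indicator N \<omega> \<partial>distr M borel ?Z)" by simp
  also have "\<dots> = (\<integral>\<omega>. indicator N (?Z \<omega>) \<partial>M)" by (subst integral_distr) auto
  also have "\<dots> = (\<integral>x. mehler (sqrt \<rho>) (sqrt (1 - \<rho>)) (indicator N) x \<partial>gauss)"
    unfolding mehler_def by (rule integral_XY[where B = 1]) (auto simp: indicator_def)
  also have "\<dots> = (\<integral>x. indicator N x \<partial>gauss)"
    using \<rho> by (intro integral_mehler[where B = 1]) (auto simp: indicator_def)
  also have "\<dots> = measure gauss N" by simp
  finally show "emeasure (distr M borel ?Z) N = emeasure gauss N"
    by (simp add: gauss.emeasure_eq_measure finite_measure.emeasure_eq_measure[OF prob_space.finite_measure[OF M.prob_space_distr]])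
qed simp

text \<open>The conditional probability given \<open>X\<close> is obtained by integrating out the independent \<open>Y\<close>. The set \<open>A\<close> may be replaced by
its Borel version because the law of the noisy vector is again Gaussian, hence does not charge null sets.\<close>

lemma cond_prob_in_eq:
  fixes A :: "'a set"
  assumes \<rho>: "0 \<le> \<rho>" "\<rho> < 1" and B[measurable]: "B \<in> sets borel" and ae: "AE x in gauss. x \<in> A \<longleftrightarrow> x \<in> B"
  defines "Z \<equiv> \<lambda>\<omega>. sqrt \<rho> *\<^sub>R X \<omega> + sqrt (1 - \<rho>) *\<^sub>R Y \<omega>"
  shows "AE \<omega> in completion M. cond_prob_in M X Z A \<omega> = heat (1 - \<rho>) (indicator B) (sqrt \<rho> *\<^sub>R X \<omega>)"
proof -
  let ?F = "vimage_algebra (space M) X borel"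
  let ?h = "\<lambda>x. heat (1 - \<rho>) (indicator B) (sqrt \<rho> *\<^sub>R x)"
  have h: "0 \<le> ?h x" "?h x \<le> 1" for x by (auto intro!: heat_bounds)
  interpret cM: prob_space "completion M" by (rule M.prob_space_completion)
  have sF: "sets ?F = {X -` C \<inter> space M | C. C \<in> sets borel}"
    by (rule sets_vimage_algebra2) auto
  have sub: "subalgebra (completion M) ?F"
    unfolding subalgebra_def sF by (auto intro: measurable_sets[OF measurable_XY(1)])
  interpret finite_measure_subalgebra "completion M" ?F
    by unfold_locales (rule sub)
  have [measurable]: "Z \<in> borel_measurable M" unfolding Z_def by measurable
  have aeZ: "AE \<omega> in M. Z \<omega> \<in> A \<longleftrightarrow> Z \<omega> \<in> B"
  proof -
    have "AE x in distr M borel Z. x \<in> A \<longleftrightarrow> x \<in> B"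
      unfolding Z_def distr_noisy[OF \<rho>] by (rule ae)
    from AE_distrD[OF \<open>Z \<in> borel_measurable M\<close> this] show ?thesis .
  qed
  let ?A = "{\<omega> \<in> space M. Z \<omega> \<in> A}" and ?B = "{\<omega> \<in> space M. Z \<omega> \<in> B}"
  have Bm: "?B \<in> sets (completion M)" by (rule sets_completionI_sets) simp
  have Am: "?A \<in> sets (completion M)"
  proof (rule completion.in_sets_AE[OF _ Bm])
    show "AE x in completion M. (x \<in> ?B) = (x \<in> ?A)"
      unfolding AE_completion_iff using aeZ by eventually_elim auto
  qed auto
  show ?thesis
    unfolding cond_prob_in_def
  proof (rule real_cond_exp_charact)
    fix C assume "C \<in> sets ?F"
    then obtain C' where C'[measurable]: "C' \<in> sets borel" and C: "C = X -` C' \<inter> space M" unfolding sF by auto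
    have Cm: "C \<in> sets (completion M)" unfolding C by (rule sets_completionI_sets) simp
    have "(\<integral>\<omega>\<in>C. (indicator ?A \<omega> :: real) \<partial>completion M) = (\<integral>\<omega>. indicator C' (X \<omega>) * (indicator B (Z \<omega>) :: real) \<partial>completion M)"
      unfolding set_lebesgue_integral_def
    proof (rule integral_cong_AE)
      show "(\<lambda>\<omega>. indicator C \<omega> *\<^sub>R (indicator ?A \<omega> :: real)) \<in> borel_measurable (completion M)"
        by (intro borel_measurable_scaleR borel_measurable_indicator Cm Am)
      show "(\<lambda>\<omega>. indicator C' (X \<omega>) * (indicator B (Z \<omega>) :: real)) \<in> borel_measurable (completion M)"
        by (intro measurable_completion) simp
      show "AE \<omega> in completion M. indicator C \<omega> *\<^sub>R (indicator ?A \<omega> :: real) = indicator C' (X \<omega>) * (indicator B (Z \<omega>) :: real)"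
        unfolding AE_completion_iff using aeZ AE_space[of M] by eventually_elim (auto simp: C indicator_def)
    qed
    also have "\<dots> = (\<integral>\<omega>. indicator C' (X \<omega>) * (indicator B (Z \<omega>) :: real) \<partial>M)"
      by (rule integral_completion) simp
    also have "\<dots> = (\<integral>x. \<integral>y. indicator C' x * indicator B (sqrt \<rho> *\<^sub>R x + sqrt (1 - \<rho>) *\<^sub>R y) \<partial>gauss \<partial>gauss)"
      unfolding Z_def by (rule integral_XY[where B = 1]) (auto simp: indicator_def)
    also have "\<dots> = (\<integral>x. \<integral>y. indicator C' x * ?h x \<partial>(gauss :: 'a measure) \<partial>gauss)"
      by (simp add: heat_def prob_gauss_UNIV)
    also have "\<dots> = (\<integral>\<omega>. indicator C' (X \<omega>) * ?h (X \<omega>) \<partial>M)"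
      by (rule integral_XY[where B = 1, symmetric]) (use h in \<open>auto simp: indicator_def\<close>)
    also have "\<dots> = (\<integral>\<omega>. indicator C' (X \<omega>) * ?h (X \<omega>) \<partial>completion M)"
      by (rule integral_completion[symmetric]) simp
    also have "\<dots> = (\<integral>\<omega>\<in>C. ?h (X \<omega>) \<partial>completion M)"
      unfolding set_lebesgue_integral_def
      by (intro Bochner_Integration.integral_cong) (auto simp: C indicator_def)
    finally show "(\<integral>\<omega>\<in>C. indicator ?A \<omega> \<partial>completion M) = (\<integral>\<omega>\<in>C. ?h (X \<omega>) \<partial>completion M)" .
  next
    show "integrable (completion M) (indicator ?A :: 'w \<Rightarrow> real)"
      using Am by (intro cM.integrable_const_bound[where B = 1]) auto
    have "(\<lambda>\<omega>. ?h (X \<omega>)) \<in> borel_measurable (completion M)" by (intro measurable_completion) simp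
    then show "integrable (completion M) (\<lambda>\<omega>. ?h (X \<omega>))"
      using h by (intro cM.integrable_const_bound[where B = 1]) auto
    have "X \<in> ?F \<rightarrow>\<^sub>M borel" by (rule measurable_vimage_algebra1) auto
    then show "(\<lambda>\<omega>. ?h (X \<omega>)) \<in> borel_measurable ?F" by measurable
  qed
qed

lemma q_stability_eq_heat:
  fixes A :: "'a set"
  assumes \<rho>: "0 \<le> \<rho>" "\<rho> < 1" and q: "1 < q" and B[measurable]: "B \<in> sets borel" and ae: "AE x in gauss. x \<in> A \<longleftrightarrow> x \<in> B"
  shows "q_stability M X Y q \<rho> A = heat \<rho> (\<lambda>y. heat (1 - \<rho>) (indicator B) y powr q) 0"
proof -
  let ?Z = "\<lambda>\<omega>. sqrt \<rho> *\<^sub>R X \<omega> + sqrt (1 - \<rho>) *\<^sub>R Y \<omega>"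
  let ?h = "\<lambda>x. heat (1 - \<rho>) (indicator B) (sqrt \<rho> *\<^sub>R x) powr q"
  have h: "0 \<le> heat (1 - \<rho>) (indicator B) x" "heat (1 - \<rho>) (indicator B) x \<le> 1" for x by (auto intro!: heat_bounds)
  have "q_stability M X Y q \<rho> A = (\<integral>\<omega>. ?h (X \<omega>) \<partial>completion M)"
    unfolding q_stability_def
  proof (rule integral_cong_AE)
    show "(\<lambda>\<omega>. cond_prob_in M X ?Z A \<omega> powr q) \<in> borel_measurable (completion M)"
      unfolding cond_prob_in_def by measurable
    show "(\<lambda>\<omega>. ?h (X \<omega>)) \<in> borel_measurable (completion M)" by (intro measurable_completion) simp
    show "AE \<omega> in completion M. cond_prob_in M X ?Z A \<omega> powr q = ?h (X \<omega>)"
      using cond_prob_in_eq[OF \<rho> B ae] by eventually_elim simp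
  qed
  also have "\<dots> = (\<integral>\<omega>. ?h (X \<omega>) \<partial>M)" by (rule integral_completion) simp
  also have "\<dots> = (\<integral>x. \<integral>y. ?h x \<partial>(gauss :: 'a measure) \<partial>gauss)"
    using h q by (intro integral_XY[where B = 1]) (auto intro!: powr_le1)
  finally show ?thesis by (simp add: heat_def[of \<rho>] prob_gauss_UNIV)
qed

end

lemma gaussian_moment_dir_nonzero:
  assumes "norm e = 1" shows "gaussian_moment_dir e A \<noteq> 0"
  using assms by (auto simp: gaussian_moment_dir_def Let_def)

text \<open>Existence of a threshold, so that the choice in its definition is meaningful. The thresholds \<open>\<infinity>\<close> and \<open>-\<infinity>\<close> serve
the measures 0 and 1, a rescaled quantile all others.\<close>

lemma gaussian_halfspace_measure:
  fixes A :: "'a::euclidean_space set"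
  assumes e: "norm e = 1"
  shows "measure std_gaussian (gaussian_halfspace e A) = measure std_gaussian A"
proof -
  let ?v = "gaussian_moment_dir e A" and ?p = "measure std_gaussian A"
  interpret P: prob_space "std_gaussian :: 'a measure"
    unfolding std_gaussian_eq_completion by (rule gauss.prob_space_completion)
  have v: "?v \<noteq> 0" by (rule gaussian_moment_dir_nonzero[OF e])
  have "\<exists>\<alpha>. measure std_gaussian {x. \<alpha> \<le> ereal (x \<bullet> ?v)} = ?p"
  proof -
    consider "?p = 0" | "?p = 1" | "0 < ?p" "?p < 1"
      using P.prob_le_1[of A] measure_nonneg[of std_gaussian A] by linarith
    then show ?thesis
    proof cases
      case 1 then show ?thesis by (intro exI[of _ \<infinity>]) simp
    next
      case 2 then show ?thesis using P.prob_space by (intro exI[of _ "- \<infinity>"]) simp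
    next
      case 3
      let ?\<theta> = "(1 / norm ?v) *\<^sub>R ?v" and ?a = "quantile ?p"
      have "{x. ereal (- (norm ?v * ?a)) \<le> ereal (x \<bullet> ?v)} = {x. - (?\<theta> \<bullet> x) \<le> ?a}"
        using v by (auto simp: inner_commute field_simps)
      moreover have "measure std_gaussian {x. - (?\<theta> \<bullet> x) \<le> ?a} = measure gauss {x. - (?\<theta> \<bullet> x) \<le> ?a}"
        unfolding std_gaussian_eq_completion by (rule measure_completion) simp
      moreover have "measure gauss {x. - (?\<theta> \<bullet> x) \<le> ?a} = ?p"
        using measure_gauss_halfspace[of ?\<theta> ?a] v 3 by simp
      ultimately show ?thesis by metis
    qed
  qed
  then have "measure std_gaussian {x. gaussian_threshold e A \<le> ereal (x \<bullet> ?v)} = ?p"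
    unfolding gaussian_threshold_def by (rule someI_ex)
  then show ?thesis by (simp add: gaussian_halfspace_def)
qed

lemma borel_gaussian_halfspace [measurable]: "gaussian_halfspace e A \<in> sets borel"
  unfolding gaussian_halfspace_def by measurable

text \<open>In the case of equality the moment of \<open>A\<close> has the maximal length \<open>\<phi> a\<close>. In particular it is nonzero, so it is the
normal direction of the half-space, and the equality case of the bathtub principle in this direction says that \<open>A\<close> is a
half-space; having the same measure and direction, the two half-spaces coincide.\<close>

lemma q_stability_halfspace:
  fixes M :: "'w measure" and X Y :: "'w \<Rightarrow> 'a::euclidean_space"
  assumes XY: "independent_std_gaussians M X Y" and e: "norm e = 1" and A: "A \<in> sets lebesgue"
    and \<rho>: "0 \<le> \<rho>" "\<rho> < 1" and q: "1 < q"
  defines "H \<equiv> gaussian_halfspace e A"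
  shows "q_stability M X Y q \<rho> A \<le> q_stability M X Y q \<rho> H"
    and "emeasure std_gaussian (sym_diff A H) = 0 \<Longrightarrow> q_stability M X Y q \<rho> H = q_stability M X Y q \<rho> A"
    and "0 < \<rho> \<Longrightarrow> q_stability M X Y q \<rho> H = q_stability M X Y q \<rho> A \<Longrightarrow> emeasure std_gaussian (sym_diff A H) = 0"
proof -
  interpret P: prob_space "std_gaussian :: 'a measure"
    unfolding std_gaussian_eq_completion by (rule gauss.prob_space_completion)
  have H[measurable]: "H \<in> sets borel" unfolding H_def by simp
  have HL: "H \<in> sets lebesgue" using H by (auto intro: sets_completionI_sets)
  have null: "emeasure std_gaussian (sym_diff A H) = 0 \<longleftrightarrow> (AE x in gauss. x \<in> A \<longleftrightarrow> x \<in> H)"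
    by (rule sym_diff_null_iff[OF A HL])
  have SH: "q_stability M X Y q \<rho> H = heat \<rho> (\<lambda>y. heat (1 - \<rho>) (indicator H) y powr q) 0"
    by (rule q_stability_eq_heat[OF XY \<rho> q H]) simp
  have SA_H: "q_stability M X Y q \<rho> H = q_stability M X Y q \<rho> A" if "AE x in gauss. x \<in> A \<longleftrightarrow> x \<in> H"
    unfolding SH by (rule q_stability_eq_heat[OF XY \<rho> q H that, symmetric])
  then show "emeasure std_gaussian (sym_diff A H) = 0 \<Longrightarrow> q_stability M X Y q \<rho> H = q_stability M X Y q \<rho> A"
    unfolding null .
  obtain B where B[measurable]: "B \<in> sets borel" and ae: "AE x in gauss. x \<in> A \<longleftrightarrow> x \<in> B"
    using borel_representative[OF A] by blast
  define p where "p = measure gauss B"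
  have mA: "measure std_gaussian A = p" unfolding p_def by (rule measure_std_gaussian_eq[OF A B ae])
  have "measure std_gaussian H = p" unfolding H_def gaussian_halfspace_measure[OF e] mA ..
  then have mH: "measure gauss H = p" using H by (simp add: std_gaussian_eq_completion)
  have SA: "q_stability M X Y q \<rho> A = heat \<rho> (\<lambda>y. heat (1 - \<rho>) (indicator B) y powr q) 0"
    by (rule q_stability_eq_heat[OF XY \<rho> q B ae])
  have "q_stability M X Y q \<rho> A \<le> q_stability M X Y q \<rho> H \<and>
    (0 < \<rho> \<longrightarrow> q_stability M X Y q \<rho> H = q_stability M X Y q \<rho> A \<longrightarrow> (AE x in gauss. x \<in> A \<longleftrightarrow> x \<in> H))"
  proof -
    consider "p = 0" | "p = 1" | "0 < p" "p < 1"
      using gauss.prob_le_1[of B] measure_nonneg[of gauss B] unfolding p_def by linarith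
    then show ?thesis
    proof cases
      case 1
      then have "AE x in gauss. x \<notin> B" "AE x in gauss. x \<notin> H"
        using mH p_def gauss.prob_eq_0[of B] gauss.prob_eq_0[of H] by auto
      with ae have "AE x in gauss. x \<in> A \<longleftrightarrow> x \<in> H" by eventually_elim auto
      then show ?thesis using SA_H by auto
    next
      case 2
      then have "AE x in gauss. x \<in> B" "AE x in gauss. x \<in> H"
        using mH p_def gauss.prob_eq_1[of B] gauss.prob_eq_1[of H] by auto
      with ae have "AE x in gauss. x \<in> A \<longleftrightarrow> x \<in> H" by eventually_elim auto
      then show ?thesis using SA_H by auto
    next
      case 3
      define v where "v = gaussian_moment_dir e A"
      define \<theta> where "\<theta> = (1 / norm v) *\<^sub>R v"
      have v: "v \<noteq> 0" unfolding v_def by (rule gaussian_moment_dir_nonzero[OF e])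
      have \<theta>: "norm \<theta> = 1" unfolding \<theta>_def using v by simp
      have "\<exists>\<tau>. H = {x. \<tau> \<le> \<theta> \<bullet> x}"
      proof (cases "gaussian_threshold e A")
        case (real r)
        then have "H = {x. r / norm v \<le> \<theta> \<bullet> x}"
          unfolding H_def gaussian_halfspace_def v_def[symmetric] \<theta>_def using v
          by (auto simp: inner_commute field_simps)
        then show ?thesis ..
      next
        case PInf
        then have "H = {}" unfolding H_def gaussian_halfspace_def by auto
        then show ?thesis using mH 3 by simp
      next
        case MInf
        then have "H = UNIV" unfolding H_def gaussian_halfspace_def by auto
        then show ?thesis using mH 3 by (simp add: prob_gauss_UNIV)
      qed
      then obtain \<tau> where H\<tau>: "H = {x. \<tau> \<le> \<theta> \<bullet> x}" ..
      have heat1: "heat 1 (indicator C) 0 = measure gauss C" if "C \<in> sets borel" for C :: "'a set"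
        using that by (simp add: heat_def)
      have Hval: "q_stability M X Y q \<rho> H = halfspace_value (\<lambda>t. t powr q) (sqrt ((1 - \<rho>) / 1)) p"
        using heat_profile_halfspace[OF \<theta>, of "1 - \<rho>" 1 "\<lambda>t. t powr q" \<tau> 0] \<rho>
        unfolding SH H\<tau>[symmetric] heat1[OF H] mH by simp
      have hB: "heat 1 (indicator B) 0 = p" unfolding p_def by (rule heat1[OF B])
      have le: "q_stability M X Y q \<rho> A \<le> q_stability M X Y q \<rho> H"
        unfolding SA Hval using heat_powr_le(1)[of "indicator B" "1 - \<rho>" 1 q 0] \<rho> q 3 by (simp add: hB)
      have "AE x in gauss. x \<in> A \<longleftrightarrow> x \<in> H" if \<rho>0: "0 < \<rho>" and eq: "q_stability M X Y q \<rho> H = q_stability M X Y q \<rho> A"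
      proof -
        define D where "D = gauss_moment (indicator B :: 'a \<Rightarrow> real)"
        define a where "a = quantile p"
        have Pa: "Phi a = p" unfolding a_def using 3 by simp
        have nD: "norm D = \<phi> a"
          using heat_powr_le(2)[of "indicator B" "1 - \<rho>" 1 q 0] \<rho> \<rho>0 q 3 eq
          unfolding SA Hval by (simp add: hB D_def a_def)
        then have D0: "D \<noteq> 0" using phi_pos[of a] by auto
        have "(\<integral>x\<in>A. x \<partial>std_gaussian) = D"
          unfolding D_def by (rule integral_std_gaussian_eq_gauss_moment[OF A B ae])
        then have vD: "v = D" unfolding v_def gaussian_moment_dir_def using D0 by (simp add: Let_def)
        have "\<theta> \<bullet> D = \<phi> a"
          unfolding \<theta>_def vD using D0 nD by (simp add: power2_norm_eq_inner[symmetric] power2_eq_square)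
        then have "AE z in gauss. indicator B z = (indicator {z. - (\<theta> \<bullet> z) \<le> a} z :: real)"
          unfolding D_def using Pa by (intro gauss_moment_le_phi(2)[OF _ _ _ \<theta>]) (auto simp: p_def)
        moreover have "H = {z. - (\<theta> \<bullet> z) \<le> a}"
        proof -
          have Hm: "H = {z. - (\<theta> \<bullet> z) \<le> - \<tau>}" unfolding H\<tau> by auto
          then have "Phi (- \<tau>) = Phi a" using measure_gauss_halfspace[OF \<theta>, of "- \<tau>"] mH Pa by simp
          then show ?thesis using Hm by simp
        qed
        ultimately have "AE z in gauss. indicator B z = (indicator H z :: real)" by simp
        with ae show ?thesis by eventually_elim (auto simp: indicator_def split: if_splits)
      qed
      with le show ?thesis by blast
    qed
  qed
  then show "q_stability M X Y q \<rho> A \<le> q_stability M X Y q \<rho> H"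
    and "0 < \<rho> \<Longrightarrow> q_stability M X Y q \<rho> H = q_stability M X Y q \<rho> A \<Longrightarrow> emeasure std_gaussian (sym_diff A H) = 0"
    unfolding null by blast+
qed

theorem theorem1:
  fixes M :: "'w measure" and X Y :: "'w \<Rightarrow> real ^ 'n"
    and e :: "real ^ 'n" and A :: "(real ^ 'n) set" and q \<rho> :: real
  assumes "independent_std_gaussians M X Y"
    and "norm e = 1"
    and "A \<in> sets lebesgue"
    and "0 \<le> \<rho>" and "\<rho> < 1" and "1 < q"
  shows "q_stability M X Y q \<rho> (gaussian_halfspace e A) \<ge> q_stability M X Y q \<rho> A \<and>
    (emeasure std_gaussian (sym_diff A (gaussian_halfspace e A)) = 0 \<longrightarrow>
       q_stability M X Y q \<rho> (gaussian_halfspace e A) = q_stability M X Y q \<rho> A) \<and>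
    (0 < \<rho> \<longrightarrow>
       q_stability M X Y q \<rho> (gaussian_halfspace e A) = q_stability M X Y q \<rho> A \<longrightarrow>
       emeasure std_gaussian (sym_diff A (gaussian_halfspace e A)) = 0)"
  using q_stability_halfspace[OF assms(1,2,3,4,5,6)] by blast

end
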